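(* Let $\hat R, R_1, T_0>0$, let $R>\hat R+R_1$, and set $T:=T_0+\hat R+R_1+R$. Let $\Gamma_R=\{\boldsymbol x\in\mathbb R^3:|\boldsymbol x|=R\}$ with unit normal vector $\boldsymbol\nu$, and let $\Gamma\subset\Gamma_R$ be a (relatively) open subset of positive Lebesgue (surface) measure. Let $\boldsymbol a\in C^1(\mathbb R_+;\mathbb R^3)$ satisfy $|\boldsymbol a(t)|<R_1$ for all $t\in\mathbb R_+$, and let $g\in C^1(\mathbb R_+;\mathbb R)$ satisfy $g(t)=0$ for $t\ge T_0$ and for $t\le 0$, together with $\int_0^{T_0}g(t)\,{\rm d}t\neq 0$. Then, $\boldsymbol a$ and $g$ being given, the source profile function $\boldsymbol J$ is uniquely determined by the data $\{\boldsymbol E(\boldsymbol x,t)\times\boldsymbol\nu:\boldsymbol x\in\Gamma,\ t\in(0,T)\}$. That is: let $\boldsymbol J_1,\boldsymbol J_2\in H^2(\mathbb R^3)^3$ be two $\mathbb R^3$-valued functions, compactly supported in $B_{\hat R}=\{\boldsymbol x:|\boldsymbol x|<\hat R\}$ and with $\mathrm{div}\,\boldsymbol J_i=0$ in $\mathbb R^3$, and for $i=1,2$ let $\boldsymbol E_i$ be the solution of $$\partial_t^2\boldsymbol E_i(\boldsymbol x,t)+\nabla\times(\nabla\times\boldsymbol E_i(\boldsymbol x,t))=\boldsymbol J_i(\boldsymbol x-\boldsymbol a(t))\,g(t),\quad \boldsymbol x\in\mathbb R^3,\ t>0,\qquad \boldsymbol E_i(\boldsymbol x,0)=\partial_t\boldsymbol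 E_i(\boldsymbol x,0)=0,\quad \boldsymbol x\in\mathbb R^3 .$$ If $\boldsymbol E_1(\boldsymbol x,t)\times\boldsymbol\nu=\boldsymbol E_2(\boldsymbol x,t)\times\boldsymbol\nu$ for all $\boldsymbol x\in\Gamma$ and $t\in(0,T)$, then $\boldsymbol J_1=\boldsymbol J_2$.
   Context: $\mathbb R_+$ denotes the nonnegative time half-line and $B_r$ the open ball of radius $r$ in $\mathbb R^3$ centred at the origin. For sources as in the claim, "the solution" of the initial value problem for the Maxwell system means the unique solution with $\boldsymbol E\in C([0,\tau];H^2(\mathbb R^3))^3\cap C^2([0,\tau];L^2(\mathbb R^3))^3$ for every $\tau>0$. Since the profile is divergence free, $\nabla\cdot\boldsymbol E=0$, and the system is equivalent to the componentwise wave equation $\partial_t^2\boldsymbol E-\Delta\boldsymbol E=\boldsymbol J(\boldsymbol x-\boldsymbol a(t))g(t)$ with zero initial data. *)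

theory Defs
  imports "HOL-Analysis.Analysis"
begin

section \<open>Sobolev space $H^2$ of vector fields on three-space\<close>

text \<open>
  Elements of $L^2$ and $H^2$ are represented by Borel measurable functions; two functions
  stand for the same element iff they agree almost everywhere.
\<close>

type_synonym field = "real^3 \<Rightarrow> real^3"

fun partial_derivs :: "3 list \<Rightarrow> (real^3 \<Rightarrow> real) \<Rightarrow> real^3 \<Rightarrow> real" where
  "partial_derivs [] \<phi> = \<phi>"
| "partial_derivs (i # \<alpha>) \<phi> =
     (\<lambda>x. frechet_derivative (partial_derivs \<alpha> \<phi>) (at x) (axis i 1))"

definition test_function :: "(real^3 \<Rightarrow> real) \<Rightarrow> bool" where
  "test_function \<phi> \<longleftrightarrow>
     (\<forall>\<alpha>. partial_derivs \<alpha> \<phi> differentiable_on UNIV) \<and> compact (closure {x. \<phi> x \<noteq> 0})"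

definition locally_integrable :: "field \<Rightarrow> bool" where
  "locally_integrable u \<longleftrightarrow> (\<forall>K. compact K \<longrightarrow> set_integrable lborel K u)"

text \<open>
  A multi-index is a list of coordinate directions, so that mixed derivatives of order two
  occur twice in the $H^2$ norm below (which gives an equivalent norm).
\<close>

definition has_weak_deriv :: "3 list \<Rightarrow> field \<Rightarrow> field \<Rightarrow> bool" where
  "has_weak_deriv \<alpha> u v \<longleftrightarrow>
     locally_integrable u \<and> locally_integrable v \<and>
     (\<forall>\<phi>. test_function \<phi> \<longrightarrow>
        (LINT x|lborel. partial_derivs \<alpha> \<phi> x *\<^sub>R u x) =
        (-1) ^ length \<alpha> *\<^sub>R (LINT x|lborel. \<phi> x *\<^sub>R v x))"

text \<open>Weak derivatives are unique up to null sets; this picks a representative.\<close>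

definition weak_deriv :: "3 list \<Rightarrow> field \<Rightarrow> field" where
  "weak_deriv \<alpha> u = (SOME v. has_weak_deriv \<alpha> u v)"

definition L2 :: "field set" where
  "L2 = {u. u \<in> borel_measurable lborel \<and> integrable lborel (\<lambda>x. (norm (u x))\<^sup>2)}"

definition L2_norm :: "field \<Rightarrow> real" where
  "L2_norm u = sqrt (LINT x|lborel. (norm (u x))\<^sup>2)"

definition H2 :: "field set" where
  "H2 = {u \<in> L2. \<forall>\<alpha>. length \<alpha> \<le> 2 \<longrightarrow> (\<exists>v \<in> L2. has_weak_deriv \<alpha> u v)}"

definition H2_norm :: "field \<Rightarrow> real" where
  "H2_norm u = sqrt (\<Sum>\<alpha> | length \<alpha> \<le> 2. (L2_norm (weak_deriv \<alpha> u))\<^sup>2)"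

definition weak_div :: "field \<Rightarrow> real^3 \<Rightarrow> real" where
  "weak_div u x = (\<Sum>i\<in>UNIV. weak_deriv [i] u x $ i)"

definition weak_curl :: "field \<Rightarrow> field" where
  "weak_curl u x = vector
     [weak_deriv [2] u x $ 3 - weak_deriv [3] u x $ 2,
      weak_deriv [3] u x $ 1 - weak_deriv [1] u x $ 3,
      weak_deriv [1] u x $ 2 - weak_deriv [2] u x $ 1]"

definition compactly_supported_in :: "(real^3) set \<Rightarrow> field \<Rightarrow> bool" where
  "compactly_supported_in U u \<longleftrightarrow>
     (\<exists>K. compact K \<and> K \<subseteq> U \<and> (AE x in lborel. x \<notin> K \<longrightarrow> u x = 0))"

definition continuous_rep :: "field \<Rightarrow> field \<Rightarrow> bool" where
  "continuous_rep u v \<longleftrightarrow> continuous_on UNIV v \<and> (AE x in lborel. v x = u x)"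


section \<open>Functions of time with values in $L^2$ and $H^2$\<close>

definition C_H2 :: "real set \<Rightarrow> (real \<Rightarrow> field) \<Rightarrow> bool" where
  "C_H2 S u \<longleftrightarrow> (\<forall>t\<in>S. u t \<in> H2 \<and>
     ((\<lambda>s. H2_norm (\<lambda>x. u s x - u t x)) \<longlongrightarrow> 0) (at t within S))"

definition C_L2 :: "real set \<Rightarrow> (real \<Rightarrow> field) \<Rightarrow> bool" where
  "C_L2 S u \<longleftrightarrow> (\<forall>t\<in>S. u t \<in> L2 \<and>
     ((\<lambda>s. L2_norm (\<lambda>x. u s x - u t x)) \<longlongrightarrow> 0) (at t within S))"

definition has_L2_deriv :: "real set \<Rightarrow> (real \<Rightarrow> field) \<Rightarrow> (real \<Rightarrow> field) \<Rightarrow> bool" where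
  "has_L2_deriv S u u' \<longleftrightarrow> (\<forall>t\<in>S. u t \<in> L2 \<and> u' t \<in> L2 \<and>
     ((\<lambda>s. L2_norm (\<lambda>x. (1 / (s - t)) *\<^sub>R (u s x - u t x) - u' t x)) \<longlongrightarrow> 0) (at t within S))"

text \<open>Continuous differentiability on the closed half-line, one-sided at the origin.\<close>

definition C1_halfline :: "(real \<Rightarrow> 'a::real_normed_vector) \<Rightarrow> bool" where
  "C1_halfline f \<longleftrightarrow> (\<exists>f'. continuous_on {0..} f' \<and>
     (\<forall>t\<ge>0. (f has_vector_derivative f' t) (at t within {0..})))"


section \<open>The Maxwell system with a moving source\<close>

text \<open>\<open>E'\<close> and \<open>E''\<close> are the first and second time derivatives of \<open>E\<close> in $L^2$.\<close>

definition maxwell_solution ::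
    "field \<Rightarrow> (real \<Rightarrow> real^3) \<Rightarrow> (real \<Rightarrow> real) \<Rightarrow> (real \<Rightarrow> field) \<Rightarrow> bool" where
  "maxwell_solution J a g E \<longleftrightarrow> (\<exists>E' E''.
     (\<forall>\<tau>>0. C_H2 {0..\<tau>} E \<and>
            has_L2_deriv {0..\<tau>} E E' \<and> has_L2_deriv {0..\<tau>} E' E'' \<and> C_L2 {0..\<tau>} E'') \<and>
     (\<forall>t>0. AE x in lborel. E'' t x + weak_curl (weak_curl (E t)) x = g t *\<^sub>R J (x - a t)) \<and>
     (AE x in lborel. E 0 x = 0) \<and> (AE x in lborel. E' 0 x = 0))"

text \<open>
  Surface measure of a subset of the sphere of radius \<open>R\<close> about the origin in three-space:
  the solid cone over \<open>A\<close> with apex at the origin has volume \<open>R / 3\<close> times the area of \<open>A\<close>.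
\<close>

definition sphere_area :: "real \<Rightarrow> (real^3) set \<Rightarrow> real" where
  "sphere_area R A = 3 / R * measure lebesgue {r *\<^sub>R x |r x. 0 < r \<and> r \<le> 1 \<and> x \<in> A}"

text \<open>
  The values of an $H^2$ field on a surface, which is a null set, are those of its continuous
  representative; it exists by the Sobolev embedding and is unique.
\<close>

definition same_tangential_trace :: "(real^3) set \<Rightarrow> field \<Rightarrow> field \<Rightarrow> field \<Rightarrow> bool" where
  "same_tangential_trace \<Gamma> \<nu> u v \<longleftrightarrow> (\<exists>u\<^sub>c v\<^sub>c. continuous_rep u u\<^sub>c \<and> continuous_rep v v\<^sub>c \<and>
     (\<forall>x\<in>\<Gamma>. cross3 (u\<^sub>c x) (\<nu> x) = cross3 (v\<^sub>c x) (\<nu> x)))"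

end

theory Submission
  imports Defs "HOL-Complex_Analysis.Conformal_Mappings" "HOL-Real_Asymp.Real_Asymp"
begin

text \<open>
  Pair each field with the regularized advanced wave
  \<open>\<psi>(s + r\<^sub>\<epsilon>) / r\<^sub>\<epsilon>\<close>, where \<open>r\<^sub>\<epsilon> = sqrt (\<bar>y - p\<bar>\<^sup>2 + \<epsilon>\<^sup>2)\<close> and \<open>p\<close> is a point of \<open>\<Gamma>\<close>. Its wave operator is an
  approximate identity at \<open>p\<close>, so \<open>\<epsilon> \<longrightarrow> 0\<close> turns the vanishing data into the vanishing of an integral of the source
  against \<open>\<psi>(s + \<bar>y - p\<bar>) / \<bar>y - p\<bar>\<close>. By Huygens' principle this integral only sees \<open>\<psi>\<close> on \<open>[0, T)\<close>;
  there \<open>\<psi>(t) = exp (- \<kappa> t)\<close> is admissible, and the time-dependent problem collapses to a static one: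
  the Yukawa potential \<open>W\<close> of a divergence-free source has vanishing tangential trace on \<open>\<Gamma>\<close>.

  The trace vanishes on the whole sphere by analyticity along great circles. Since \<open>div W = 0\<close>, the
  scalar \<open>Q = \<bar>x\<bar> (x \<bullet> W)\<close> has zero radial derivative on the sphere, and the maximum principle gives
  \<open>Q = 0\<close> and then \<open>W = 0\<close> outside. The far field of \<open>W\<close> factors as
  \<open>(\<integral> g(s) exp (\<kappa> (\<omega> \<bullet> a(s) - s)) ds) (\<integral> J(y) exp (\<kappa> \<omega> \<bullet> y) dy)\<close>; for small \<open>\<kappa>\<close> the first factor is nonzero, so the
  Laplace transform of \<open>J\<close> vanishes near the origin, hence everywhere, and \<open>J = 0\<close>.
\<close>


section \<open>Smooth radial test functions\<close>

text \<open>The length of \<open>T\<close> makes the exponential admissible. At the source,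
  \<open>s + \<bar>y - p\<bar>\<close> is at most \<open>T\<^sub>0 + D + R\<close>, where
  \<open>D\<close> bounds the moving support and is strictly below \<open>Rhat + R\<^sub>1\<close>;
  the gap up to \<open>T\<close> leaves room to bend the exponential smoothly to zero. The cutoff
  also removes the boundary terms at time \<open>T\<close>, so nothing about the fields after
  \<open>T\<close> enters. The obstacle in the static problem is that a tangential trace is not a
  Dirichlet datum for the Cartesian components of \<open>W\<close>, so the maximum principle cannot
  be applied to them at once. Outside the source the scalar \<open>x \<bullet> W\<close> is again a
  Yukawa potential, because the Laplacian minus \<open>\<kappa>\<^sup>2\<close> maps it to
  \<open>2 div W = 0\<close>. On the sphere \<open>W\<close> is normal and divergence free, which
  forces the radial derivative of its normal component to be \<open>- 2 / R\<close> times that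
  component; the weight |x| in \<open>Q\<close> is the one for which this cancels. Only after
  \<open>x \<bullet> W = 0\<close> do all components have zero boundary values.\<close>

inductive_set fun_algebra :: "('a \<Rightarrow> real) set \<Rightarrow> ('a \<Rightarrow> real) set" for At where
  atom: "f \<in> At \<Longrightarrow> f \<in> fun_algebra At"
| const: "(\<lambda>_. c) \<in> fun_algebra At"
| add: "f \<in> fun_algebra At \<Longrightarrow> g \<in> fun_algebra At \<Longrightarrow> (\<lambda>x. f x + g x) \<in> fun_algebra At"
| mult: "f \<in> fun_algebra At \<Longrightarrow> g \<in> fun_algebra At \<Longrightarrow> (\<lambda>x. f x * g x) \<in> fun_algebra At"

lemma fun_algebra_power:
  assumes "f \<in> fun_algebra At"
  shows "(\<lambda>x. f x ^ n) \<in> fun_algebra At"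
proof (induction n)
  case 0
  show ?case using fun_algebra.const[of 1] by simp
next
  case (Suc n)
  show ?case using fun_algebra.mult[OF assms Suc] by simp
qed

lemma fun_algebra_cmult:
  assumes "f \<in> fun_algebra At"
  shows "(\<lambda>x. c * f x) \<in> fun_algebra At"
  using fun_algebra.mult[OF fun_algebra.const assms] .

text \<open>A smooth function is carried together with its derivatives, \<open>P 0\<close> being the
  function itself, since gradients and the wave operator refer to \<open>P 1\<close> and
  \<open>P 2\<close> by name.\<close>

definition derivative_tower :: "(nat \<Rightarrow> real \<Rightarrow> real) \<Rightarrow> bool" where
  "derivative_tower P \<longleftrightarrow> (\<forall>n x. (P n has_real_derivative P (Suc n) x) (at x))"

text \<open>Smoothness of all orders is reduced to one derivative per atom: sums and products follow
  from the Leibniz rule, and the derivative found lies in the algebra again, so it can be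
  differentiated in turn.\<close>

lemma fun_algebra_deriv:
  assumes At: "\<And>f. f \<in> At \<Longrightarrow> \<exists>f'\<in>fun_algebra At. \<forall>x. (f has_real_derivative f' x) (at x)"
    and "f \<in> fun_algebra At"
  shows "\<exists>f'\<in>fun_algebra At. \<forall>x. (f has_real_derivative f' x) (at x)"
  using assms(2)
proof induction
  case (atom f)
  then show ?case using At by blast
next
  case (const c)
  show ?case by (rule bexI[OF _ fun_algebra.const[of 0]]) auto
next
  case (add f g)
  then obtain f' g' where "f' \<in> fun_algebra At" "\<forall>x. (f has_real_derivative f' x) (at x)"
    "g' \<in> fun_algebra At" "\<forall>x. (g has_real_derivative g' x) (at x)" by blast
  then show ?case
    by (intro bexI[where x = "\<lambda>x. f' x + g' x"]) (auto intro!: derivative_intros fun_algebra.add)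
next
  case (mult f g)
  then obtain f' g' where fg: "f' \<in> fun_algebra At" "\<forall>x. (f has_real_derivative f' x) (at x)"
    "g' \<in> fun_algebra At" "\<forall>x. (g has_real_derivative g' x) (at x)" by blast
  show ?case
  proof (rule bexI[where x = "\<lambda>x. f' x * g x + g' x * f x"])
    show "(\<lambda>x. f' x * g x + g' x * f x) \<in> fun_algebra At"
      using fg mult by (intro fun_algebra.add fun_algebra.mult)
    show "\<forall>x. ((\<lambda>x. f x * g x) has_real_derivative f' x * g x + g' x * f x) (at x)"
      using fg by (auto intro!: DERIV_mult)
  qed
qed

text \<open>Dependent choice picks the successive derivatives; membership in the algebra is the
  invariant that guarantees the next one.\<close>

lemma fun_algebra_tower:
  assumes At: "\<And>f. f \<in> At \<Longrightarrow> \<exists>f'\<in>fun_algebra At. \<forall>x. (f has_real_derivative f' x) (at x)"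
    and f: "f \<in> fun_algebra At"
  shows "\<exists>P. P 0 = f \<and> derivative_tower P"
proof -
  have "\<exists>P. \<forall>n. (P n \<in> fun_algebra At \<and> (n = 0 \<longrightarrow> P n = f)) \<and>
    (\<forall>x. (P n has_real_derivative P (Suc n) x) (at x))"
  proof (rule dependent_nat_choice)
    show "\<exists>g. g \<in> fun_algebra At \<and> (0 = (0::nat) \<longrightarrow> g = f)" using f by auto
    fix g and n :: nat
    assume "g \<in> fun_algebra At \<and> (n = 0 \<longrightarrow> g = f)"
    then show "\<exists>g'. (g' \<in> fun_algebra At \<and> (Suc n = 0 \<longrightarrow> g' = f)) \<and>
        (\<forall>x. (g has_real_derivative g' x) (at x))"
      using fun_algebra_deriv[OF At] by blast
  qed
  then obtain P where "\<forall>n. (P n \<in> fun_algebra At \<and> (n = 0 \<longrightarrow> P n = f)) \<and>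
    (\<forall>x. (P n has_real_derivative P (Suc n) x) (at x))" by blast
  then show ?thesis unfolding derivative_tower_def by (intro exI[of _ P]) auto
qed

text \<open>The powers of 1/x in front of the classical flat function exp(-1/x) make the family
  closed under differentiation.\<close>

definition flat_exp :: "nat \<Rightarrow> real \<Rightarrow> real" where
  "flat_exp k x = (if x \<le> 0 then 0 else inverse x ^ k * exp (- inverse x))"

lemma power_over_fact_le_exp:
  fixes x :: real assumes "x \<ge> 0" shows "x ^ n / fact n \<le> exp x"
  using sum_le_suminf[OF summable_exp_generic[of x], of "{n}"] assms
  by (simp add: exp_def divide_inverse mult.commute)

text \<open>One term of the exponential series at 1/x, taken of order \<open>k + 2\<close>, leaves
  two powers of x to spare. The quadratic bound yields a vanishing derivative at the origin.\<close>

lemma flat_exp_bound: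
  assumes "x > 0" shows "\<bar>flat_exp k x\<bar> \<le> fact (k + 2) * x\<^sup>2"
proof -
  have le: "inverse x ^ (k+2) \<le> fact (k+2) * exp (inverse x)"
    using power_over_fact_le_exp[of "inverse x" "k+2"] assms by (simp add: pos_divide_le_eq mult.commute)
  have "\<bar>flat_exp k x\<bar> = inverse x ^ (k+2) * x\<^sup>2 * exp (- inverse x)"
    using assms by (simp add: flat_exp_def power_add field_simps power2_eq_square)
  also have "\<dots> \<le> fact (k+2) * exp (inverse x) * x\<^sup>2 * exp (- inverse x)"
    using le by (intro mult_right_mono) auto
  also have "\<dots> = fact (k+2) * x\<^sup>2" by (simp add: exp_minus)
  finally show ?thesis .
qed

lemma flat_exp_deriv:
  "(flat_exp k has_real_derivative (- real k * flat_exp (Suc k) x + flat_exp (k + 2) x)) (at x)"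
proof -
  consider "x > 0" | "x < 0" | "x = 0" by linarith
  then show ?thesis
  proof cases
    case 1
    have "((\<lambda>x. inverse x ^ k * exp (- inverse x)) has_real_derivative
       (- real k * flat_exp (Suc k) x + flat_exp (k + 2) x)) (at x)"
      using 1 by (auto intro!: derivative_eq_intros simp: flat_exp_def power2_eq_square)
        (cases k; simp add: algebra_simps divide_simps)
    moreover have "eventually (\<lambda>y. y > 0) (nhds x)" using 1 eventually_nhds_in_open[OF open_greaterThan, of x 0] by simp
    then have "eventually (\<lambda>y. flat_exp k y = inverse y ^ k * exp (- inverse y)) (nhds x)"
      by eventually_elim (auto simp: flat_exp_def)
    ultimately show ?thesis by (simp add: DERIV_cong_ev)
  next
    case 2
    have "eventually (\<lambda>y. y < 0) (nhds x)" using 2 eventually_nhds_in_open[OF open_lessThan, of x 0] by simp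
    then have "eventually (\<lambda>y. flat_exp k y = 0) (nhds x)"
      by eventually_elim (auto simp: flat_exp_def)
    then show ?thesis using 2 DERIV_cong_ev[of x x "flat_exp k" "\<lambda>_. 0" 0 0] by (simp add: flat_exp_def)
  next
    case 3
    have "((\<lambda>h. flat_exp k h / h) \<longlongrightarrow> 0) (at 0)"
    proof (rule Lim_null_comparison)
      show "eventually (\<lambda>h. norm (flat_exp k h / h) \<le> fact (k+2) * \<bar>h\<bar>) (at 0)"
      proof (rule eventuallyI)
        fix h :: real
        show "norm (flat_exp k h / h) \<le> fact (k+2) * \<bar>h\<bar>"
        proof (cases "h > 0")
          case False
          have "0 \<le> (fact (k+2) :: real) * \<bar>h\<bar>" by (intro mult_nonneg_nonneg) auto
          then show ?thesis using False by (simp only: flat_exp_def not_less if_True) simp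
        next
          case True
          then have "\<bar>flat_exp k h\<bar> / h \<le> (fact (k+2) * h\<^sup>2) / h"
            by (intro divide_right_mono flat_exp_bound) auto
          then show ?thesis using True by (simp add: power2_eq_square)
        qed
      qed
      show "((\<lambda>h::real. fact (k+2) * \<bar>h\<bar>) \<longlongrightarrow> 0) (at 0)"
        by (auto intro!: tendsto_eq_intros)
    qed
    then show ?thesis using 3 by (simp add: DERIV_def flat_exp_def)
  qed
qed

text \<open>With b(x) = exp(-1/x) for positive x and 0 otherwise, the quotient b(T - t) / (b(T - t)
  + b(t - T1)) is the classical smooth step; it multiplies the exponential. The denominator is
  positive because one of its terms is positive for every t.\<close>

lemma ex_smooth_cutoff:
  assumes "T1 < T"
  shows "\<exists>P. derivative_tower P \<and> (\<forall>t\<le>T1. P 0 t = exp (- \<kappa> * t)) \<and> (\<forall>t\<ge>T. P 0 t = 0)"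
proof -
  define den where "den = (\<lambda>t. flat_exp 0 (T - t) + flat_exp 0 (t - T1))"
  have den: "den t > 0" for t
    using assms unfolding den_def flat_exp_def by (cases "t < T"; cases "t > T1") (auto simp: add_pos_pos)
  \<comment> \<open>The reciprocal of \<open>den\<close> is an atom of its own: its derivative is
    -den' / den^2, a polynomial in the atoms.\<close>
  define At where "At = {(\<lambda>t. flat_exp k (T - t)) |k. True} \<union> {(\<lambda>t. flat_exp k (t - T1)) |k. True} \<union>
    {\<lambda>t. inverse (den t), \<lambda>t. exp (- \<kappa> * t)}"
  have a1: "(\<lambda>t. flat_exp k (T - t)) \<in> fun_algebra At" and a2: "(\<lambda>t. flat_exp k (t - T1)) \<in> fun_algebra At"
    and a3: "(\<lambda>t. inverse (den t)) \<in> fun_algebra At" and a4: "(\<lambda>t. exp (- \<kappa> * t)) \<in> fun_algebra At" for k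
    by (rule fun_algebra.atom, force simp: At_def)+
  have d1: "((\<lambda>t. flat_exp k (T - t)) has_real_derivative
     (-1) * (- real k * flat_exp (Suc k) (T - t) + flat_exp (k + 2) (T - t))) (at t)" for k t
  proof -
    have "((\<lambda>t. T - t) has_real_derivative -1) (at t)" by (auto intro!: derivative_eq_intros)
    from DERIV_chain2[OF flat_exp_deriv this, of k] show ?thesis by simp
  qed
  have d2: "((\<lambda>t. flat_exp k (t - T1)) has_real_derivative
     (- real k * flat_exp (Suc k) (t - T1) + flat_exp (k + 2) (t - T1))) (at t)" for k t
  proof -
    have "((\<lambda>t. t - T1) has_real_derivative 1) (at t)" by (auto intro!: derivative_eq_intros)
    from DERIV_chain2[OF flat_exp_deriv this, of k] show ?thesis by simp
  qed
  have dd: "(den has_real_derivative (-1) * (- real 0 * flat_exp (Suc 0) (T - t) + flat_exp (0 + 2) (T - t))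
      + (- real 0 * flat_exp (Suc 0) (t - T1) + flat_exp (0 + 2) (t - T1))) (at t)" for t
    unfolding den_def by (intro DERIV_add d1 d2)
  have "\<exists>f'\<in>fun_algebra At. \<forall>x. (f has_real_derivative f' x) (at x)" if "f \<in> At" for f
  proof -
    consider k where "f = (\<lambda>t. flat_exp k (T - t))" | k where "f = (\<lambda>t. flat_exp k (t - T1))"
      | "f = (\<lambda>t. inverse (den t))" | "f = (\<lambda>t. exp (- \<kappa> * t))" using \<open>f \<in> At\<close> by (auto simp: At_def)
    then show ?thesis
    proof cases
      case 1
      show ?thesis unfolding 1
        by (rule bexI, rule allI, rule d1) (intro fun_algebra.add fun_algebra_cmult a1)
    next
      case 2
      show ?thesis unfolding 2
        by (rule bexI, rule allI, rule d2) (intro fun_algebra.add fun_algebra_cmult a2)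
    next
      case 3
      show ?thesis unfolding 3
      proof (rule bexI, rule allI)
        fix t
        show "((\<lambda>t. inverse (den t)) has_real_derivative
          (-1) * (((-1) * (- real 0 * flat_exp (Suc 0) (T - t) + flat_exp (0 + 2) (T - t))
      + (- real 0 * flat_exp (Suc 0) (t - T1) + flat_exp (0 + 2) (t - T1))) * inverse (den t) ^ 2)) (at t)"
          using DERIV_inverse_fun[OF dd, of t] den[of t] by (simp add: power_inverse numeral_2_eq_2)
      qed (intro fun_algebra.add fun_algebra.mult fun_algebra_cmult fun_algebra_power fun_algebra.const a1 a2 a3)
    next
      case 4
      show ?thesis unfolding 4
      proof (rule bexI, rule allI)
        fix t
        show "((\<lambda>t. exp (- \<kappa> * t)) has_real_derivative (- \<kappa>) * exp (- \<kappa> * t)) (at t)"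
          by (auto intro!: derivative_eq_intros)
      qed (intro fun_algebra_cmult a4)
    qed
  qed
  then obtain P where P: "P 0 = (\<lambda>t. exp (- \<kappa> * t) * (flat_exp 0 (T - t) * inverse (den t)))" "derivative_tower P"
    using fun_algebra_tower[of At "\<lambda>t. exp (- \<kappa> * t) * (flat_exp 0 (T - t) * inverse (den t))"]
      fun_algebra.mult[OF a4 fun_algebra.mult[OF a1 a3]] by blast
  have "P 0 t = exp (- \<kappa> * t)" if "t \<le> T1" for t
    using den[of t] that unfolding P by (simp add: den_def flat_exp_def)
  moreover have "P 0 t = 0" if "t \<ge> T" for t
    using that unfolding P by (simp add: flat_exp_def)
  ultimately show ?thesis using P by blast
qed

text \<open>Equality on an open set is equality near each of its points, so it passes to the next
  derivative. This identifies the derivatives of the cutoff where it is zero or exponential.\<close>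

lemma derivative_tower_eq_on_open:
  assumes P: "derivative_tower P" and Q: "derivative_tower Q" and "open S"
    and eq: "\<And>t. t \<in> S \<Longrightarrow> P 0 t = Q 0 t" and "t \<in> S"
  shows "P n t = Q n t"
  using \<open>t \<in> S\<close>
proof (induction n arbitrary: t)
  case 0 then show ?case using eq by simp
next
  case (Suc n)
  have "eventually (\<lambda>y. P n y = Q n y) (nhds t)"
    using eventually_nhds_in_open[OF \<open>open S\<close> Suc.prems] Suc.IH by (rule eventually_mono)
  then have "(Q n has_real_derivative P (Suc n) t) (at t)"
    using P DERIV_cong_ev[OF refl _ refl] unfolding derivative_tower_def by blast
  then show ?case using Q DERIV_unique unfolding derivative_tower_def by blast
qed

section \<open>Partial derivatives in function algebras closed under gradients\<close>

definition pd :: "3 \<Rightarrow> (real^3 \<Rightarrow> real) \<Rightarrow> real^3 \<Rightarrow> real" where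
  "pd i f x = frechet_derivative f (at x) (axis i 1)"

lemma partial_derivs_Cons: "partial_derivs (i # \<alpha>) f = pd i (partial_derivs \<alpha> f)"
  by (auto simp: pd_def)

lemma partial_derivs_append: "partial_derivs (\<alpha> @ \<beta>) f = partial_derivs \<alpha> (partial_derivs \<beta> f)"
  by (induction \<alpha>) (auto simp: partial_derivs_Cons simp del: partial_derivs.simps(2))

lemma pd_eqI:
  assumes "\<And>x. (f has_derivative (\<lambda>v. g x \<bullet> v)) (at x)"
  shows "pd i f = (\<lambda>x. g x $ i)"
proof
  fix x show "pd i f x = g x $ i"
    unfolding pd_def frechet_derivative_at[OF assms[of x], symmetric]
    by (simp add: inner_axis)
qed

text \<open>The closure hypothesis in several variables: each atom has a gradient whose components
  stay in the algebra, and this propagates to derivatives of every order.\<close>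

definition moderately_smooth :: "(real^3 \<Rightarrow> real) set \<Rightarrow> bool" where
  "moderately_smooth At \<longleftrightarrow> (\<forall>f\<in>At. \<exists>g. (\<forall>i. (\<lambda>x. g x $ i) \<in> fun_algebra At) \<and>
     (\<forall>x. (f has_derivative (\<lambda>v. g x \<bullet> v)) (at x)))"

lemma fun_algebra_gradient:
  assumes At: "moderately_smooth At" and "f \<in> fun_algebra At"
  shows "\<exists>g. (\<forall>i. (\<lambda>x. g x $ i) \<in> fun_algebra At) \<and> (\<forall>x. (f has_derivative (\<lambda>v. g x \<bullet> v)) (at x))"
  using assms(2)
proof induction
  case (atom f)
  then show ?case using At unfolding moderately_smooth_def by blast
next
  case (const c)
  show ?case by (rule exI[of _ "\<lambda>_. 0"]) (auto intro: fun_algebra.const)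
next
  case (add f1 f2)
  then obtain g1 g2 where "\<forall>i. (\<lambda>x. g1 x $ i) \<in> fun_algebra At" "\<forall>x. (f1 has_derivative (\<lambda>v. g1 x \<bullet> v)) (at x)"
    "\<forall>i. (\<lambda>x. g2 x $ i) \<in> fun_algebra At" "\<forall>x. (f2 has_derivative (\<lambda>v. g2 x \<bullet> v)) (at x)" by blast
  then show ?case
    by (intro exI[of _ "\<lambda>x. g1 x + g2 x"]) (auto simp: inner_add_left intro!: fun_algebra.add has_derivative_add)
next
  case (mult f1 f2)
  then obtain g1 g2 where "\<forall>i. (\<lambda>x. g1 x $ i) \<in> fun_algebra At" "\<And>x. (f1 has_derivative (\<lambda>v. g1 x \<bullet> v)) (at x)"
    "\<forall>i. (\<lambda>x. g2 x $ i) \<in> fun_algebra At" "\<And>x. (f2 has_derivative (\<lambda>v. g2 x \<bullet> v)) (at x)" by blast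
  then show ?case using mult.hyps
    by (intro exI[of _ "\<lambda>x. f1 x *\<^sub>R g2 x + f2 x *\<^sub>R g1 x"])
      (auto simp: inner_add_left intro!: fun_algebra.add fun_algebra.mult derivative_eq_intros)
qed

lemma fun_algebra_pd:
  assumes "moderately_smooth At" "f \<in> fun_algebra At"
  shows "pd i f \<in> fun_algebra At"
  using fun_algebra_gradient[OF assms] pd_eqI by metis

lemma fun_algebra_differentiable:
  assumes "moderately_smooth At" "f \<in> fun_algebra At"
  shows "f differentiable (at x)"
  using fun_algebra_gradient[OF assms] differentiable_def by blast

lemma fun_algebra_partial_derivs:
  assumes "moderately_smooth At" "f \<in> fun_algebra At"
  shows "partial_derivs \<alpha> f \<in> fun_algebra At"
  by (induction \<alpha>) (auto simp: partial_derivs_Cons assms fun_algebra_pd simp del: partial_derivs.simps(2))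

lemma fun_algebra_test_function:
  assumes "moderately_smooth At" "f \<in> fun_algebra At" and "\<And>y. \<rho> < norm (y - x0) \<Longrightarrow> f y = 0"
  shows "test_function f"
  unfolding test_function_def
proof (intro conjI allI)
  show "partial_derivs \<alpha> f differentiable_on UNIV" for \<alpha>
    using fun_algebra_differentiable[OF assms(1) fun_algebra_partial_derivs[OF assms(1,2)]]
    by (simp add: differentiable_on_def)
  have "{y. f y \<noteq> 0} \<subseteq> cball x0 \<rho>"
    using assms(3) by (force simp: dist_norm norm_minus_commute)
  then show "compact (closure {y. f y \<noteq> 0})"
    by (meson bounded_cball bounded_subset compact_closure)
qed

lemma pd_add:
  assumes "f differentiable (at x)" "g differentiable (at x)"
  shows "pd i (\<lambda>y. f y + g y) x = pd i f x + pd i g x"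
  unfolding pd_def
  using has_derivative_add[OF assms[unfolded frechet_derivative_works]]
  by (simp add: frechet_derivative_at[symmetric])

lemma pd_mult:
  assumes "f differentiable (at x)" "g differentiable (at x)"
  shows "pd i (\<lambda>y. f y * g y) x = f x * pd i g x + pd i f x * g x"
  unfolding pd_def
  using has_derivative_mult[OF assms[unfolded frechet_derivative_works]]
  by (simp add: frechet_derivative_at[symmetric])

lemma pd_const [simp]: "pd i (\<lambda>_. c) = (\<lambda>_. 0)"
  by (auto simp: pd_def)

text \<open>Symmetry of mixed derivatives spreads from the atoms to the algebra, because the Leibniz
  expansion of a second derivative of a product is symmetric in \<open>i\<close> and
  \<open>j\<close> once both factors are.\<close>

lemma fun_algebra_pd_commute:
  assumes At: "moderately_smooth At"
    and atoms: "\<And>f. f \<in> At \<Longrightarrow> pd i (pd j f) = pd j (pd i f)"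
    and "f \<in> fun_algebra At"
  shows "pd i (pd j f) = pd j (pd i f)"
  using assms(3)
proof induction
  case (atom f)
  then show ?case using atoms by blast
next
  case (const c)
  show ?case by simp
next
  case (add f g)
  note d = fun_algebra_differentiable[OF At]
  have *: "pd i (\<lambda>y. f y + g y) = (\<lambda>y. pd i f y + pd i g y)" for i
    using pd_add d add.hyps by blast
  show ?case unfolding *
    by (auto simp: fun_eq_iff pd_add d fun_algebra_pd[OF At] add)
next
  case (mult f g)
  note d = fun_algebra_differentiable[OF At]
  have *: "pd i (\<lambda>y. f y * g y) = (\<lambda>y. f y * pd i g y + pd i f y * g y)" for i
    using pd_mult d mult.hyps by blast
  note m = mult.hyps fun_algebra_pd[OF At mult.hyps(1)] fun_algebra_pd[OF At mult.hyps(2)]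
  show ?case unfolding *
    by (auto simp: fun_eq_iff pd_add pd_mult d m fun_algebra.mult algebra_simps mult.IH)
qed

section \<open>The regularized distance and the Laplacian of a radial wave\<close>

definition radius :: "real^3 \<Rightarrow> real \<Rightarrow> real^3 \<Rightarrow> real" where
  "radius x0 \<epsilon> y = sqrt ((norm (y - x0))\<^sup>2 + \<epsilon>\<^sup>2)"

locale radial_profile =
  fixes P :: "nat \<Rightarrow> real \<Rightarrow> real" and x0 :: "real^3" and \<epsilon> s :: real
  assumes tower: "derivative_tower P" and eps: "\<epsilon> > 0"
begin

abbreviation rad :: "real^3 \<Rightarrow> real" where
  "rad \<equiv> radius x0 \<epsilon>"

text \<open>The gradient of \<open>rad\<close> is \<open>(y - x0) / rad y\<close>, so profiles, the
  reciprocal radius and the coordinates generate an algebra closed under gradients.\<close>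

definition atoms :: "(real^3 \<Rightarrow> real) set" where
  "atoms = {(\<lambda>y. P n (s + rad y)) |n. True} \<union> {\<lambda>y. inverse (rad y)} \<union> {(\<lambda>y. (y - x0) $ i) |i. True}"

lemma rad_pos: "rad y > 0" and rad_ge: "rad y \<ge> \<epsilon>" and rad_ge_norm: "rad y \<ge> norm (y - x0)"
  and rad_sq: "(rad y)\<^sup>2 = (norm (y - x0))\<^sup>2 + \<epsilon>\<^sup>2"
  using eps by (auto simp: radius_def intro!: real_le_rsqrt add_nonneg_pos)

lemma has_derivative_rad:
  "(rad has_derivative (\<lambda>v. (inverse (rad y) *\<^sub>R (y - x0)) \<bullet> v)) (at y)"
proof -
  have pos: "(norm (y - x0))\<^sup>2 + \<epsilon>\<^sup>2 > 0" using eps by (intro add_nonneg_pos) auto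
  have d: "((\<lambda>y. (y - x0) \<bullet> (y - x0) + \<epsilon>\<^sup>2) has_derivative (\<lambda>v. 2 * ((y - x0) \<bullet> v))) (at y)"
    by (auto intro!: derivative_eq_intros simp: inner_commute)
  have "((\<lambda>y. sqrt ((y - x0) \<bullet> (y - x0) + \<epsilon>\<^sup>2)) has_derivative
      (\<lambda>v. 2 * ((y - x0) \<bullet> v) * (inverse (sqrt ((y - x0) \<bullet> (y - x0) + \<epsilon>\<^sup>2)) / 2))) (at y)"
    by (rule has_derivative_real_sqrt[OF _ d]) (use pos in \<open>simp add: power2_norm_eq_inner\<close>)
  then show ?thesis by (simp add: radius_def[abs_def] power2_norm_eq_inner mult.commute)
qed

lemma has_derivative_profile:
  "((\<lambda>y. P n (s + rad y)) has_derivative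
     (\<lambda>v. ((P (Suc n) (s + rad y) * inverse (rad y)) *\<^sub>R (y - x0)) \<bullet> v)) (at y)"
proof -
  have "(P n has_derivative (\<lambda>h. P (Suc n) (s + rad y) * h)) (at (s + rad y))"
    using tower by (simp add: derivative_tower_def has_field_derivative_def)
  moreover have "((\<lambda>y. s + rad y) has_derivative (\<lambda>v. (inverse (rad y) *\<^sub>R (y - x0)) \<bullet> v)) (at y)"
    using has_derivative_add[OF has_derivative_const has_derivative_rad] by simp
  ultimately show ?thesis
    using has_derivative_compose[of "\<lambda>y. s + rad y" _ y UNIV "P n"] by (simp add: mult.assoc)
qed

lemma has_derivative_inverse_rad:
  "((\<lambda>y. inverse (rad y)) has_derivative (\<lambda>v. (- (inverse (rad y) ^ 3) *\<^sub>R (y - x0)) \<bullet> v)) (at y)"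
  using Deriv.has_derivative_inverse[OF _ has_derivative_rad, of y] rad_pos[of y]
  by (simp add: power3_eq_cube mult_ac)

lemma has_derivative_coord: "((\<lambda>y. (y - x0) $ i) has_derivative (\<lambda>v. axis i 1 \<bullet> v)) (at y)"
  using bounded_linear_imp_has_derivative[OF bounded_linear_vec_nth]
  by (auto intro!: derivative_eq_intros simp: inner_axis')

lemma atom_profile: "(\<lambda>y. P n (s + rad y)) \<in> fun_algebra atoms"
  and atom_inverse: "(\<lambda>y. inverse (rad y)) \<in> fun_algebra atoms"
  and atom_coord: "(\<lambda>y. (y - x0) $ i) \<in> fun_algebra atoms"
  by (rule fun_algebra.atom, force simp: atoms_def)+

lemma atoms_smooth: "moderately_smooth atoms"
  unfolding moderately_smooth_def
proof
  fix f assume "f \<in> atoms"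
  then consider n where "f = (\<lambda>y. P n (s + rad y))" | "f = (\<lambda>y. inverse (rad y))" | i where "f = (\<lambda>y. (y - x0) $ i)"
    by (auto simp: atoms_def)
  then show "\<exists>g. (\<forall>i. (\<lambda>x. g x $ i) \<in> fun_algebra atoms) \<and> (\<forall>x. (f has_derivative (\<lambda>v. g x \<bullet> v)) (at x))"
  proof cases
    case 1
    show ?thesis unfolding 1
      by (rule exI, rule conjI[OF _ allI[OF has_derivative_profile]])
        (simp, intro allI fun_algebra.mult atom_profile atom_inverse atom_coord[simplified])
  next
    case 2
    show ?thesis unfolding 2
      by (rule exI, rule conjI[OF _ allI[OF has_derivative_inverse_rad]])
        (auto intro!: fun_algebra.mult fun_algebra_cmult[where c="-1", simplified] fun_algebra_power atom_inverse atom_coord[simplified])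
  next
    case 3
    show ?thesis unfolding 3
      by (rule exI, rule conjI[OF _ allI[OF has_derivative_coord]]) (auto intro: fun_algebra.const)
  qed
qed

lemma pd_profile: "pd i (\<lambda>y. P n (s + rad y)) = (\<lambda>y. P (Suc n) (s + rad y) * inverse (rad y) * (y - x0) $ i)"
  using pd_eqI[OF has_derivative_profile] by simp

lemma pd_inverse: "pd i (\<lambda>y. inverse (rad y)) = (\<lambda>y. - (inverse (rad y) ^ 3 * (y - x0) $ i))"
  using pd_eqI[OF has_derivative_inverse_rad] by simp

lemma pd_coord: "pd i (\<lambda>y. (y - x0) $ j) = (\<lambda>y. if i = j then 1 else 0)"
  using pd_eqI[OF has_derivative_coord] by (simp add: axis_def)

lemmas d = fun_algebra_differentiable[OF atoms_smooth]
lemmas atom_intros = fun_algebra.mult fun_algebra.add fun_algebra_power fun_algebra_cmult atom_profile atom_inverse atom_coord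

lemma pd_prod: "f \<in> fun_algebra atoms \<Longrightarrow> g \<in> fun_algebra atoms \<Longrightarrow>
   pd i (\<lambda>y. f y * g y) = (\<lambda>y. f y * pd i g y + pd i f y * g y)"
  by (auto simp: fun_eq_iff intro!: pd_mult d)

lemma pd_prod3: "f \<in> fun_algebra atoms \<Longrightarrow> g \<in> fun_algebra atoms \<Longrightarrow> h \<in> fun_algebra atoms \<Longrightarrow>
   pd i (\<lambda>y. f y * g y * h y) = (\<lambda>y. f y * g y * pd i h y + f y * pd i g y * h y + pd i f y * g y * h y)"
  by (simp add: pd_prod fun_algebra.mult algebra_simps)

lemma pd_neg: "f \<in> fun_algebra atoms \<Longrightarrow> pd i (\<lambda>y. - f y) = (\<lambda>y. - pd i f y)"
  using pd_prod[OF fun_algebra.const[of "-1"], of f i] by simp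

lemma pd_cube: "pd i (\<lambda>y. inverse (rad y) ^ 3) = (\<lambda>y. - (3 * inverse (rad y) ^ 5 * (y - x0) $ i))"
proof -
  have "pd i (\<lambda>y. inverse (rad y) ^ 3) = pd i (\<lambda>y. inverse (rad y) * (inverse (rad y) * inverse (rad y)))"
    by (simp add: power3_eq_cube mult.assoc)
  also have "\<dots> = (\<lambda>y. - (3 * inverse (rad y) ^ 5 * (y - x0) $ i))"
    by (subst pd_prod, (intro atom_intros)+, subst pd_prod, (intro atom_intros)+)
      (simp add: pd_inverse fun_eq_iff algebra_simps eval_nat_numeral)
  finally show ?thesis .
qed

lemma pd_commute:
  assumes "f \<in> fun_algebra atoms" shows "pd i (pd j f) = pd j (pd i f)"
proof (rule fun_algebra_pd_commute[OF atoms_smooth _ assms])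
  fix f assume "f \<in> atoms"
  then consider n where "f = (\<lambda>y. P n (s + rad y))" | "f = (\<lambda>y. inverse (rad y))" | i where "f = (\<lambda>y. (y - x0) $ i)"
    by (auto simp: atoms_def)
  then show "pd i (pd j f) = pd j (pd i f)"
  proof cases
    case 1
    show ?thesis unfolding 1 pd_profile
      unfolding pd_prod3[OF atom_profile atom_inverse atom_coord] pd_profile pd_inverse pd_coord
      by (auto simp: fun_eq_iff algebra_simps)
  next
    case 2
    have *: "(\<lambda>y. inverse (rad y) ^ 3 * (y - x0) $ i) \<in> fun_algebra atoms" for i by (intro atom_intros)
    show ?thesis unfolding 2 pd_inverse
      unfolding pd_neg[OF *] pd_prod[OF fun_algebra_power[OF atom_inverse] atom_coord] pd_cube pd_coord
      by (auto simp: fun_eq_iff algebra_simps)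
  next
    case 3
    show ?thesis unfolding 3 pd_coord by simp
  qed
qed

text \<open>The regularized radius r satisfies |grad r|^2 = 1 - \<epsilon>^2 / r^2 and has Laplacian
  2 / r + \<epsilon>^2 / r^3. Without the \<epsilon>-terms the spherical wave P(s + r) / r would
  solve the wave equation exactly; the remaining defect is what becomes the approximate
  identity.\<close>

lemma laplacian_wave:
  "(\<Sum>i\<in>UNIV. pd i (pd i (\<lambda>y. P n (s + rad y) * inverse (rad y))) y) =
     P (n+2) (s + rad y) * inverse (rad y)
     - \<epsilon>\<^sup>2 * (P (n+2) (s + rad y) * inverse (rad y) ^ 3 - 3 * P (n+1) (s + rad y) * inverse (rad y) ^ 4
              + 3 * P n (s + rad y) * inverse (rad y) ^ 5)"
proof -
  let ?q = "inverse (rad y)" and ?w = "\<lambda>i. (y - x0) $ i"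
  \<comment> \<open>For F(r) = P(s + r) / r, this is F'(r) / r, so the gradient is \<open>B\<close>
    times the vector \<open>y - x0\<close>.\<close>
  define B where "B = (\<lambda>y. P n (s + rad y) * (-1 * inverse (rad y) ^ 3) + P (Suc n) (s + rad y) * inverse (rad y) ^ 2)"
  have B: "B \<in> fun_algebra atoms" unfolding B_def by (intro atom_intros)
  have 1: "pd i (\<lambda>y. P n (s + rad y) * inverse (rad y)) = (\<lambda>y. B y * (y - x0) $ i)" for i
    by (subst pd_prod, (intro atom_intros)+)
      (auto simp: pd_profile pd_inverse B_def fun_eq_iff algebra_simps power2_eq_square)
  have sq: "pd i (\<lambda>y. inverse (rad y) ^ 2) = (\<lambda>y. - 2 * inverse (rad y) ^ 4 * (y - x0) $ i)" for i
    unfolding power2_eq_square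
    by (subst pd_prod, (intro atom_intros)+) (simp add: pd_inverse fun_eq_iff algebra_simps eval_nat_numeral)
  have Bi: "pd i B y = (P (n+2) (s + rad y) * ?q ^ 3 - 3 * P (n+1) (s + rad y) * ?q ^ 4 + 3 * P n (s + rad y) * ?q ^ 5) * ?w i" for i
    unfolding B_def
    by (subst pd_add, (intro d atom_intros fun_algebra.const)+, subst (1 2) pd_prod, (intro atom_intros fun_algebra.const)+,
        subst pd_prod, (intro atom_intros fun_algebra.const)+)
      (simp only: pd_profile pd_cube sq pd_const, simp add: algebra_simps eval_nat_numeral)
  have 2: "pd i (pd i (\<lambda>y. P n (s + rad y) * inverse (rad y))) y = B y + pd i B y * ?w i" for i
    unfolding 1 by (subst pd_prod[OF B atom_coord]) (simp only: pd_coord, simp)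
  have n: "(\<Sum>i\<in>UNIV. ?w i * ?w i) = (rad y)\<^sup>2 - \<epsilon>\<^sup>2"
    unfolding rad_sq power2_norm_eq_inner inner_vec_def by simp
  have "(\<Sum>i\<in>UNIV. pd i (pd i (\<lambda>y. P n (s + rad y) * inverse (rad y))) y) =
     3 * B y + (P (n+2) (s + rad y) * ?q ^ 3 - 3 * P (n+1) (s + rad y) * ?q ^ 4 + 3 * P n (s + rad y) * ?q ^ 5) * (\<Sum>i\<in>UNIV. ?w i * ?w i)"
    unfolding 2 Bi by (simp add: sum.distrib sum_distrib_left mult.assoc)
  also have "\<dots> = P (n+2) (s + rad y) * ?q
     - \<epsilon>\<^sup>2 * (P (n+2) (s + rad y) * ?q ^ 3 - 3 * P (n+1) (s + rad y) * ?q ^ 4 + 3 * P n (s + rad y) * ?q ^ 5)"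
    unfolding n B_def using rad_pos[of y] by (simp add: field_simps eval_nat_numeral)
  finally show ?thesis .
qed

end

section \<open>The Yukawa kernel and integrals depending on a parameter\<close>

lemma measurable_continuous_comp:
  fixes Y :: "'m \<Rightarrow> 'b::second_countable_topology" and \<phi> :: "'b \<Rightarrow> 'c::topological_space"
  assumes Y: "Y \<in> borel_measurable M" "\<And>m. m \<in> space M \<Longrightarrow> Y m \<in> K"
    and \<phi>: "continuous_on K \<phi>"
  shows "(\<lambda>m. \<phi> (Y m)) \<in> borel_measurable M"
proof -
  have "Y \<in> measurable M (restrict_space borel K)"
    using Y by (intro measurable_restrict_space2) auto
  then show ?thesis
    using borel_measurable_continuous_on_restrict[OF \<phi>] measurable_compose by blast
qed

lemma integrable_scaleR_bounded:
  fixes f :: "'m \<Rightarrow> real" and \<phi> :: "'m \<Rightarrow> 'c::{banach,second_countable_topology}"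
  assumes f: "integrable M f" and \<phi>: "\<phi> \<in> borel_measurable M" and B: "\<And>m. m \<in> space M \<Longrightarrow> norm (\<phi> m) \<le> B"
  shows "integrable M (\<lambda>m. f m *\<^sub>R \<phi> m)"
proof (rule Bochner_Integration.integrable_bound)
  show "integrable M (\<lambda>m. B * f m)" using f by simp
  show "(\<lambda>m. f m *\<^sub>R \<phi> m) \<in> borel_measurable M" using f \<phi> by measurable
  have "\<bar>f m\<bar> * norm (\<phi> m) \<le> \<bar>f m\<bar> * \<bar>B\<bar>" if "m \<in> space M" for m
    using B[OF that] by (intro mult_left_mono) auto
  then show "AE m in M. norm (f m *\<^sub>R \<phi> m) \<le> norm (B * f m)"
    by (intro AE_I2) (simp add: abs_mult mult.commute)
qed

lemma integrable_scaleR_continuous: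
  fixes f :: "'m \<Rightarrow> real" and Y :: "'m \<Rightarrow> 'b::{second_countable_topology,t2_space}"
    and \<phi> :: "'b \<Rightarrow> 'c::{banach,second_countable_topology}"
  assumes f: "integrable M f" and Y: "Y \<in> borel_measurable M" "\<And>m. m \<in> space M \<Longrightarrow> Y m \<in> K"
    and "compact K" and \<phi>: "continuous_on K \<phi>"
  shows "integrable M (\<lambda>m. f m *\<^sub>R \<phi> (Y m))"
proof -
  obtain B where "\<And>y. y \<in> K \<Longrightarrow> norm (\<phi> y) \<le> B"
    using compact_imp_bounded[OF compact_continuous_image[OF \<phi> \<open>compact K\<close>]] unfolding bounded_iff by auto
  then show ?thesis
    using Y by (intro integrable_scaleR_bounded[OF f measurable_continuous_comp[OF Y \<phi>], of B]) auto
qed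

text \<open>A convergent sequence of parameters together with its limit is compact, so the kernel is
  uniformly bounded along it and dominated convergence applies. Density \<open>f\<close> and
  location \<open>Y\<close> are kept apart because only the location has to range over a compact
  set.\<close>

lemma continuous_on_integral_parameter:
  fixes f :: "'m \<Rightarrow> real" and Y :: "'m \<Rightarrow> 'b::euclidean_space"
    and \<phi> :: "'a::heine_borel \<Rightarrow> 'b \<Rightarrow> 'c::{banach,second_countable_topology}"
  assumes f: "integrable M f" and Y: "Y \<in> borel_measurable M" "\<And>m. m \<in> space M \<Longrightarrow> Y m \<in> K"
    and K: "compact K" and \<phi>: "continuous_on (U \<times> K) (\<lambda>(z, y). \<phi> z y)"
  shows "continuous_on U (\<lambda>z. \<integral>m. f m *\<^sub>R \<phi> z (Y m) \<partial>M)"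
  unfolding continuous_on_sequentially
proof (intro allI ballI impI, elim conjE)
  fix X z assume z: "z \<in> U" and X: "\<forall>n. X n \<in> U" "X \<longlonglongrightarrow> z"
  let ?C = "insert z (range X)"
  have C: "compact ?C" using compact_sequence_with_limit[OF X(2)] .
  have "?C \<times> K \<subseteq> U \<times> K" using z X by auto
  then have cont: "continuous_on (?C \<times> K) (\<lambda>(z, y). \<phi> z y)" using \<phi> continuous_on_subset by blast
  obtain B where B: "\<And>z y. z \<in> ?C \<Longrightarrow> y \<in> K \<Longrightarrow> norm (\<phi> z y) \<le> B"
    using compact_imp_bounded[OF compact_continuous_image[OF cont compact_Times[OF C K]]] unfolding bounded_iff by auto
  have c1: "continuous_on K (\<phi> w)" if "w \<in> ?C" for w
  proof -
    have "continuous_on K (\<lambda>y. (\<lambda>(z, y). \<phi> z y) (w, y))"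
      by (rule continuous_on_compose2[OF cont]) (use that in \<open>auto intro!: continuous_intros\<close>)
    then show ?thesis by simp
  qed
  have c2: "(\<lambda>n. \<phi> (X n) y) \<longlonglongrightarrow> \<phi> z y" if "y \<in> K" for y
  proof -
    have "continuous_on ?C (\<lambda>w. (\<lambda>(z, y). \<phi> z y) (w, y))"
      by (rule continuous_on_compose2[OF cont]) (use that in \<open>auto intro!: continuous_intros\<close>)
    then have "continuous_on ?C (\<lambda>w. \<phi> w y)" by simp
    then show ?thesis
      using continuous_on_tendsto_compose[of ?C "\<lambda>w. \<phi> w y" X z] X(2) by simp
  qed
  show "((\<lambda>z. \<integral>m. f m *\<^sub>R \<phi> z (Y m) \<partial>M) \<circ> X) \<longlonglongrightarrow> (\<integral>m. f m *\<^sub>R \<phi> z (Y m) \<partial>M)"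
    unfolding comp_def
  proof (rule integral_dominated_convergence[where w = "\<lambda>m. B * \<bar>f m\<bar>"])
    show "(\<lambda>m. f m *\<^sub>R \<phi> z (Y m)) \<in> borel_measurable M"
      using f measurable_continuous_comp[OF Y c1[of z]] by measurable
    show "(\<lambda>m. f m *\<^sub>R \<phi> (X i) (Y m)) \<in> borel_measurable M" for i
      using f measurable_continuous_comp[OF Y c1[of "X i"]] by measurable
    show "integrable M (\<lambda>m. B * \<bar>f m\<bar>)" using f by simp
    show "AE m in M. (\<lambda>i. f m *\<^sub>R \<phi> (X i) (Y m)) \<longlonglongrightarrow> f m *\<^sub>R \<phi> z (Y m)"
      using c2 Y by (intro AE_I2 tendsto_intros) auto
    show "AE m in M. norm (f m *\<^sub>R \<phi> (X i) (Y m)) \<le> B * \<bar>f m\<bar>" for i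
      using B[of "X i"] Y by (intro AE_I2) (auto simp: mult.commute[of B] intro!: mult_left_mono)
  qed
qed

text \<open>On a small closed ball of parameters the mean value inequality bounds all difference
  quotients by the maximum of \<phi>'. The parameter field is left general, so that one proof serves
  real derivatives along curves and complex derivatives for analytic continuation.\<close>

lemma has_field_derivative_integral_parameter:
  fixes f :: "'m \<Rightarrow> real" and Y :: "'m \<Rightarrow> 'b::euclidean_space"
    and \<phi> \<phi>' :: "'a::{real_normed_field,banach,second_countable_topology,heine_borel} \<Rightarrow> 'b \<Rightarrow> 'a"
  assumes f: "integrable M f" and Y: "Y \<in> borel_measurable M" "\<And>m. m \<in> space M \<Longrightarrow> Y m \<in> K"
    and K: "compact K" and U: "open U" "z0 \<in> U"
    and \<phi>: "continuous_on (U \<times> K) (\<lambda>(z, y). \<phi> z y)" and \<phi>': "continuous_on (U \<times> K) (\<lambda>(z, y). \<phi>' z y)"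
    and deriv: "\<And>z y. z \<in> U \<Longrightarrow> y \<in> K \<Longrightarrow> ((\<lambda>z. \<phi> z y) has_field_derivative \<phi>' z y) (at z)"
  shows "((\<lambda>z. \<integral>m. f m *\<^sub>R \<phi> z (Y m) \<partial>M) has_field_derivative (\<integral>m. f m *\<^sub>R \<phi>' z0 (Y m) \<partial>M)) (at z0)"
proof -
  obtain \<delta> where \<delta>: "\<delta> > 0" "cball z0 \<delta> \<subseteq> U" using U open_contains_cball by blast
  let ?C = "cball z0 \<delta>"
  have "?C \<times> K \<subseteq> U \<times> K" using \<delta> by auto
  then have cont': "continuous_on (?C \<times> K) (\<lambda>(z, y). \<phi>' z y)" and cont: "continuous_on (?C \<times> K) (\<lambda>(z, y). \<phi> z y)"
    using \<phi> \<phi>' continuous_on_subset by blast+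
  obtain B where "\<forall>p\<in>(\<lambda>(z, y). \<phi>' z y) ` (?C \<times> K). norm p \<le> B"
    using compact_imp_bounded[OF compact_continuous_image[OF cont' compact_Times[OF compact_cball K]]]
    unfolding bounded_iff by blast
  then have B: "norm (\<phi>' z y) \<le> B" if "z \<in> ?C" "y \<in> K" for z y using that by force
  have c1: "continuous_on K (\<phi> w)" "continuous_on K (\<phi>' w)" if "w \<in> ?C" for w
  proof -
    have "continuous_on K (\<lambda>y. (\<lambda>(z, y). \<phi> z y) (w, y))"
      by (rule continuous_on_compose2[OF cont]) (use that in \<open>auto intro!: continuous_intros\<close>)
    moreover have "continuous_on K (\<lambda>y. (\<lambda>(z, y). \<phi>' z y) (w, y))"
      by (rule continuous_on_compose2[OF cont']) (use that in \<open>auto intro!: continuous_intros\<close>)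
    ultimately show "continuous_on K (\<phi> w)" "continuous_on K (\<phi>' w)" by simp_all
  qed
  have z0: "z0 \<in> ball z0 \<delta>" and z0c: "z0 \<in> ?C" using \<delta> by auto
  have "((\<lambda>z. ((\<integral>m. f m *\<^sub>R \<phi> z (Y m) \<partial>M) - (\<integral>m. f m *\<^sub>R \<phi> z0 (Y m) \<partial>M)) / (z - z0)) \<longlongrightarrow>
      (\<integral>m. f m *\<^sub>R \<phi>' z0 (Y m) \<partial>M)) (at z0 within ball z0 \<delta>)"
    unfolding tendsto_at_iff_sequentially comp_def
  proof (intro allI impI)
    fix X assume X: "\<forall>i. X i \<in> ball z0 \<delta> - {z0}" "X \<longlonglongrightarrow> z0"
    have Xc: "X i \<in> ?C" "X i \<noteq> z0" for i using X(1) by (auto simp: less_imp_le)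
    have int: "integrable M (\<lambda>m. f m *\<^sub>R \<phi> w (Y m))" if "w \<in> ?C" for w
      using integrable_scaleR_continuous[OF f Y K c1(1)[OF that]] .
    have eq: "((\<integral>m. f m *\<^sub>R \<phi> (X i) (Y m) \<partial>M) - (\<integral>m. f m *\<^sub>R \<phi> z0 (Y m) \<partial>M)) / (X i - z0) =
       (\<integral>m. f m *\<^sub>R ((\<phi> (X i) (Y m) - \<phi> z0 (Y m)) / (X i - z0)) \<partial>M)" for i
      using int[OF Xc(1)] int[of z0] z0
      by (simp add: Bochner_Integration.integral_diff[symmetric] scaleR_diff_right[symmetric] divide_inverse
          flip: mult_scaleR_left)
    show "(\<lambda>i. ((\<integral>m. f m *\<^sub>R \<phi> (X i) (Y m) \<partial>M) - (\<integral>m. f m *\<^sub>R \<phi> z0 (Y m) \<partial>M)) / (X i - z0)) \<longlonglongrightarrow>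
      (\<integral>m. f m *\<^sub>R \<phi>' z0 (Y m) \<partial>M)"
      unfolding eq
    proof (rule integral_dominated_convergence[where w = "\<lambda>m. B * \<bar>f m\<bar>"])
      show "(\<lambda>m. f m *\<^sub>R \<phi>' z0 (Y m)) \<in> borel_measurable M"
        using f measurable_continuous_comp[OF Y c1(2)[OF z0c]] by measurable
      show "(\<lambda>m. f m *\<^sub>R ((\<phi> (X i) (Y m) - \<phi> z0 (Y m)) / (X i - z0))) \<in> borel_measurable M" for i
      proof -
        have [measurable]: "(\<lambda>m. \<phi> (X i) (Y m)) \<in> borel_measurable M" "(\<lambda>m. \<phi> z0 (Y m)) \<in> borel_measurable M" "f \<in> borel_measurable M"
          using f measurable_continuous_comp[OF Y c1(1)[OF Xc(1)[of i]]] measurable_continuous_comp[OF Y c1(1)[of z0]] z0 by auto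
        show ?thesis by measurable
      qed
      show "integrable M (\<lambda>m. B * \<bar>f m\<bar>)" using f by simp
      show "AE m in M. (\<lambda>i. f m *\<^sub>R ((\<phi> (X i) (Y m) - \<phi> z0 (Y m)) / (X i - z0))) \<longlonglongrightarrow> f m *\<^sub>R \<phi>' z0 (Y m)"
      proof (intro AE_I2 tendsto_intros)
        fix m assume m: "m \<in> space M"
        have "((\<lambda>z. (\<phi> z (Y m) - \<phi> z0 (Y m)) / (z - z0)) \<longlongrightarrow> \<phi>' z0 (Y m)) (at z0)"
          using deriv[of z0 "Y m"] U Y(2)[OF m] by (simp add: has_field_derivative_iff)
        then show "(\<lambda>i. (\<phi> (X i) (Y m) - \<phi> z0 (Y m)) / (X i - z0)) \<longlonglongrightarrow> \<phi>' z0 (Y m)"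
          using X(2) Xc unfolding tendsto_at_iff_sequentially comp_def by auto
      qed
      show "AE m in M. norm (f m *\<^sub>R ((\<phi> (X i) (Y m) - \<phi> z0 (Y m)) / (X i - z0))) \<le> B * \<bar>f m\<bar>" for i
      proof (intro AE_I2)
        fix m assume m: "m \<in> space M"
        have "norm (\<phi> (X i) (Y m) - \<phi> z0 (Y m)) \<le> B * norm (X i - z0)"
          using \<delta> Xc Y(2)[OF m] B z0
          by (intro field_differentiable_bound[of ?C "\<lambda>z. \<phi> z (Y m)" "\<lambda>z. \<phi>' z (Y m)"])
            (auto intro!: has_field_derivative_at_within[OF deriv])
        then have "norm ((\<phi> (X i) (Y m) - \<phi> z0 (Y m)) / (X i - z0)) \<le> B"
          using Xc[of i] by (simp add: norm_divide divide_le_eq)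
        then show "norm (f m *\<^sub>R ((\<phi> (X i) (Y m) - \<phi> z0 (Y m)) / (X i - z0))) \<le> B * \<bar>f m\<bar>"
          by (auto simp: mult.commute[of B] intro!: mult_left_mono)
      qed
    qed
  qed
  then show ?thesis
    using z0 by (simp add: has_field_derivative_iff at_within_open[OF z0 open_ball])
qed

text \<open>The kernel exp(-\<kappa> r) / r as a function of \<rho> = r^2: the squared distance is a
  polynomial in the point and extends to an entire function of the angle along a great
  circle.\<close>

definition yuk :: "real \<Rightarrow> real \<Rightarrow> real" where
  "yuk \<kappa> \<rho> = exp (- \<kappa> * sqrt \<rho>) / sqrt \<rho>"

definition yuk' :: "real \<Rightarrow> real \<Rightarrow> real" where
  "yuk' \<kappa> \<rho> = - (\<kappa> / (2 * \<rho>) + 1 / (2 * \<rho> * sqrt \<rho>)) * exp (- \<kappa> * sqrt \<rho>)"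

text \<open>Obtained by solving the radial equation 4 \<rho> k'' + 6 k' = \<kappa>^2 k, which says
  that k(|x|^2) is annihilated by the Laplacian minus \<kappa>^2 in three dimensions. That this is
  the second derivative is then the content of \<open>yuk'_deriv\<close>.\<close>

definition yuk'' :: "real \<Rightarrow> real \<Rightarrow> real" where
  "yuk'' \<kappa> \<rho> = (\<kappa>\<^sup>2 * yuk \<kappa> \<rho> - 6 * yuk' \<kappa> \<rho>) / (4 * \<rho>)"

lemma sqrt_deriv: "\<rho> > 0 \<Longrightarrow> (sqrt has_real_derivative inverse (sqrt \<rho>) / 2) (at \<rho>)"
  by (rule DERIV_real_sqrt)

lemma exp_sqrt_deriv:
  assumes "\<rho> > 0"
  shows "((\<lambda>\<rho>. exp (- \<kappa> * sqrt \<rho>)) has_real_derivative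
     exp (- \<kappa> * sqrt \<rho>) * (- \<kappa> * (inverse (sqrt \<rho>) / 2))) (at \<rho>)"
  by (rule DERIV_fun_exp[OF DERIV_cmult[OF sqrt_deriv[OF assms]]])

lemma yuk_deriv:
  assumes "\<rho> > 0" shows "(yuk \<kappa> has_real_derivative yuk' \<kappa> \<rho>) (at \<rho>)"
proof -
  define r where "r = sqrt \<rho>"
  have r: "r > 0" "\<rho> = r\<^sup>2" using assms by (auto simp: r_def)
  show ?thesis unfolding yuk_def[abs_def] yuk'_def
    by (rule DERIV_cong[OF DERIV_divide[OF exp_sqrt_deriv[OF assms] sqrt_deriv[OF assms]]], use assms in simp)
      (fold r_def, use r in \<open>simp add: field_simps power2_eq_square\<close>)
qed

lemma yuk'_deriv:
  assumes "\<rho> > 0" shows "(yuk' \<kappa> has_real_derivative yuk'' \<kappa> \<rho>) (at \<rho>)"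
proof -
  define r where "r = sqrt \<rho>"
  have r: "r > 0" "\<rho> = r\<^sup>2" using assms by (auto simp: r_def)
  have a: "((\<lambda>\<rho>. \<kappa> / (2 * \<rho>)) has_real_derivative - \<kappa> / (2 * \<rho>\<^sup>2)) (at \<rho>)"
    using assms by (auto intro!: derivative_eq_intros simp: power2_eq_square field_simps)
  have b: "((\<lambda>\<rho>. 1 / (2 * \<rho> * sqrt \<rho>)) has_real_derivative
      (0 * (2 * \<rho> * sqrt \<rho>) - 1 * (2 * sqrt \<rho> + inverse (sqrt \<rho>) / 2 * (2 * \<rho>))) / ((2 * \<rho> * sqrt \<rho>) * (2 * \<rho> * sqrt \<rho>))) (at \<rho>)"
    using assms by (intro DERIV_divide DERIV_mult sqrt_deriv) (auto intro!: derivative_eq_intros)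
  show ?thesis unfolding yuk'_def[abs_def] yuk''_def yuk_def
    by (rule DERIV_cong[OF DERIV_mult[OF DERIV_minus[OF DERIV_add[OF a b]] exp_sqrt_deriv[OF assms]]])
     (fold r_def, use r in \<open>simp add: field_simps power2_eq_square\<close>)
qed

lemma yuk_ode: assumes "\<rho> > 0" shows "4 * \<rho> * yuk'' \<kappa> \<rho> + 6 * yuk' \<kappa> \<rho> = \<kappa>\<^sup>2 * yuk \<kappa> \<rho>"
  using assms by (simp add: yuk''_def field_simps)

lemma yuk_mono:
  assumes "\<kappa> \<ge> 0" "0 < \<rho>" "\<rho> \<le> \<sigma>" shows "0 < yuk \<kappa> \<sigma>" "yuk \<kappa> \<sigma> \<le> yuk \<kappa> \<rho>"
  using assms by (auto simp: yuk_def intro!: frac_le mult_left_mono)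

lemma continuous_on_yuk [continuous_intros]:
  assumes "continuous_on S g" "\<And>x. x \<in> S \<Longrightarrow> g x > 0"
  shows "continuous_on S (\<lambda>x. yuk \<kappa> (g x))" "continuous_on S (\<lambda>x. yuk' \<kappa> (g x))" "continuous_on S (\<lambda>x. yuk'' \<kappa> (g x))"
proof -
  note [continuous_intros] = assms(1)
  have pos: "g x > 0" "g x \<noteq> 0" "sqrt (g x) \<noteq> 0" if "x \<in> S" for x using assms(2)[OF that] by auto
  show 1: "continuous_on S (\<lambda>x. yuk \<kappa> (g x))" unfolding yuk_def by (intro continuous_intros ballI pos)
  show 2: "continuous_on S (\<lambda>x. yuk' \<kappa> (g x))" unfolding yuk'_def
    by (intro continuous_intros ballI) (use pos in auto)
  show "continuous_on S (\<lambda>x. yuk'' \<kappa> (g x))" unfolding yuk''_def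
    by (intro continuous_intros 1 2 ballI) (use pos in auto)
qed

text \<open>A second derivative test that produces larger values to the right only. It therefore
  also applies at a maximum on the boundary sphere, where only outward points belong to the
  domain.\<close>

lemma increases_if_second_deriv_pos:
  fixes F :: "real \<Rightarrow> real"
  assumes "\<delta> > 0" and F: "\<And>t. 0 \<le> t \<Longrightarrow> t < \<delta> \<Longrightarrow> (F has_real_derivative F1 t) (at t)"
    and "F1 0 = 0" and "(F1 has_real_derivative a) (at 0)" and "a > 0"
  shows "\<exists>t. 0 < t \<and> t < \<delta> \<and> F 0 < F t"
proof -
  obtain d where d: "d > 0" "\<And>h. 0 < h \<Longrightarrow> h < d \<Longrightarrow> F1 0 < F1 h"
    using DERIV_pos_inc_right[OF assms(4,5)] by auto
  define t where "t = min (d/2) (\<delta>/2)"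
  have t: "0 < t" "t < d" "t < \<delta>" using d \<open>\<delta> > 0\<close> by (auto simp: t_def)
  have "F 0 < F t"
  proof (rule DERIV_pos_imp_increasing_open[OF t(1)])
    show "\<exists>y. (F has_real_derivative y) (at x) \<and> 0 < y" if "0 < x" "x < t" for x
      using F[of x] d(2)[of x] that t \<open>F1 0 = 0\<close> by auto
    show "continuous_on {0..t} F"
      using t by (intro continuous_at_imp_continuous_on ballI DERIV_isCont[OF F]) auto
  qed
  then show ?thesis using t by auto
qed

lemma second_deriv_nonpos_at_max:
  fixes F :: "real \<Rightarrow> real"
  assumes F: "\<And>t. (F has_real_derivative F1 t) (at t)" and "(F1 has_real_derivative a) (at 0)"
    and max: "\<And>t. F t \<le> F 0"
  shows "a \<le> 0"
proof (rule ccontr)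
  assume "\<not> a \<le> 0"
  moreover have "F1 0 = 0" using DERIV_local_max[OF F[of 0], of 1] max by auto
  ultimately obtain t where "F 0 < F t"
    using increases_if_second_deriv_pos[of 1 F F1 a] F assms(2) by auto
  then show False using max[of t] by simp
qed

section \<open>Yukawa potentials and the exterior maximum principle\<close>

text \<open>The frame is an argument because differentiation merely rotates it: \<open>n\<close> and
  \<open>e\<close> are replaced by \<open>e\<close> and \<open>- n\<close>.\<close>

definition circle :: "real \<Rightarrow> real^3 \<Rightarrow> real^3 \<Rightarrow> real \<Rightarrow> real^3" where
  "circle r n e \<theta> = (r * cos \<theta>) *\<^sub>R n + (r * sin \<theta>) *\<^sub>R e"

lemma circle_deriv: "(circle r n e has_vector_derivative circle r e (- n) t) (at t)"
  unfolding circle_def[abs_def] has_vector_derivative_def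
  by (auto intro!: derivative_eq_intros simp: algebra_simps fun_eq_iff)

lemma circle_deriv2: "(circle r e (- n) has_vector_derivative circle r (- n) (- e) t) (at t)"
  unfolding circle_def[abs_def] has_vector_derivative_def
  by (auto intro!: derivative_eq_intros simp: algebra_simps fun_eq_iff)

lemma circle_cont: "continuous_on S (circle r n e)"
  unfolding circle_def by (intro continuous_intros)

lemma norm_circle:
  assumes "norm n = 1" "norm e = 1" "n \<bullet> e = 0" "r \<ge> 0"
  shows "norm (circle r n e t) = r"
proof -
  have "(norm (circle r n e t))\<^sup>2 = (r * cos t)\<^sup>2 + (r * sin t)\<^sup>2"
    using assms unfolding circle_def power2_norm_eq_inner
    by (simp add: inner_add_left inner_add_right norm_eq_1 inner_commute power2_eq_square)
  also have "\<dots> = r\<^sup>2" by (simp add: power_mult_distrib flip: distrib_left)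
  finally show ?thesis using assms by simp
qed

text \<open>The third vector is the cross product of the first two. A vector \<open>w\<close>
  orthogonal to all three has zero cross product with \<open>e2\<close> by the double cross product
  formula, and also zero inner product, so it vanishes.\<close>

lemma orthonormal_frame:
  fixes n :: "real^3" assumes "norm n = 1"
  obtains e1 e2 where "norm e1 = 1" "norm e2 = 1" "n \<bullet> e1 = 0" "n \<bullet> e2 = 0" "e1 \<bullet> e2 = 0"
    "\<And>u v. u \<bullet> v = (u \<bullet> n) * (v \<bullet> n) + (u \<bullet> e1) * (v \<bullet> e1) + (u \<bullet> e2) * (v \<bullet> e2)"
proof -
  obtain x where x: "x \<noteq> 0" "n \<bullet> x = 0" using orthogonal_to_vector_exists[of n] by (auto simp: orthogonal_def)
  define e1 where "e1 = x /\<^sub>R norm x"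
  define e2 where "e2 = cross3 n e1"
  have 1: "norm e1 = 1" "n \<bullet> e1 = 0" using x by (auto simp: e1_def)
  have 2: "n \<bullet> e2 = 0" "e1 \<bullet> e2 = 0" by (auto simp: e2_def dot_cross_self)
  have 3: "norm e2 = 1"
    using norm_cross_dot[of n e1] 1 assms power2_eq_imp_eq[of "norm e2" 1] by (simp add: e2_def)
  have id: "u \<bullet> v = (u \<bullet> n) * (v \<bullet> n) + (u \<bullet> e1) * (v \<bullet> e1) + (u \<bullet> e2) * (v \<bullet> e2)" for u v
  proof -
    define w where "w = u - ((u \<bullet> n) *\<^sub>R n + (u \<bullet> e1) *\<^sub>R e1 + (u \<bullet> e2) *\<^sub>R e2)"
    have w: "w \<bullet> n = 0" "w \<bullet> e1 = 0" "w \<bullet> e2 = 0"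
      unfolding w_def inner_diff_left inner_add_left inner_scaleR_left
      using 1 2 3 assms by (simp_all add: norm_eq_1 inner_commute[of e1 n] inner_commute[of e2 n] inner_commute[of e2 e1])
    have "cross3 w e2 = 0" using w unfolding e2_def Lagrange by simp
    then have "w = 0" using norm_cross_dot[of w e2] w(3) 3 by simp
    then have "u = (u \<bullet> n) *\<^sub>R n + (u \<bullet> e1) *\<^sub>R e1 + (u \<bullet> e2) *\<^sub>R e2" by (simp add: w_def)
    then have "u \<bullet> v = ((u \<bullet> n) *\<^sub>R n + (u \<bullet> e1) *\<^sub>R e1 + (u \<bullet> e2) *\<^sub>R e2) \<bullet> v" by simp
    then show ?thesis unfolding inner_add_left inner_scaleR_left by (simp only: inner_commute[of v])
  qed
  show ?thesis using that 1 2 3 id by blast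
qed

text \<open>Potentials of densities on an abstract measure space with locations \<open>Y\<close>. In
  the application the space is a product of time and space and \<open>Y\<close> is the moving point
  \<open>a s + y\<close>, so the time-integrated moving source becomes one static density.\<close>

locale yukawa_potential =
  fixes M :: "'m measure" and Y :: "'m \<Rightarrow> real^3" and D R \<kappa> :: real
  assumes Y_meas: "Y \<in> borel_measurable M" and Y_le: "\<And>m. m \<in> space M \<Longrightarrow> norm (Y m) \<le> D"
    and D: "0 \<le> D" "D < R" and kap: "\<kappa> > 0"
begin

lemma Y_cball: "m \<in> space M \<Longrightarrow> Y m \<in> cball 0 D"
  using Y_le by simp

definition pot :: "('m \<Rightarrow> real) \<Rightarrow> real^3 \<Rightarrow> real" where
  "pot f x = (\<integral>m. f m * yuk \<kappa> ((norm (x - Y m))\<^sup>2) \<partial>M)"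

definition pot' :: "('m \<Rightarrow> real) \<Rightarrow> real^3 \<Rightarrow> real^3 \<Rightarrow> real" where
  "pot' f x v = (\<integral>m. f m * (yuk' \<kappa> ((norm (x - Y m))\<^sup>2) * (2 * ((x - Y m) \<bullet> v))) \<partial>M)"

text \<open>The second derivative of the potential along a curve passing through \<open>x\<close>
  with velocity \<open>v\<close> and acceleration \<open>w\<close>.\<close>

definition pot'' :: "('m \<Rightarrow> real) \<Rightarrow> real^3 \<Rightarrow> real^3 \<Rightarrow> real^3 \<Rightarrow> real" where
  "pot'' f x v w = (\<integral>m. f m * (4 * yuk'' \<kappa> ((norm (x - Y m))\<^sup>2) * ((x - Y m) \<bullet> v)\<^sup>2
      + 2 * yuk' \<kappa> ((norm (x - Y m))\<^sup>2) * (v \<bullet> v + (x - Y m) \<bullet> w)) \<partial>M)"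

lemma dist_pos: "D < norm x \<Longrightarrow> norm y \<le> D \<Longrightarrow> 0 < (norm (x - y))\<^sup>2"
  by auto

lemma integrable_kernel:
  assumes "integrable M f" "continuous_on (cball 0 D) \<phi>"
  shows "integrable M (\<lambda>m. f m * (\<phi> (Y m) :: real))"
  using integrable_scaleR_continuous[OF assms(1) Y_meas Y_cball compact_cball assms(2)] by simp

lemma pot_cmult: "pot (\<lambda>m. c * f m) x = c * pot f x"
  unfolding pot_def by (simp add: mult.assoc)

lemma pot'_cmult: "pot' (\<lambda>m. c * f m) x v = c * pot' f x v"
  unfolding pot'_def by (simp add: mult.assoc)

lemma continuous_on_pot:
  assumes f: "integrable M f"
  shows "continuous_on {x. D < norm x} (pot f)"
proof -
  have "continuous_on ({x. D < norm x} \<times> cball 0 D) (\<lambda>(x, y). yuk \<kappa> ((norm (x - y))\<^sup>2))"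
    unfolding case_prod_beta by (intro continuous_intros) (use dist_pos in auto)
  from continuous_on_integral_parameter[OF f Y_meas Y_cball compact_cball this]
  show ?thesis by (simp add: pot_def[abs_def])
qed

context
  fixes c c1 c2 :: "real \<Rightarrow> real^3" and f :: "'m \<Rightarrow> real"
  assumes c1: "\<And>t. (c has_vector_derivative c1 t) (at t)"
    and c2: "\<And>t. (c1 has_vector_derivative c2 t) (at t)"
    and c2_cont: "continuous_on UNIV c2" and f: "integrable M f"
begin

lemma cont_c: "continuous_on S c" "continuous_on S c1" "continuous_on S c2"
  using has_vector_derivative_continuous[OF c1] has_vector_derivative_continuous[OF c2] continuous_on_subset[OF c2_cont]
  by (auto intro!: continuous_at_imp_continuous_on)

lemma open_outside: "open {t. D < norm (c t)}"
  using cont_c by (intro open_Collect_less continuous_intros)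

lemma cont_comp: "continuous_on S (\<lambda>p. c (fst p))" "continuous_on S (\<lambda>p. c1 (fst p))" "continuous_on S (\<lambda>p. c2 (fst p))"
  by (auto intro!: continuous_on_compose2[OF cont_c(1)[of UNIV]] continuous_on_compose2[OF cont_c(2)[of UNIV]]
     continuous_on_compose2[OF cont_c(3)[of UNIV]] continuous_intros)

lemma deriv_normsq:
  "((\<lambda>t. (norm (c t - y))\<^sup>2) has_real_derivative 2 * ((c t - y) \<bullet> c1 t)) (at t)"
proof -
  have "((\<lambda>t. (c t - y) \<bullet> (c t - y)) has_derivative (\<lambda>h. h * (2 * ((c t - y) \<bullet> c1 t)))) (at t)"
    using c1[of t] unfolding has_vector_derivative_def
    by (auto intro!: derivative_eq_intros simp: inner_commute algebra_simps)
  then show ?thesis by (simp add: power2_norm_eq_inner has_field_derivative_def mult_commute_abs)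
qed

lemma deriv_inner:
  "((\<lambda>t. (c t - y) \<bullet> c1 t) has_real_derivative c1 t \<bullet> c1 t + (c t - y) \<bullet> c2 t) (at t)"
proof -
  have "((\<lambda>t. (c t - y) \<bullet> c1 t) has_derivative (\<lambda>h. h * (c1 t \<bullet> c1 t + (c t - y) \<bullet> c2 t))) (at t)"
    using c1[of t] c2[of t] unfolding has_vector_derivative_def
    by (auto intro!: derivative_eq_intros simp: inner_commute algebra_simps)
  then show ?thesis by (simp add: has_field_derivative_def mult_commute_abs)
qed

text \<open>All differentiation of potentials is done along curves with prescribed velocity and
  acceleration; radial lines and great circles are the two instances that matter.\<close>

lemma pot_curve_deriv:
  assumes t: "D < norm (c t)"
  shows "((\<lambda>t. pot f (c t)) has_real_derivative pot' f (c t) (c1 t)) (at t)"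
proof -
  have "((\<lambda>t. \<integral>m. f m *\<^sub>R yuk \<kappa> ((norm (c t - Y m))\<^sup>2) \<partial>M) has_real_derivative
     (\<integral>m. f m *\<^sub>R (yuk' \<kappa> ((norm (c t - Y m))\<^sup>2) * (2 * ((c t - Y m) \<bullet> c1 t))) \<partial>M)) (at t)"
    by (rule has_field_derivative_integral_parameter[OF f Y_meas Y_cball compact_cball open_outside])
      (use t dist_pos in \<open>auto intro!: continuous_intros cont_comp DERIV_chain2[OF yuk_deriv deriv_normsq] simp: case_prod_beta\<close>)
  then show ?thesis by (simp add: pot_def pot'_def)
qed

lemma pot_curve_deriv2:
  assumes t: "D < norm (c t)"
  shows "((\<lambda>t. pot' f (c t) (c1 t)) has_real_derivative pot'' f (c t) (c1 t) (c2 t)) (at t)"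
proof -
  have d: "((\<lambda>t. yuk' \<kappa> ((norm (c t - y))\<^sup>2) * (2 * ((c t - y) \<bullet> c1 t))) has_real_derivative
      4 * yuk'' \<kappa> ((norm (c t - y))\<^sup>2) * ((c t - y) \<bullet> c1 t)\<^sup>2
      + 2 * yuk' \<kappa> ((norm (c t - y))\<^sup>2) * (c1 t \<bullet> c1 t + (c t - y) \<bullet> c2 t)) (at t)"
    if "D < norm (c t)" "norm y \<le> D" for t y
    by (rule DERIV_cong[OF DERIV_mult[OF DERIV_chain2[OF yuk'_deriv deriv_normsq] DERIV_cmult[OF deriv_inner]]])
      (use dist_pos[OF that] in \<open>auto simp: algebra_simps power2_eq_square\<close>)
  have "((\<lambda>t. \<integral>m. f m *\<^sub>R (yuk' \<kappa> ((norm (c t - Y m))\<^sup>2) * (2 * ((c t - Y m) \<bullet> c1 t))) \<partial>M) has_real_derivative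
     (\<integral>m. f m *\<^sub>R (4 * yuk'' \<kappa> ((norm (c t - Y m))\<^sup>2) * ((c t - Y m) \<bullet> c1 t)\<^sup>2
      + 2 * yuk' \<kappa> ((norm (c t - Y m))\<^sup>2) * (c1 t \<bullet> c1 t + (c t - Y m) \<bullet> c2 t)) \<partial>M)) (at t)"
    by (rule has_field_derivative_integral_parameter[OF f Y_meas Y_cball compact_cball open_outside])
      (use t dist_pos d in \<open>auto intro!: continuous_intros cont_comp simp: case_prod_beta\<close>)
  then show ?thesis by (simp add: pot'_def pot''_def)
qed

end

text \<open>This is r^2 times the Laplacian in polar coordinates: the first summand is r (r u)''
  along the ray, and the two great-circle accelerations add up to the spherical Laplacian. For a
  fixed source point it reduces to \<open>yuk_ode\<close>, and integration against the density gives
  the claim.\<close>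

lemma pot_laplacian:
  assumes "D < r" "norm n = 1" "norm e1 = 1" "norm e2 = 1" "n \<bullet> e1 = 0" "n \<bullet> e2 = 0"
    and frame: "\<And>u v. u \<bullet> v = (u \<bullet> n) * (v \<bullet> n) + (u \<bullet> e1) * (v \<bullet> e1) + (u \<bullet> e2) * (v \<bullet> e2)"
    and f: "integrable M f"
  shows "r * (2 * pot' f (r *\<^sub>R n) n + r * pot'' f (r *\<^sub>R n) n 0)
     + pot'' f (r *\<^sub>R n) (r *\<^sub>R e1) (- (r *\<^sub>R n)) + pot'' f (r *\<^sub>R n) (r *\<^sub>R e2) (- (r *\<^sub>R n))
     = \<kappa>\<^sup>2 * r\<^sup>2 * pot f (r *\<^sub>R n)"
proof -
  let ?x = "r *\<^sub>R n"
  have r: "r > 0" "D < norm ?x" using assms(1,2) D by auto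
  note pos = dist_pos[OF r(2)]
  define k where "k y = yuk \<kappa> ((norm (?x - y))\<^sup>2)" for y
  define k' where "k' y v = yuk' \<kappa> ((norm (?x - y))\<^sup>2) * (2 * ((?x - y) \<bullet> v))" for y v
  define k'' where "k'' y v w = 4 * yuk'' \<kappa> ((norm (?x - y))\<^sup>2) * ((?x - y) \<bullet> v)\<^sup>2
      + 2 * yuk' \<kappa> ((norm (?x - y))\<^sup>2) * (v \<bullet> v + (?x - y) \<bullet> w)" for y v w
  have c: "continuous_on (cball 0 D) k" "continuous_on (cball 0 D) (\<lambda>y. k' y v)" "continuous_on (cball 0 D) (\<lambda>y. k'' y v w)" for v w
    using pos unfolding k_def k'_def k''_def by (auto intro!: continuous_intros)
  note i = integrable_kernel[OF f c(1)] integrable_kernel[OF f c(2)] integrable_kernel[OF f c(3)]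
  have id: "r * (2 * k' y n + r * k'' y n 0) + k'' y (r *\<^sub>R e1) (- ?x) + k'' y (r *\<^sub>R e2) (- ?x) = \<kappa>\<^sup>2 * r\<^sup>2 * k y"
    if "norm y \<le> D" for y
  proof -
    define \<rho> where "\<rho> = (norm (?x - y))\<^sup>2"
    have n: "n \<bullet> n = 1" "e1 \<bullet> e1 = 1" "e2 \<bullet> e2 = 1" using assms(2-4) by (simp_all add: norm_eq_1)
    have "\<rho> = (r - y \<bullet> n)\<^sup>2 + (y \<bullet> e1)\<^sup>2 + (y \<bullet> e2)\<^sup>2"
      unfolding \<rho>_def power2_norm_eq_inner frame[of "?x - y" "?x - y"] using assms(5,6)
      by (simp add: inner_diff_left n power2_eq_square)
    moreover have ode: "4 * \<rho> * yuk'' \<kappa> \<rho> + 6 * yuk' \<kappa> \<rho> = \<kappa>\<^sup>2 * yuk \<kappa> \<rho>"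
      using pos[OF that] unfolding \<rho>_def by (rule yuk_ode)
    ultimately have "4 * ((r - y \<bullet> n)\<^sup>2 + (y \<bullet> e1)\<^sup>2 + (y \<bullet> e2)\<^sup>2) * yuk'' \<kappa> \<rho> + 6 * yuk' \<kappa> \<rho> = \<kappa>\<^sup>2 * yuk \<kappa> \<rho>" by simp
    then have "r\<^sup>2 * (4 * ((r - y \<bullet> n)\<^sup>2 + (y \<bullet> e1)\<^sup>2 + (y \<bullet> e2)\<^sup>2) * yuk'' \<kappa> \<rho> + 6 * yuk' \<kappa> \<rho>) = \<kappa>\<^sup>2 * r\<^sup>2 * yuk \<kappa> \<rho>" by simp
    moreover have "(?x - y) \<bullet> n = r - y \<bullet> n" "(?x - y) \<bullet> (r *\<^sub>R e1) = - (r * (y \<bullet> e1))" "(?x - y) \<bullet> (r *\<^sub>R e2) = - (r * (y \<bullet> e2))"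
      "(?x - y) \<bullet> (- ?x) = - (r * (r - y \<bullet> n))" "(?x - y) \<bullet> 0 = 0"
      using n assms(5,6) by (simp_all add: inner_diff_left)
    moreover have "(r *\<^sub>R e1) \<bullet> (r *\<^sub>R e1) = r\<^sup>2" "(r *\<^sub>R e2) \<bullet> (r *\<^sub>R e2) = r\<^sup>2"
      using n by (simp_all add: power2_eq_square)
    ultimately show ?thesis
      unfolding k_def k'_def k''_def \<rho>_def[symmetric] n(1) by algebra
  qed
  have "r * (2 * pot' f ?x n + r * pot'' f ?x n 0)
     + pot'' f ?x (r *\<^sub>R e1) (- ?x) + pot'' f ?x (r *\<^sub>R e2) (- ?x)
     = (\<integral>m. f m * (r * (2 * k' (Y m) n + r * k'' (Y m) n 0) + k'' (Y m) (r *\<^sub>R e1) (- ?x) + k'' (Y m) (r *\<^sub>R e2) (- ?x)) \<partial>M)"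
    unfolding pot'_def pot''_def k'_def[symmetric] k''_def[symmetric]
    by (simp add: distrib_left mult.left_commute[of "f _"] i)
  also have "\<dots> = (\<integral>m. f m * (\<kappa>\<^sup>2 * r\<^sup>2 * k (Y m)) \<partial>M)"
    by (rule Bochner_Integration.integral_cong) (auto simp: id Y_le)
  also have "\<dots> = \<kappa>\<^sup>2 * r\<^sup>2 * pot f ?x"
    unfolding pot_def k_def[symmetric] by (simp add: mult.left_commute[of "f _"])
  finally show ?thesis .
qed

text \<open>All sources lie within distance \<open>D\<close> of the origin, so the exponential decay
  of the kernel absorbs the factor |x|. This makes up for the noncompact exterior domain in the
  maximum principle.\<close>

lemma pot_decay:
  assumes f: "integrable M f" and e: "e > 0"
  shows "\<exists>N. \<forall>x. N \<le> norm x \<longrightarrow> norm x * \<bar>pot f x\<bar> < e"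
proof -
  define A where "A = (\<integral>m. \<bar>f m\<bar> \<partial>M)"
  have "A \<ge> 0" unfolding A_def by simp
  have b: "norm x * \<bar>pot f x\<bar> \<le> A * (norm x * (exp (- \<kappa> * (norm x - D)) / (norm x - D)))" if x: "D < norm x" for x
  proof -
    have k: "0 < yuk \<kappa> ((norm (x - Y m))\<^sup>2)" "yuk \<kappa> ((norm (x - Y m))\<^sup>2) \<le> exp (- \<kappa> * (norm x - D)) / (norm x - D)"
      if "m \<in> space M" for m
    proof -
      have "norm x - D \<le> norm (x - Y m)" using Y_le[OF that] norm_triangle_ineq2[of x "Y m"] by linarith
      then have "(norm x - D)\<^sup>2 \<le> (norm (x - Y m))\<^sup>2" using x by (intro power_mono) auto
      then show "0 < yuk \<kappa> ((norm (x - Y m))\<^sup>2)" "yuk \<kappa> ((norm (x - Y m))\<^sup>2) \<le> exp (- \<kappa> * (norm x - D)) / (norm x - D)"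
        using yuk_mono[of \<kappa> "(norm x - D)\<^sup>2" "(norm (x - Y m))\<^sup>2"] x kap by (simp_all add: yuk_def)
    qed
    have "\<bar>pot f x\<bar> \<le> (\<integral>m. \<bar>f m\<bar> * (exp (- \<kappa> * (norm x - D)) / (norm x - D)) \<partial>M)"
      unfolding pot_def
    proof (rule order_trans[OF integral_abs_bound integral_mono])
      show "integrable M (\<lambda>m. \<bar>f m * yuk \<kappa> ((norm (x - Y m))\<^sup>2)\<bar>)"
        using dist_pos[OF x] by (intro integrable_abs integrable_kernel[OF f]) (auto intro!: continuous_intros)
      show "integrable M (\<lambda>m. \<bar>f m\<bar> * (exp (- \<kappa> * (norm x - D)) / (norm x - D)))" using f by auto
      show "\<bar>f m * yuk \<kappa> ((norm (x - Y m))\<^sup>2)\<bar> \<le> \<bar>f m\<bar> * (exp (- \<kappa> * (norm x - D)) / (norm x - D))" if "m \<in> space M" for m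
        using k[OF that] unfolding abs_mult by (intro mult_left_mono) auto
    qed
    also have "\<dots> = A * (exp (- \<kappa> * (norm x - D)) / (norm x - D))" by (simp add: A_def)
    finally have "norm x * \<bar>pot f x\<bar> \<le> norm x * (A * (exp (- \<kappa> * (norm x - D)) / (norm x - D)))"
      by (intro mult_left_mono) auto
    then show ?thesis by (simp only: mult.left_commute)
  qed
  have "((\<lambda>t. t * (exp (- \<kappa> * (t - D)) / (t - D))) \<longlongrightarrow> 0) at_top"
    using kap by real_asymp
  then have "((\<lambda>t. A * (t * (exp (- \<kappa> * (t - D)) / (t - D)))) \<longlongrightarrow> 0) at_top"
    by (rule tendsto_mult_right_zero)
  then have "eventually (\<lambda>t. A * (t * (exp (- \<kappa> * (t - D)) / (t - D))) < e \<and> D < t) at_top"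
    by (intro eventually_conj order_tendstoD(2)[OF _ e] eventually_gt_at_top)
  then obtain N where "\<And>t. t \<ge> N \<Longrightarrow> A * (t * (exp (- \<kappa> * (t - D)) / (t - D))) < e \<and> D < t"
    by (auto simp: eventually_at_top_linorder)
  then show ?thesis using b by (meson le_less_trans)
qed

text \<open>\<open>Q x = \<bar>x\<bar> * pot f x\<close> satisfies an elliptic equation in polar coordinates without first-order terms,
  so a positive maximum is excluded both inside the exterior domain and at boundary points
  where the radial derivative of \<open>Q\<close> vanishes.\<close>

lemma pot_nonpos:
  assumes f: "integrable M f"
    and bdry: "\<And>n. norm n = 1 \<Longrightarrow> pot f (R *\<^sub>R n) = 0 \<or> pot f (R *\<^sub>R n) + R * pot' f (R *\<^sub>R n) n = 0"
    and x1: "R \<le> norm x1"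
  shows "pot f x1 \<le> 0"
proof (rule ccontr)
  assume neg: "\<not> pot f x1 \<le> 0"
  have Rpos: "R > 0" using D by simp
  define Q where "Q x = norm x * pot f x" for x
  have Q1: "Q x1 > 0" using neg x1 Rpos unfolding Q_def by (intro mult_pos_pos) auto
  obtain N where N: "\<And>x. N \<le> norm x \<Longrightarrow> norm x * \<bar>pot f x\<bar> < Q x1" using pot_decay[OF f Q1] by blast
  \<comment> \<open>Beyond radius \<open>N\<close> the function \<open>Q\<close> stays below
    \<open>Q x1\<close>, so its maximum over this compact shell is its maximum over the whole
    exterior.\<close>
  define S where "S = {x::real^3. R \<le> norm x} \<inter> cball 0 (max N (norm x1))"
  have "closed {x::real^3. R \<le> norm x}" by (intro closed_Collect_le continuous_intros)
  then have "compact S" unfolding S_def by (intro closed_Int_compact compact_cball)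
  moreover have "x1 \<in> S" using x1 by (auto simp: S_def)
  moreover have "continuous_on S Q" unfolding Q_def
    using D by (intro continuous_intros continuous_on_subset[OF continuous_on_pot[OF f]]) (auto simp: S_def)
  ultimately obtain x0 where x0: "x0 \<in> S" "\<And>x. x \<in> S \<Longrightarrow> Q x \<le> Q x0"
    using continuous_attains_sup[of S Q] by blast
  have Q0: "Q x0 > 0" using x0(2)[OF \<open>x1 \<in> S\<close>] Q1 by simp
  have max: "Q x \<le> Q x0" if "R \<le> norm x" for x
  proof (cases "x \<in> S")
    case False
    then have "N \<le> norm x" using that by (auto simp: S_def)
    then have "norm x * \<bar>pot f x\<bar> < Q x1" by (rule N)
    moreover have "Q x \<le> norm x * \<bar>pot f x\<bar>" unfolding Q_def by (intro mult_left_mono) auto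
    ultimately show ?thesis using x0(2)[OF \<open>x1 \<in> S\<close>] by linarith
  qed (use x0 in auto)
  define r where "r = norm x0"
  define n where "n = x0 /\<^sub>R r"
  have r: "R \<le> r" "r > 0" "D < r" using x0(1) Rpos D by (auto simp: S_def r_def)
  have n: "norm n = 1" "x0 = r *\<^sub>R n" using r by (auto simp: n_def r_def)
  obtain e1 e2 where e: "norm e1 = 1" "norm e2 = 1" "n \<bullet> e1 = 0" "n \<bullet> e2 = 0" "e1 \<bullet> e2 = 0"
    "\<And>u v. u \<bullet> v = (u \<bullet> n) * (v \<bullet> n) + (u \<bullet> e1) * (v \<bullet> e1) + (u \<bullet> e2) * (v \<bullet> e2)"
    using orthonormal_frame[OF n(1)] by metis
  \<comment> \<open>The norm is constant along a great circle, so a maximum of \<open>Q\<close> is a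
    maximum of the potential there.\<close>
  have circ: "pot'' f x0 (r *\<^sub>R e) (- (r *\<^sub>R n)) \<le> 0" if e: "norm e = 1" "n \<bullet> e = 0" for e
  proof (rule second_deriv_nonpos_at_max)
    have out: "D < norm (circle r n e t)" for t using norm_circle[OF n(1) e] r by simp
    show "((\<lambda>t. pot f (circle r n e t)) has_real_derivative pot' f (circle r n e t) (circle r e (- n) t)) (at t)" for t
      by (rule pot_curve_deriv[OF circle_deriv circle_deriv2 circle_cont f out])
    have "circle r n e 0 = x0" "circle r e (- n) 0 = r *\<^sub>R e" "circle r (-n) (-e) 0 = - (r *\<^sub>R n)"
      by (auto simp: circle_def n)
    then show "((\<lambda>t. pot' f (circle r n e t) (circle r e (- n) t)) has_real_derivative pot'' f x0 (r *\<^sub>R e) (- (r *\<^sub>R n))) (at 0)"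
      using pot_curve_deriv2[OF circle_deriv circle_deriv2 circle_cont f out[of 0]] by simp
    show "pot f (circle r n e t) \<le> pot f (circle r n e 0)" for t
    proof -
      have "Q (circle r n e t) \<le> Q x0" using norm_circle[OF n(1) e] r by (intro max) simp
      then show ?thesis using norm_circle[OF n(1) e] r \<open>circle r n e 0 = x0\<close> by (simp add: Q_def r_def)
    qed
  qed
  define c where "c t = (r + t) *\<^sub>R n" for t
  have cd: "(c has_vector_derivative n) (at t)" "((\<lambda>_. n) has_vector_derivative 0) (at t)" for t
    unfolding c_def[abs_def] has_vector_derivative_def
    by (auto intro!: derivative_eq_intros simp: algebra_simps fun_eq_iff)
  have nc: "norm (c t) = \<bar>r + t\<bar>" for t using n by (simp add: c_def)
  define F where "F t = (r + t) * pot f (c t)" for t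
  define F1 where "F1 t = pot f (c t) + (r + t) * pot' f (c t) n" for t
  have dF: "(F has_real_derivative F1 t) (at t)" if "D < norm (c t)" for t
    unfolding F_def[abs_def] F1_def
    by (rule DERIV_cong[OF DERIV_mult[OF _ pot_curve_deriv[OF cd _ f that]]]) (auto intro!: derivative_eq_intros)
  have c0: "c 0 = x0" by (simp add: c_def n)
  have out0: "D < norm (c 0)" using nc[of 0] r by simp
  have dF1: "(F1 has_real_derivative (2 * pot' f x0 n + r * pot'' f x0 n 0)) (at 0)"
    unfolding F1_def[abs_def]
    by (rule DERIV_cong[OF DERIV_add[OF pot_curve_deriv[OF cd _ f out0] DERIV_mult[OF _ pot_curve_deriv2[OF cd _ f out0]]]])
      (auto intro!: derivative_eq_intros simp: c0)
  have lap: "r * (2 * pot' f x0 n + r * pot'' f x0 n 0) + pot'' f x0 (r *\<^sub>R e1) (- (r *\<^sub>R n))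
     + pot'' f x0 (r *\<^sub>R e2) (- (r *\<^sub>R n)) = \<kappa>\<^sup>2 * r\<^sup>2 * pot f x0"
    using pot_laplacian[OF r(3) n(1) e(1-4) e(6) f] unfolding n(2) by blast
  have "pot f x0 > 0" using Q0 r unfolding Q_def r_def[symmetric] by (simp add: zero_less_mult_iff)
  then have "\<kappa>\<^sup>2 * r\<^sup>2 * pot f x0 > 0" using kap r by simp
  then have "r * (2 * pot' f x0 n + r * pot'' f x0 n 0) > 0"
    using lap circ[OF e(1,3)] circ[OF e(2,4)] by linarith
  then have pos: "2 * pot' f x0 n + r * pot'' f x0 n 0 > 0" using r by (simp add: zero_less_mult_iff)
  have maxF: "F t \<le> F 0" if "R \<le> r + t" for t
    using max[of "c t"] that nc[of t] nc[of 0] r Rpos by (simp add: Q_def F_def c0)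
  \<comment> \<open>On the boundary sphere positivity excludes the first alternative of
    \<open>bdry\<close>, and the second says exactly that the radial derivative of \<open>Q\<close>
    vanishes. Off the sphere the maximum is interior in the radial direction.\<close>
  have "F1 0 = 0"
  proof (cases "r = R")
    case True
    then show ?thesis using bdry[OF n(1)] \<open>pot f x0 > 0\<close> n(2) by (simp add: F1_def c0)
  next
    case False
    then have "r > R" using r by simp
    show ?thesis
      by (rule DERIV_local_max[OF dF[OF out0], of "r - R"]) (use \<open>r > R\<close> maxF in \<open>auto simp: abs_if split: if_splits\<close>)
  qed
  moreover have "(F has_real_derivative F1 t) (at t)" if "0 \<le> t" for t
    using nc[of t] that r by (intro dF) simp
  ultimately obtain t where "0 < t" "F 0 < F t"
    using increases_if_second_deriv_pos[of 1 F F1, OF _ _ _ dF1 pos] by auto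
  then show False using maxF[of t] r by simp
qed

lemma pot_exterior_zero:
  assumes f: "integrable M f"
    and bdry: "\<And>n. norm n = 1 \<Longrightarrow> pot f (R *\<^sub>R n) = 0 \<or> pot f (R *\<^sub>R n) + R * pot' f (R *\<^sub>R n) n = 0"
    and x: "R \<le> norm x"
  shows "pot f x = 0"
proof -
  have "pot (\<lambda>m. -1 * f m) x \<le> 0"
  proof (rule pot_nonpos[OF _ _ x])
    fix n :: "real^3" assume "norm n = 1"
    then show "pot (\<lambda>m. -1 * f m) (R *\<^sub>R n) = 0 \<or> pot (\<lambda>m. -1 * f m) (R *\<^sub>R n) + R * pot' (\<lambda>m. -1 * f m) (R *\<^sub>R n) n = 0"
      using bdry unfolding pot_cmult pot'_cmult by force
  qed (use f in auto)
  then show ?thesis using pot_nonpos[OF f bdry x] by (simp only: pot_cmult) simp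
qed

end

section \<open>Exterior uniqueness and the far field\<close>

lemma unit_sphere_circle:
  fixes n m :: "real^3" assumes "norm n = 1" "norm m = 1"
  obtains e \<theta> where "norm e = 1" "n \<bullet> e = 0" "m = cos \<theta> *\<^sub>R n + sin \<theta> *\<^sub>R e"
proof -
  define w where "w = m - (m \<bullet> n) *\<^sub>R n"
  have wn: "n \<bullet> w = 0" using assms by (simp add: w_def inner_diff_right inner_commute norm_eq_1)
  have ww: "(m \<bullet> n)\<^sup>2 + (norm w)\<^sup>2 = 1"
  proof -
    have "m \<bullet> m = 1" "n \<bullet> n = 1" using assms by (auto simp: norm_eq_1)
    then show ?thesis unfolding w_def power2_norm_eq_inner
      by (simp add: inner_diff_left inner_diff_right inner_commute power2_eq_square)
  qed
  obtain \<theta> where \<theta>: "m \<bullet> n = cos \<theta>" "norm w = sin \<theta>" using sincos_total_2pi[OF ww] by metis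
  obtain e where e: "norm e = 1" "n \<bullet> e = 0" "w = norm w *\<^sub>R e"
  proof (cases "w = 0")
    case True
    obtain e where "norm e = 1" "n \<bullet> e = 0" using orthonormal_frame[OF assms(1)] by metis
    then show ?thesis using that True by simp
  next
    case False
    then show ?thesis using that[of "w /\<^sub>R norm w"] wn by simp
  qed
  have "m = cos \<theta> *\<^sub>R n + sin \<theta> *\<^sub>R e" using e(3) \<theta> by (simp add: w_def algebra_simps)
  then show ?thesis using that e by blast
qed

text \<open>The kernel with the principal square root; it is used only for arguments of positive
  real part, away from the branch cut.\<close>

definition yukC :: "real \<Rightarrow> complex \<Rightarrow> complex" where
  "yukC \<kappa> w = exp (- of_real \<kappa> * csqrt w) / csqrt w"

definition yukC' :: "real \<Rightarrow> complex \<Rightarrow> complex" where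
  "yukC' \<kappa> w = (exp (- of_real \<kappa> * csqrt w) * (- of_real \<kappa> * inverse (2 * csqrt w)) * csqrt w
     - exp (- of_real \<kappa> * csqrt w) * inverse (2 * csqrt w)) / (csqrt w * csqrt w)"

lemma yukC_deriv:
  assumes "Re w > 0" shows "(yukC \<kappa> has_field_derivative yukC' \<kappa> w) (at w)"
proof -
  have w: "w \<notin> \<real>\<^sub>\<le>\<^sub>0" "csqrt w \<noteq> 0" using assms by (auto simp: complex_nonpos_Reals_iff)
  have s: "(csqrt has_field_derivative inverse (2 * csqrt w)) (at w)"
    using w by (intro has_field_derivative_csqrt)
  show ?thesis unfolding yukC_def[abs_def] yukC'_def
    by (rule DERIV_divide[OF DERIV_chain2[OF DERIV_exp DERIV_cmult[OF s]] s w(2)])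
qed

lemma yukC_of_real:
  assumes "\<rho> > 0" shows "yukC \<kappa> (of_real \<rho>) = of_real (yuk \<kappa> \<rho>)"
proof -
  have q: "csqrt (of_real \<rho>) = of_real (sqrt \<rho>)" using of_real_sqrt[of \<rho>] assms by simp
  have "exp (- of_real \<kappa> * of_real (sqrt \<rho>)) = (of_real (exp (- \<kappa> * sqrt \<rho>)) :: complex)"
    by (metis exp_of_real of_real_minus of_real_mult)
  then show ?thesis unfolding yukC_def yuk_def q by simp
qed

lemma continuous_on_yukC:
  assumes g: "continuous_on S g" and pos: "\<And>x. x \<in> S \<Longrightarrow> Re (g x) > 0"
  shows "continuous_on S (\<lambda>x. yukC \<kappa> (g x))" "continuous_on S (\<lambda>x. yukC' \<kappa> (g x))"
proof -
  have q: "continuous_on S (\<lambda>x. csqrt (g x))" "csqrt (g x) \<noteq> 0" if "x \<in> S" for x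
  proof -
    show "continuous_on S (\<lambda>x. csqrt (g x))"
      unfolding continuous_on_def
    proof
      fix x assume x: "x \<in> S"
      have "isCont csqrt (g x)" using pos[OF x] by (intro continuous_at_csqrt) (auto simp: complex_nonpos_Reals_iff)
      moreover have "(g \<longlongrightarrow> g x) (at x within S)" using g x by (simp add: continuous_on_def)
      ultimately show "((\<lambda>x. csqrt (g x)) \<longlongrightarrow> csqrt (g x)) (at x within S)" by (rule isCont_tendsto_compose)
    qed
    show "csqrt (g x) \<noteq> 0" using pos[OF that] by auto
  qed
  then show "continuous_on S (\<lambda>x. yukC \<kappa> (g x))" "continuous_on S (\<lambda>x. yukC' \<kappa> (g x))"
    unfolding yukC_def yukC'_def by (cases "S = {}"; auto intro!: continuous_intros)+
qed

context yukawa_potential begin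

text \<open>The squared distance from \<open>y\<close> to the point at angle \<open>z\<close> on a
  great circle of radius \<open>R\<close>, extended to complex angles.\<close>

definition rhoC :: "real^3 \<Rightarrow> real^3 \<Rightarrow> complex \<Rightarrow> real^3 \<Rightarrow> complex" where
  "rhoC n e z y = of_real (R\<^sup>2 + (norm y)\<^sup>2) - of_real (2 * R) * (of_real (n \<bullet> y) * cos z + of_real (e \<bullet> y) * sin z)"

lemma rhoC_of_real:
  assumes "norm n = 1" "norm e = 1" "n \<bullet> e = 0"
  shows "rhoC n e (of_real \<theta>) y = of_real ((norm (circle R n e \<theta> - y))\<^sup>2)"
proof -
  have "(norm (circle R n e \<theta> - y))\<^sup>2 = (norm (circle R n e \<theta>))\<^sup>2 + (norm y)\<^sup>2 - 2 * (circle R n e \<theta> \<bullet> y)"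
    by (simp add: power2_norm_eq_inner inner_diff_left inner_diff_right inner_commute)
  also have "\<dots> = R\<^sup>2 + (norm y)\<^sup>2 - 2 * R * ((n \<bullet> y) * cos \<theta> + (e \<bullet> y) * sin \<theta>)"
    using norm_circle[OF assms, of R] D by (simp add: circle_def inner_add_left algebra_simps)
  finally show ?thesis by (simp add: rhoC_def cos_of_real sin_of_real)
qed

text \<open>An imaginary part t of the angle multiplies the cosine and sine terms, in the real part,
  by cosh t. Hence the real part is at least (R - D)^2 - 2 R D (cosh t - 1), which is positive on a
  strip whose width does not depend on \<open>y\<close>.\<close>

lemma Re_rhoC_pos:
  assumes "norm n = 1" "norm e = 1" "n \<bullet> e = 0"
  shows "\<exists>\<delta>>0. \<forall>z y. \<bar>Im z\<bar> < \<delta> \<longrightarrow> norm y \<le> D \<longrightarrow> 0 < Re (rhoC n e z y)"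
proof -
  have "((\<lambda>t::real. 2 * R * D * ((exp t + exp (- t)) / 2 - 1)) \<longlongrightarrow> 2 * R * D * ((exp 0 + exp (- 0)) / 2 - 1)) (at 0)"
    by (intro tendsto_intros) auto
  then have lim: "((\<lambda>t::real. 2 * R * D * ((exp t + exp (- t)) / 2 - 1)) \<longlongrightarrow> 0) (at 0)" by simp
  have "(R - D)\<^sup>2 > 0" using D by simp
  then obtain \<delta> where \<delta>: "\<delta> > 0" "\<And>t. t \<noteq> 0 \<Longrightarrow> \<bar>t\<bar> < \<delta> \<Longrightarrow> 2 * R * D * ((exp t + exp (- t)) / 2 - 1) < (R - D)\<^sup>2"
    using order_tendstoD(2)[OF lim \<open>(R - D)\<^sup>2 > 0\<close>] unfolding eventually_at by (auto simp: dist_norm)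
  have "0 < Re (rhoC n e z y)" if z: "\<bar>Im z\<bar> < \<delta>" and y: "norm y \<le> D" for z y
  proof -
    define C where "C = (exp (Im z) + exp (- Im z)) / 2"
    define a where "a = (n \<bullet> y) * cos (Re z) + (e \<bullet> y) * sin (Re z)"
    have re: "Re (rhoC n e z y) = R\<^sup>2 + (norm y)\<^sup>2 - 2 * R * (a * C)"
      by (simp add: rhoC_def Re_cos Re_sin a_def C_def algebra_simps add_divide_distrib)
    have "a = circle 1 n e (Re z) \<bullet> y" by (simp add: a_def circle_def inner_add_left)
    then have "a \<le> norm (circle 1 n e (Re z)) * norm y" using norm_cauchy_schwarz by simp
    then have a: "a \<le> norm y" using norm_circle[OF assms, of 1] by simp
    have C1: "C \<ge> 1"
      using cosh_real_ge_1[of "Im z"] by (simp add: C_def cosh_field_def)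
    have C2: "2 * R * D * (C - 1) < (R - D)\<^sup>2"
      using \<delta>(2)[of "Im z"] z \<open>(R - D)\<^sup>2 > 0\<close> by (cases "Im z = 0") (auto simp: C_def)
    have "a * C \<le> norm y * C" using a C1 by (intro mult_right_mono) auto
    then have "2 * R * (a * C) \<le> 2 * R * (norm y * C)" using D by (intro mult_left_mono) auto
    also have "\<dots> = 2 * R * norm y + 2 * R * norm y * (C - 1)" by (simp add: algebra_simps)
    also have "\<dots> \<le> 2 * R * norm y + 2 * R * D * (C - 1)"
      using D C1 y by (intro add_left_mono mult_right_mono mult_left_mono) auto
    finally have "Re (rhoC n e z y) \<ge> (R - norm y)\<^sup>2 - 2 * R * D * (C - 1)"
      unfolding re power2_diff by simp
    moreover have "(R - norm y)\<^sup>2 \<ge> (R - D)\<^sup>2" using D y by (intro power_mono) auto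
    ultimately show ?thesis using C2 by simp
  qed
  then show ?thesis using \<delta> by blast
qed

text \<open>The potential extends holomorphically along great circles, so the identity theorem
  spreads the boundary condition from an open patch to the whole sphere.\<close>

lemma tangential_zero_extends:
  fixes f :: "'m \<Rightarrow> real^3"
  assumes f: "integrable M f"
    and \<Gamma>: "openin (top_of_set (sphere 0 R)) \<Gamma>" "\<Gamma> \<noteq> {}"
    and zero: "\<And>x. x \<in> \<Gamma> \<Longrightarrow> pot (\<lambda>m. f m \<bullet> u) x * (x \<bullet> v) = pot (\<lambda>m. f m \<bullet> v) x * (x \<bullet> u)"
    and x: "norm x = R"
  shows "pot (\<lambda>m. f m \<bullet> u) x * (x \<bullet> v) = pot (\<lambda>m. f m \<bullet> v) x * (x \<bullet> u)"
proof -
  have R: "R > 0" using D by simp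
  obtain x0 where x0: "x0 \<in> \<Gamma>" using \<Gamma> by auto
  obtain O' where O': "open O'" "\<Gamma> = sphere 0 R \<inter> O'" using \<Gamma>(1) by (auto simp: openin_open)
  have nx0: "norm x0 = R" using x0 O' by auto
  define n where "n = x0 /\<^sub>R R"
  have n: "norm n = 1" using nx0 R by (simp add: n_def)
  obtain e \<theta> where e: "norm e = 1" "n \<bullet> e = 0" and \<theta>: "x /\<^sub>R R = cos \<theta> *\<^sub>R n + sin \<theta> *\<^sub>R e"
    using unit_sphere_circle[OF n, of "x /\<^sub>R R"] x R by auto
  have xc: "x = circle R n e \<theta>"
  proof -
    have "x = R *\<^sub>R (x /\<^sub>R R)" using R by simp
    then show ?thesis unfolding \<theta> by (simp add: circle_def scaleR_add_right)
  qed
  obtain \<delta> where \<delta>: "\<delta> > 0" "\<And>z y. \<bar>Im z\<bar> < \<delta> \<Longrightarrow> norm y \<le> D \<Longrightarrow> 0 < Re (rhoC n e z y)"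
    using Re_rhoC_pos[OF n e] by blast
  define S where "S = {z. Im z < \<delta>} \<inter> {z. Im z > - \<delta>}"
  have S: "open S" "connected S" "\<And>z. z \<in> S \<longleftrightarrow> \<bar>Im z\<bar> < \<delta>"
    unfolding S_def by (auto intro!: open_Int open_halfspace_Im_lt open_halfspace_Im_gt convex_connected convex_Int
        convex_halfspace_Im_lt convex_halfspace_Im_gt)
  define G where "G w z = (\<integral>m. (f m \<bullet> w) *\<^sub>R yukC \<kappa> (rhoC n e z (Y m)) \<partial>M)" for w z
  have fi: "integrable M (\<lambda>m. f m \<bullet> w)" for w using f by simp
  have Gd: "(G w has_field_derivative (\<integral>m. (f m \<bullet> w) *\<^sub>R (yukC' \<kappa> (rhoC n e z (Y m)) *
       (- of_real (2 * R) * (of_real (n \<bullet> Y m) * - sin z + of_real (e \<bullet> Y m) * cos z))) \<partial>M)) (at z)"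
    if "z \<in> S" for z w
    unfolding G_def[abs_def]
  proof (rule has_field_derivative_integral_parameter[OF fi Y_meas Y_cball compact_cball S(1) that])
    have c: "continuous_on (S \<times> cball 0 D) (\<lambda>p. rhoC n e (fst p) (snd p))"
      unfolding rhoC_def by (intro continuous_intros)
    have pos: "Re (rhoC n e (fst p) (snd p)) > 0" if "p \<in> S \<times> cball 0 D" for p
      using that \<delta>(2) S(3) by auto
    show "continuous_on (S \<times> cball 0 D) (\<lambda>(z, y). yukC \<kappa> (rhoC n e z y))"
      unfolding case_prod_beta by (rule continuous_on_yukC[OF c pos])
    show "continuous_on (S \<times> cball 0 D) (\<lambda>(z, y). yukC' \<kappa> (rhoC n e z y) *
       (- of_real (2 * R) * (of_real (n \<bullet> y) * - sin z + of_real (e \<bullet> y) * cos z)))"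
      unfolding case_prod_beta by (intro continuous_intros continuous_on_yukC[OF c pos])
    show "((\<lambda>z. yukC \<kappa> (rhoC n e z y)) has_field_derivative yukC' \<kappa> (rhoC n e z y) *
       (- of_real (2 * R) * (of_real (n \<bullet> y) * - sin z + of_real (e \<bullet> y) * cos z))) (at z)"
      if "z \<in> S" "y \<in> cball 0 D" for z y
    proof (rule DERIV_chain2[OF yukC_deriv])
      show "0 < Re (rhoC n e z y)" using that \<delta>(2) S(3) by auto
      show "((\<lambda>z. rhoC n e z y) has_field_derivative
         - of_real (2 * R) * (of_real (n \<bullet> y) * - sin z + of_real (e \<bullet> y) * cos z)) (at z)"
        unfolding rhoC_def by (auto intro!: derivative_eq_intros)
    qed
  qed
  have Greal: "G w (of_real t) = of_real (pot (\<lambda>m. f m \<bullet> w) (circle R n e t))" for w t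
  proof -
    have "G w (of_real t) = (\<integral>m. of_real ((f m \<bullet> w) * yuk \<kappa> ((norm (circle R n e t - Y m))\<^sup>2)) \<partial>M)"
      unfolding G_def rhoC_of_real[OF n e]
    proof (rule Bochner_Integration.integral_cong[OF refl])
      fix m assume "m \<in> space M"
      then have "0 < (norm (circle R n e t - Y m))\<^sup>2"
        using D norm_circle[OF n e, of R t] by (intro dist_pos Y_le) auto
      then show "(f m \<bullet> w) *\<^sub>R yukC \<kappa> (of_real ((norm (circle R n e t - Y m))\<^sup>2)) =
         of_real ((f m \<bullet> w) * yuk \<kappa> ((norm (circle R n e t - Y m))\<^sup>2))"
        by (simp only: yukC_of_real of_real_mult scaleR_conv_of_real)
    qed
    then show ?thesis by (simp only: pot_def integral_complex_of_real)
  qed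
  define X where "X w z = of_real R * (cos z * of_real (n \<bullet> w) + sin z * of_real (e \<bullet> w))" for w and z :: complex
  have Xreal: "X w (of_real t) = of_real (circle R n e t \<bullet> w)" for w t
    by (simp add: X_def circle_def inner_add_left cos_of_real sin_of_real algebra_simps)
  \<comment> \<open>At real angles \<open>H\<close> is the defect in the tangential condition for
    the directions \<open>u\<close> and \<open>v\<close>. It is holomorphic on the strip and
    vanishes near angle 0, the point chosen in \<Gamma>.\<close>
  define H where "H z = G u z * X v z - G v z * X u z" for z
  have "G w holomorphic_on S" for w
    using Gd S(1) by (auto simp: holomorphic_on_open)
  moreover have "X w holomorphic_on S" for w unfolding X_def by (intro holomorphic_intros)
  ultimately have Hh: "H holomorphic_on S" unfolding H_def[abs_def] by (intro holomorphic_intros)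
  have Hreal: "H (of_real t) = of_real (pot (\<lambda>m. f m \<bullet> u) (circle R n e t) * (circle R n e t \<bullet> v)
      - pot (\<lambda>m. f m \<bullet> v) (circle R n e t) * (circle R n e t \<bullet> u))" for t
    by (simp add: H_def Greal Xreal)
  have "open (circle R n e -` O')"
    using continuous_open_preimage[OF circle_cont[of UNIV] open_UNIV O'(1)] by simp
  moreover have "0 \<in> circle R n e -` O'" using x0 O' R by (simp add: circle_def n_def)
  ultimately obtain d where d: "d > 0" "ball 0 d \<subseteq> circle R n e -` O'" using open_contains_ball by blast
  have H0: "H (of_real t) = 0" if "\<bar>t\<bar> < d" for t
  proof -
    have "t \<in> ball 0 d" using that by simp
    then have "circle R n e t \<in> \<Gamma>" using d(2) norm_circle[OF n e, of R] R O'(2) by auto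
    then show ?thesis using zero unfolding Hreal by simp
  qed
  have "H (of_real \<theta>) = 0"
  proof (rule analytic_continuation[OF Hh S(1,2), of "of_real ` ball 0 d" 0])
    show "of_real ` ball 0 d \<subseteq> S" using \<delta> S(3) by auto
    show "0 \<in> S" "of_real \<theta> \<in> S" using \<delta> S(3) by auto
    show "H z = 0" if "z \<in> of_real ` ball 0 d" for z using that H0 by auto
    show "(0::complex) islimpt of_real ` ball 0 d"
      unfolding islimpt_approachable
    proof (intro allI impI)
      fix r :: real assume "r > 0"
      define t where "t = min (r/2) (d/2)"
      have "t \<in> ball 0 d" "t \<noteq> 0" "\<bar>t\<bar> < r" using \<open>r > 0\<close> d by (auto simp: t_def)
      then show "\<exists>y\<in>of_real ` ball 0 d. y \<noteq> (0::complex) \<and> dist y 0 < r" by (intro bexI[of _ "of_real t"]) auto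
    qed
  qed
  then show ?thesis unfolding Hreal xc of_real_eq_0_iff by simp
qed

section \<open>From a vanishing tangential trace to a vanishing exterior field\<close>

lemma pot'_scale: "pot' g x (a *\<^sub>R v) = a * pot' g x v"
  unfolding pot'_def by (simp add: algebra_simps flip: integral_mult_right_zero)

text \<open>Let W be the vector potential with density \<open>f\<close>. The hypothesis
  \<open>div'\<close> is div W = 0, and \<open>div\<close> gives x . W as the scalar potential with
  density \<open>f m \<bullet> Y m\<close>. The scalar is shown to vanish first, through its radial
  derivative on the sphere; the components of W follow.\<close>

lemma pot_tangential:
  fixes f :: "'m \<Rightarrow> real^3"
  assumes f: "integrable M f"
    and tan: "\<And>x u v. norm x = R \<Longrightarrow> pot (\<lambda>m. f m \<bullet> u) x * (x \<bullet> v) = pot (\<lambda>m. f m \<bullet> v) x * (x \<bullet> u)"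
    and div: "\<And>x. D < norm x \<Longrightarrow> (\<integral>m. (f m \<bullet> (x - Y m)) * yuk \<kappa> ((norm (x - Y m))\<^sup>2) \<partial>M) = 0"
    and div': "\<And>x. D < norm x \<Longrightarrow> (\<integral>m. (f m \<bullet> (x - Y m)) * yuk' \<kappa> ((norm (x - Y m))\<^sup>2) \<partial>M) = 0"
    and x: "R \<le> norm x"
  shows "pot (\<lambda>m. f m \<bullet> u) x = 0"
proof -
  have R: "R > 0" using D by simp
  have fi: "integrable M (\<lambda>m. f m \<bullet> w)" for w using f by simp
  have fY: "integrable M (\<lambda>m. f m \<bullet> Y m)"
  proof (rule Bochner_Integration.integrable_bound)
    show "integrable M (\<lambda>m. D * norm (f m))" using f by simp
    show "(\<lambda>m. f m \<bullet> Y m) \<in> borel_measurable M" using f Y_meas by measurable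
    show "AE m in M. norm (f m \<bullet> Y m) \<le> norm (D * norm (f m))"
    proof (rule AE_I2)
      fix m assume "m \<in> space M"
      have "\<bar>f m \<bullet> Y m\<bar> \<le> norm (f m) * norm (Y m)" by (rule Cauchy_Schwarz_ineq2)
      also have "\<dots> \<le> norm (f m) * D" using Y_le[OF \<open>m \<in> space M\<close>] by (intro mult_left_mono) auto
      finally show "norm (f m \<bullet> Y m) \<le> norm (D * norm (f m))" using D by (simp add: mult.commute)
    qed
  qed
  have ik: "integrable M (\<lambda>m. g m * yuk \<kappa> ((norm (x - Y m))\<^sup>2))" if "integrable M g" "D < norm x" for g x
    using that dist_pos[OF that(2)] by (intro integrable_kernel) (auto intro!: continuous_intros)
  have q: "pot (\<lambda>m. f m \<bullet> Y m) x = pot (\<lambda>m. f m \<bullet> x) x" if x: "D < norm x" for x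
  proof -
    have "pot (\<lambda>m. f m \<bullet> x) x - pot (\<lambda>m. f m \<bullet> Y m) x = (\<integral>m. (f m \<bullet> (x - Y m)) * yuk \<kappa> ((norm (x - Y m))\<^sup>2) \<partial>M)"
      unfolding pot_def Bochner_Integration.integral_diff[OF ik[OF fi x] ik[OF fY x], symmetric]
      by (simp only: inner_diff_right left_diff_distrib)
    then show ?thesis using div[OF x] by simp
  qed
  have tan0: "pot (\<lambda>m. f m \<bullet> e) (R *\<^sub>R n) = 0" if "norm n = 1" "n \<bullet> e = 0" for n e
  proof -
    have "n \<bullet> n = 1" using that by (simp add: norm_eq_1)
    then show ?thesis using tan[of "R *\<^sub>R n" e n] that R by simp
  qed
  \<comment> \<open>Differentiating the identically vanishing tangential component along the great
    circle gives R times the tangential derivative of W in direction \<open>e\<close>, minus the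
    normal component produced by the rotating frame.\<close>
  have circ: "R * pot' (\<lambda>m. f m \<bullet> e) (R *\<^sub>R n) e = pot (\<lambda>m. f m \<bullet> n) (R *\<^sub>R n)"
    if n: "norm n = 1" and e: "norm e = 1" "n \<bullet> e = 0" for n e
  proof -
    have out: "D < norm (circle R n e t)" for t using norm_circle[OF n e, of R] D by simp
    let ?F = "\<lambda>t. cos t * pot (\<lambda>m. f m \<bullet> e) (circle R n e t) - sin t * pot (\<lambda>m. f m \<bullet> n) (circle R n e t)"
    have F0: "?F = (\<lambda>_. 0)"
    proof
      fix t
      have nn: "n \<bullet> n = 1" "e \<bullet> e = 1" "e \<bullet> n = 0" using n e by (simp_all add: norm_eq_1 inner_commute)
      have "circle R n e t \<bullet> n = R * cos t" "circle R n e t \<bullet> e = R * sin t"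
        using nn e by (simp_all add: circle_def inner_add_left)
      then show "?F t = 0" using tan[of "circle R n e t" e n] norm_circle[OF n e, of R t] R
        by (simp add: algebra_simps)
    qed
    have d: "((\<lambda>t. pot (\<lambda>m. f m \<bullet> w) (circle R n e t)) has_real_derivative
        pot' (\<lambda>m. f m \<bullet> w) (circle R n e 0) (circle R e (- n) 0)) (at 0)" for w
      by (rule pot_curve_deriv[OF circle_deriv circle_deriv2 circle_cont fi out])
    have c0: "circle R n e 0 = R *\<^sub>R n" "circle R e (- n) 0 = R *\<^sub>R e" by (auto simp: circle_def)
    have "(?F has_real_derivative (R * pot' (\<lambda>m. f m \<bullet> e) (R *\<^sub>R n) e - pot (\<lambda>m. f m \<bullet> n) (R *\<^sub>R n))) (at 0)"
      by (rule DERIV_cong[OF DERIV_diff[OF DERIV_mult[OF DERIV_cos d] DERIV_mult[OF DERIV_sin d]]])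
        (simp add: c0 pot'_scale)
    then show ?thesis unfolding F0 using DERIV_unique[OF _ DERIV_const] by fastforce
  qed
  \<comment> \<open>The divergence is the sum of the three directional derivatives in the frame. The
    two tangential ones each equal the normal component divided by \<open>R\<close>, which
    determines the normal one.\<close>
  have nn: "pot' (\<lambda>m. f m \<bullet> n) (R *\<^sub>R n) n = - 2 * pot (\<lambda>m. f m \<bullet> n) (R *\<^sub>R n) / R" if n: "norm n = 1" for n
  proof -
    obtain e1 e2 where e: "norm e1 = 1" "norm e2 = 1" "n \<bullet> e1 = 0" "n \<bullet> e2 = 0" "e1 \<bullet> e2 = 0"
      and frame: "\<And>u v. u \<bullet> v = (u \<bullet> n) * (v \<bullet> n) + (u \<bullet> e1) * (v \<bullet> e1) + (u \<bullet> e2) * (v \<bullet> e2)"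
      using orthonormal_frame[OF n] by metis
    have out: "D < norm (R *\<^sub>R n)" using n D by simp
    have ik': "integrable M (\<lambda>m. g m * (yuk' \<kappa> ((norm (R *\<^sub>R n - Y m))\<^sup>2) * (2 * ((R *\<^sub>R n - Y m) \<bullet> w))))"
      if "integrable M g" for g w
      using dist_pos[OF out] by (intro integrable_kernel[OF that]) (auto intro!: continuous_intros)
    have "pot' (\<lambda>m. f m \<bullet> n) (R *\<^sub>R n) n + pot' (\<lambda>m. f m \<bullet> e1) (R *\<^sub>R n) e1 + pot' (\<lambda>m. f m \<bullet> e2) (R *\<^sub>R n) e2
      = (\<integral>m. 2 * ((f m \<bullet> (R *\<^sub>R n - Y m)) * yuk' \<kappa> ((norm (R *\<^sub>R n - Y m))\<^sup>2)) \<partial>M)"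
    proof -
      define t where "t m w = (f m \<bullet> w) * (yuk' \<kappa> ((norm (R *\<^sub>R n - Y m))\<^sup>2) * (2 * ((R *\<^sub>R n - Y m) \<bullet> w)))" for m w
      have i: "integrable M (\<lambda>m. t m w)" for w unfolding t_def by (rule ik'[OF fi])
      have "2 * ((f m \<bullet> (R *\<^sub>R n - Y m)) * yuk' \<kappa> ((norm (R *\<^sub>R n - Y m))\<^sup>2)) = t m n + t m e1 + t m e2" for m
        unfolding t_def frame[of "f m" "R *\<^sub>R n - Y m"] by algebra
      then show ?thesis unfolding pot'_def t_def[symmetric] using i by simp
    qed
    also have "\<dots> = 0" using div'[OF out] by simp
    finally have "R * pot' (\<lambda>m. f m \<bullet> n) (R *\<^sub>R n) n + R * pot' (\<lambda>m. f m \<bullet> e1) (R *\<^sub>R n) e1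
        + R * pot' (\<lambda>m. f m \<bullet> e2) (R *\<^sub>R n) e2 = 0"
      by (metis distrib_left mult_zero_right)
    then show ?thesis using circ[OF n e(1,3)] circ[OF n e(2,4)] R by (simp add: field_simps)
  qed
  \<comment> \<open>Along the ray the scalar x . W is (R + t) times the normal component. By
    \<open>nn\<close> the derivative of this product at the sphere is minus the normal component,
    which cancels the first term.\<close>
  have bdry: "pot (\<lambda>m. f m \<bullet> Y m) (R *\<^sub>R n) + R * pot' (\<lambda>m. f m \<bullet> Y m) (R *\<^sub>R n) n = 0" if n: "norm n = 1" for n
  proof -
    let ?w = "pot (\<lambda>m. f m \<bullet> n) (R *\<^sub>R n)"
    define c where "c t = (R + t) *\<^sub>R n" for t
    have cd: "(c has_vector_derivative n) (at t)" "((\<lambda>_. n) has_vector_derivative 0) (at t)" for t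
      unfolding c_def[abs_def] has_vector_derivative_def
      by (auto intro!: derivative_eq_intros simp: algebra_simps fun_eq_iff)
    have nc: "norm (c t) = \<bar>R + t\<bar>" for t using n by (simp add: c_def)
    have c0: "c 0 = R *\<^sub>R n" by (simp add: c_def)
    have out: "D < norm (c 0)" using nc[of 0] D by simp
    have d: "((\<lambda>t. pot g (c t)) has_real_derivative pot' g (c 0) n) (at 0)" if "integrable M g" for g
      by (rule pot_curve_deriv[OF cd _ that out]) (auto intro: continuous_intros)
    have px: "pot (\<lambda>m. f m \<bullet> c t) (c t) = (R + t) * pot (\<lambda>m. f m \<bullet> n) (c t)" for t
      using pot_cmult[of "R + t" "\<lambda>m. f m \<bullet> n"] by (simp add: c_def)
    have "eventually (\<lambda>t. t \<in> {-(R - D)<..<R - D}) (nhds (0::real))"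
      using D by (intro eventually_nhds_in_open) auto
    then have "eventually (\<lambda>t. pot (\<lambda>m. f m \<bullet> Y m) (c t) = (R + t) * pot (\<lambda>m. f m \<bullet> n) (c t)) (nhds 0)"
    proof eventually_elim
      case (elim t)
      then have "D < norm (c t)" using nc[of t] by auto
      from q[OF this] px[of t] show ?case by simp
    qed
    moreover have "((\<lambda>t. (R + t) * pot (\<lambda>m. f m \<bullet> n) (c t)) has_real_derivative
        (?w + R * pot' (\<lambda>m. f m \<bullet> n) (R *\<^sub>R n) n)) (at 0)"
      by (rule DERIV_cong[OF DERIV_mult[OF _ d[OF fi]]]) (auto intro!: derivative_eq_intros simp: c0)
    ultimately have "((\<lambda>t. pot (\<lambda>m. f m \<bullet> Y m) (c t)) has_real_derivative
        (?w + R * pot' (\<lambda>m. f m \<bullet> n) (R *\<^sub>R n) n)) (at 0)"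
      by (subst DERIV_cong_ev[OF refl _ refl])
    then have "pot' (\<lambda>m. f m \<bullet> Y m) (R *\<^sub>R n) n = - ?w"
      using DERIV_unique[OF d[OF fY]] nn[OF n] R by (simp add: c0)
    moreover have "pot (\<lambda>m. f m \<bullet> Y m) (R *\<^sub>R n) = R * ?w"
      using q[OF out] px[of 0] by (simp add: c0)
    ultimately show ?thesis by simp
  qed
  \<comment> \<open>With x . W = 0 the normal component vanishes, and the tangential condition then
    removes the others; each component now has zero boundary values.\<close>
  have V0: "pot (\<lambda>m. f m \<bullet> w) (R *\<^sub>R n) = 0" if n: "norm n = 1" for n w
  proof -
    have "pot (\<lambda>m. f m \<bullet> Y m) (R *\<^sub>R n) = 0"
      using bdry by (intro pot_exterior_zero[OF fY]) (auto simp: n D less_imp_le R)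
    moreover have "pot (\<lambda>m. f m \<bullet> (R *\<^sub>R n)) (R *\<^sub>R n) = R * pot (\<lambda>m. f m \<bullet> n) (R *\<^sub>R n)"
      using pot_cmult[of "R" "\<lambda>m. f m \<bullet> n"] by simp
    ultimately have 0: "pot (\<lambda>m. f m \<bullet> n) (R *\<^sub>R n) = 0" using q[of "R *\<^sub>R n"] n D by simp
    have "pot (\<lambda>m. f m \<bullet> w) (R *\<^sub>R n) * ((R *\<^sub>R n) \<bullet> n) = 0"
      using tan[of "R *\<^sub>R n" w n] n R 0 by simp
    then show ?thesis using n R by auto
  qed
  show ?thesis using V0 by (intro pot_exterior_zero[OF fi _ x]) auto
qed

text \<open>At x = r \<omega> the distance to \<open>Y m\<close> is r - \<omega> . Y m + o(1), so r
  exp(\<kappa> r) times the kernel tends to exp(\<kappa> (\<omega> . Y m)). The prefactor times a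
  zero potential stays zero in the limit.\<close>

lemma far_field_zero:
  assumes g: "integrable M g" and zero: "\<And>x. R \<le> norm x \<Longrightarrow> pot g x = 0" and \<omega>: "norm \<omega> = 1"
  shows "(\<integral>m. g m * exp (\<kappa> * (\<omega> \<bullet> Y m)) \<partial>M) = 0"
proof -
  have R: "R > 0" using D by simp
  define r where "r k = R + real k" for k
  define h where "h k y = r k * exp (\<kappa> * r k) * yuk \<kappa> ((norm (r k *\<^sub>R \<omega> - y))\<^sup>2)" for k y
  have r: "r k \<ge> R" "r k > 0" "r k > D" for k using R D by (auto simp: r_def)
  \<comment> \<open>The dominating constant comes from |r \<omega> - Y m| >= r - D, which bounds the
    scaled kernel by exp(\<kappa> D) r / (r - D), together with r / (r - D) = 1 + D / (r - D) and r
    >= R.\<close>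
  have "(\<lambda>k. \<integral>m. g m * h k (Y m) \<partial>M) \<longlonglongrightarrow> (\<integral>m. g m * exp (\<kappa> * (\<omega> \<bullet> Y m)) \<partial>M)"
  proof (rule integral_dominated_convergence[where w = "\<lambda>m. \<bar>g m\<bar> * (exp (\<kappa> * D) * (1 + D / (R - D)))"])
    show "(\<lambda>m. g m * exp (\<kappa> * (\<omega> \<bullet> Y m))) \<in> borel_measurable M" using g Y_meas by measurable
    show "(\<lambda>m. g m * h k (Y m)) \<in> borel_measurable M" for k
      using g Y_meas unfolding h_def yuk_def by measurable
    show "integrable M (\<lambda>m. \<bar>g m\<bar> * (exp (\<kappa> * D) * (1 + D / (R - D))))" using g by simp
    show "AE m in M. (\<lambda>k. g m * h k (Y m)) \<longlonglongrightarrow> g m * exp (\<kappa> * (\<omega> \<bullet> Y m))"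
    proof (intro AE_I2 tendsto_intros)
      fix m
      define a where "a = \<omega> \<bullet> Y m"
      define b where "b = (norm (Y m))\<^sup>2"
      have sq: "(norm (s *\<^sub>R \<omega> - Y m))\<^sup>2 = s\<^sup>2 - 2 * s * a + b" for s
        using \<omega> unfolding a_def b_def power2_norm_eq_inner by (simp add: inner_diff_left inner_diff_right norm_eq_1 inner_commute power2_eq_square)
      have "((\<lambda>s. s * exp (\<kappa> * s) * (exp (- \<kappa> * sqrt (s\<^sup>2 - 2 * s * a + b)) / sqrt (s\<^sup>2 - 2 * s * a + b))) \<longlongrightarrow> exp (\<kappa> * a)) at_top"
        using kap by real_asymp
      moreover have "filterlim r at_top sequentially" unfolding r_def by real_asymp
      ultimately show "(\<lambda>k. h k (Y m)) \<longlonglongrightarrow> exp (\<kappa> * (\<omega> \<bullet> Y m))"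
        unfolding h_def sq yuk_def a_def[symmetric] by (rule filterlim_compose)
    qed
    show "AE m in M. norm (g m * h k (Y m)) \<le> \<bar>g m\<bar> * (exp (\<kappa> * D) * (1 + D / (R - D)))" for k
    proof (intro AE_I2)
      fix m assume m: "m \<in> space M"
      have "r k - D \<le> norm (r k *\<^sub>R \<omega>) - norm (Y m)" using \<omega> r[of k] Y_le[OF m] by simp
      also have "\<dots> \<le> norm (r k *\<^sub>R \<omega> - Y m)" by (rule norm_triangle_ineq2)
      finally have "(r k - D)\<^sup>2 \<le> (norm (r k *\<^sub>R \<omega> - Y m))\<^sup>2" using r[of k] by (intro power_mono) auto
      then have y: "0 < yuk \<kappa> ((norm (r k *\<^sub>R \<omega> - Y m))\<^sup>2)" "yuk \<kappa> ((norm (r k *\<^sub>R \<omega> - Y m))\<^sup>2) \<le> exp (- \<kappa> * (r k - D)) / (r k - D)"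
        using yuk_mono[of \<kappa> "(r k - D)\<^sup>2" "(norm (r k *\<^sub>R \<omega> - Y m))\<^sup>2"] r[of k] kap by (simp_all add: yuk_def)
      have "h k (Y m) \<le> r k * exp (\<kappa> * r k) * (exp (- \<kappa> * (r k - D)) / (r k - D))"
        unfolding h_def using y r[of k] by (intro mult_left_mono) auto
      also have "\<dots> = exp (\<kappa> * D) * (r k / (r k - D))"
      proof -
        have "exp (\<kappa> * r k) * exp (- \<kappa> * (r k - D)) = exp (\<kappa> * D)" by (simp add: mult_exp_exp algebra_simps)
        then show ?thesis by (metis (no_types, opaque_lifting) mult.commute mult.left_commute times_divide_eq_right)
      qed
      also have "r k / (r k - D) = 1 + D / (r k - D)" using r[of k] by (simp add: field_simps)
      also have "D / (r k - D) \<le> D / (R - D)" using r[of k] D by (intro divide_left_mono) auto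
      finally have "h k (Y m) \<le> exp (\<kappa> * D) * (1 + D / (R - D))" by simp
      moreover have "h k (Y m) > 0" using y r[of k] by (simp add: h_def)
      ultimately show "norm (g m * h k (Y m)) \<le> \<bar>g m\<bar> * (exp (\<kappa> * D) * (1 + D / (R - D)))"
        by (auto simp: abs_mult intro!: mult_left_mono)
    qed
  qed
  moreover have "(\<integral>m. g m * h k (Y m) \<partial>M) = 0" for k
  proof -
    have "(\<integral>m. g m * h k (Y m) \<partial>M) = r k * exp (\<kappa> * r k) * pot g (r k *\<^sub>R \<omega>)"
      unfolding pot_def h_def by (simp add: mult.left_commute[of "g _"])
    then show ?thesis using zero[of "r k *\<^sub>R \<omega>"] \<omega> r[of k] by simp
  qed
  ultimately show ?thesis by (simp only: LIMSEQ_const_iff)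
qed

end

section \<open>Laplace transforms of compactly supported sources\<close>

text \<open>Linear combinations of real exponentials; products of exponentials are exponentials, so
  this is an algebra to which the Stone-Weierstrass theorem applies.\<close>

inductive_set exp_span :: "(real^3 \<Rightarrow> real) set" where
  exp: "(\<lambda>y. c * exp (\<xi> \<bullet> y)) \<in> exp_span"
| add: "f \<in> exp_span \<Longrightarrow> g \<in> exp_span \<Longrightarrow> (\<lambda>y. f y + g y) \<in> exp_span"

lemma exp_span_mult:
  assumes "f \<in> exp_span" "g \<in> exp_span"
  shows "(\<lambda>y. f y * g y) \<in> exp_span"
  using assms(1)
proof induction
  case (exp c \<xi>)
  show ?case using assms(2)
  proof induction
    case (exp d \<eta>)
    have "(\<lambda>y. c * exp (\<xi> \<bullet> y) * (d * exp (\<eta> \<bullet> y))) = (\<lambda>y. (c * d) * exp ((\<xi> + \<eta>) \<bullet> y))"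
      by (simp add: fun_eq_iff inner_add_left exp_add)
    then show ?case using exp_span.exp[of "c * d" "\<xi> + \<eta>"] by simp
  next
    case (add f g)
    then show ?case using exp_span.add by (simp add: distrib_left)
  qed
next
  case (add f1 f2)
  then show ?case using exp_span.add by (simp add: distrib_right)
qed

lemma exp_span_continuous: "f \<in> exp_span \<Longrightarrow> continuous_on S f"
  by (induction rule: exp_span.induct) (auto intro!: continuous_intros)

lemma integrable_mult_continuous:
  fixes J :: "real^3 \<Rightarrow> real"
  assumes J: "integrable lborel J" "\<And>y. y \<notin> K \<Longrightarrow> J y = 0" and K: "compact K" and \<phi>: "continuous_on UNIV \<phi>"
  shows "integrable lborel (\<lambda>y. J y * \<phi> y)"
proof -
  obtain B where B: "\<And>y. y \<in> K \<Longrightarrow> norm (\<phi> y) \<le> B"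
    using compact_imp_bounded[OF compact_continuous_image[OF continuous_on_subset[OF \<phi>] K]] unfolding bounded_iff by auto
  show ?thesis
  proof (rule Bochner_Integration.integrable_bound)
  show "integrable lborel (\<lambda>y. B * J y)" using J by simp
  have "\<phi> \<in> borel_measurable lborel" using borel_measurable_continuous_onI[OF \<phi>] by simp
  then show "(\<lambda>y. J y * \<phi> y) \<in> borel_measurable lborel" using J by measurable
  have "norm (J y * \<phi> y) \<le> norm (B * J y)" for y
  proof (cases "y \<in> K")
    case True
    have "\<bar>J y\<bar> * norm (\<phi> y) \<le> \<bar>J y\<bar> * \<bar>B\<bar>" using B[OF True] by (intro mult_left_mono) auto
    then show ?thesis by (simp add: abs_mult mult.commute)
  qed (simp add: J)
  then show "AE y in lborel. norm (J y * \<phi> y) \<le> norm (B * J y)" by simp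
  qed
qed

text \<open>In a fixed direction \<omega> the Laplace transform is entire, because \<open>J\<close>
  has compact support. Its zeros on the interval from 0 to \<kappa>0 accumulate at the origin, so it
  vanishes at every complex argument.\<close>

lemma exp_moments_extend:
  fixes J :: "real^3 \<Rightarrow> real"
  assumes J: "integrable lborel J" "\<And>y. y \<notin> K \<Longrightarrow> J y = 0" and K: "compact K"
    and \<kappa>0: "\<kappa>0 > 0" and zero: "\<And>\<kappa> \<omega>. 0 < \<kappa> \<Longrightarrow> \<kappa> < \<kappa>0 \<Longrightarrow> norm \<omega> = 1 \<Longrightarrow> (\<integral>y. J y * exp (\<kappa> * (\<omega> \<bullet> y)) \<partial>lborel) = 0"
  shows "(\<integral>y. J y * exp (\<xi> \<bullet> y) \<partial>lborel) = 0"
proof -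
  obtain t \<omega> where \<omega>: "norm \<omega> = 1" "\<xi> = t *\<^sub>R \<omega>"
  proof (cases "\<xi> = 0")
    case True
    then show ?thesis using that[of "axis 1 1" 0] by simp
  next
    case False
    then show ?thesis using that[of "\<xi> /\<^sub>R norm \<xi>" "norm \<xi>"] by simp
  qed
  define M where "M = restrict_space (lborel :: (real^3) measure) K"
  have Km: "K \<in> sets lborel" using borel_compact[OF K] by simp
  have JM: "integrable M J"
  proof -
    have "(\<lambda>y. indicator K y *\<^sub>R J y) = J" using J(2) by (auto simp: fun_eq_iff indicator_def)
    then show ?thesis unfolding M_def using J(1) Km by (simp add: integrable_restrict_space)
  qed
  have Jint: "(\<integral>y. J y *\<^sub>R h y \<partial>M) = (\<integral>y. J y *\<^sub>R h y \<partial>lborel)" for h :: "real^3 \<Rightarrow> complex"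
  proof -
    have "(\<lambda>y. indicator K y *\<^sub>R (J y *\<^sub>R h y)) = (\<lambda>y. J y *\<^sub>R h y)"
      using J(2) by (auto simp: fun_eq_iff indicator_def)
    then show ?thesis unfolding M_def using Km by (simp add: integral_restrict_space)
  qed
  define L where "L z = (\<integral>y. J y *\<^sub>R exp (z * of_real (\<omega> \<bullet> y)) \<partial>M)" for z :: complex
  have Ld: "(L has_field_derivative (\<integral>y. J y *\<^sub>R (exp (z * of_real (\<omega> \<bullet> y)) * of_real (\<omega> \<bullet> y)) \<partial>M)) (at z)" for z
    unfolding L_def[abs_def]
  proof (rule has_field_derivative_integral_parameter[OF JM _ _ K open_UNIV])
    show "(\<lambda>y. y) \<in> borel_measurable M" unfolding M_def by (intro measurable_restrict_space1) simp
    show "m \<in> space M \<Longrightarrow> m \<in> K" for m by (simp add: M_def space_restrict_space)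
    show "((\<lambda>z. exp (z * of_real (\<omega> \<bullet> y))) has_field_derivative exp (z * of_real (\<omega> \<bullet> y)) * of_real (\<omega> \<bullet> y)) (at z)" for z y
      by (auto intro!: derivative_eq_intros)
  qed (auto simp: case_prod_beta intro!: continuous_intros)
  have Lreal: "L (of_real s) = of_real (\<integral>y. J y * exp (s * (\<omega> \<bullet> y)) \<partial>lborel)" for s
  proof -
    have "L (of_real s) = (\<integral>y. of_real (J y * exp (s * (\<omega> \<bullet> y))) \<partial>lborel)"
      unfolding L_def Jint
      by (rule Bochner_Integration.integral_cong[OF refl])
        (simp add: scaleR_conv_of_real exp_of_real flip: of_real_mult)
    then show ?thesis by (simp only: integral_complex_of_real)
  qed
  have "L (of_real t) = 0"
  proof (rule analytic_continuation[of L UNIV "of_real ` {0<..<\<kappa>0}" 0])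
    show "L holomorphic_on UNIV" using Ld by (auto simp: holomorphic_on_open)
    show "L z = 0" if "z \<in> of_real ` {0<..<\<kappa>0}" for z using that zero \<omega> by (auto simp: Lreal)
    show "(0::complex) islimpt of_real ` {0<..<\<kappa>0}"
      unfolding islimpt_approachable
    proof (intro allI impI)
      fix r :: real assume "r > 0"
      define s where "s = min (r/2) (\<kappa>0/2)"
      have "s \<in> {0<..<\<kappa>0}" "s \<noteq> 0" "\<bar>s\<bar> < r" using \<open>r > 0\<close> \<kappa>0 by (auto simp: s_def)
      then show "\<exists>y\<in>of_real ` {0<..<\<kappa>0}. y \<noteq> (0::complex) \<and> dist y 0 < r" by (intro bexI[of _ "of_real s"]) auto
    qed
  qed auto
  then show ?thesis unfolding Lreal \<omega> by simp
qed

text \<open>Exponentials are uniformly dense in the continuous functions on \<open>K\<close>, so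
  \<open>J\<close> integrates to zero against every continuous function. Approximating the sign of
  \<open>J\<close> by continuous functions gives a vanishing integral of |J|.\<close>

lemma exp_moments_zero_imp_AE_zero:
  fixes J :: "real^3 \<Rightarrow> real"
  assumes J: "integrable lborel J" "\<And>y. y \<notin> K \<Longrightarrow> J y = 0" and K: "compact K"
    and zero: "\<And>\<xi>. (\<integral>y. J y * exp (\<xi> \<bullet> y) \<partial>lborel) = 0"
  shows "AE y in lborel. J y = 0"
proof -
  have int: "integrable lborel (\<lambda>y. J y * \<phi> y)" if "continuous_on UNIV \<phi>" for \<phi>
    by (rule integrable_mult_continuous[OF J(1) _ K that]) (rule J(2))
  have span0: "(\<integral>y. J y * f y \<partial>lborel) = 0" if "f \<in> exp_span" for f
    using that
  proof induction
    case (exp c \<xi>)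
    then show ?case using zero[of \<xi>] by (simp add: mult.left_commute)
  next
    case (add f g)
    then show ?case
      using int[OF exp_span_continuous[OF add.hyps(1)]] int[OF exp_span_continuous[OF add.hyps(2)]]
      by (simp add: distrib_left)
  qed
  define A where "A = (\<integral>y. \<bar>J y\<bar> \<partial>lborel)"
  have cont0: "(\<integral>y. J y * \<phi> y \<partial>lborel) = 0" if \<phi>: "continuous_on UNIV \<phi>" for \<phi> :: "real^3 \<Rightarrow> real"
  proof -
    have "\<bar>\<integral>y. J y * \<phi> y \<partial>lborel\<bar> \<le> A * e" if "e > 0" for e
    proof -
      have "\<exists>g. g \<in> exp_span \<and> (\<forall>x \<in> K. \<bar>\<phi> x - g x\<bar> < e)"
      proof (rule Stone_Weierstrass_HOL[OF K])
        show "(\<lambda>x. c) \<in> exp_span" for c using exp_span.exp[of c 0] by simp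
        show "continuous_on K \<phi>" using \<phi> continuous_on_subset by blast
        show "\<exists>f. f \<in> exp_span \<and> f x \<noteq> f y" if "x \<in> K \<and> y \<in> K \<and> x \<noteq> y" for x y
        proof -
          have "(x - y) \<bullet> (x - y) \<noteq> 0" using that by simp
          then have "(x - y) \<bullet> x \<noteq> (x - y) \<bullet> y" by (simp add: inner_diff_right)
          then show ?thesis using exp_span.exp[of 1 "x - y"] by (intro exI[of _ "\<lambda>z. 1 * exp ((x - y) \<bullet> z)"]) auto
        qed
      qed (use exp_span_continuous exp_span.add exp_span_mult \<open>e > 0\<close> in auto)
      then obtain g where g: "g \<in> exp_span" "\<And>x. x \<in> K \<Longrightarrow> \<bar>\<phi> x - g x\<bar> < e" by blast
      have ig: "integrable lborel (\<lambda>y. J y * g y)" by (rule int[OF exp_span_continuous[OF g(1)]])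
      have "(\<integral>y. J y * \<phi> y \<partial>lborel) = (\<integral>y. J y * \<phi> y - J y * g y \<partial>lborel)"
        using span0[OF g(1)] int[OF \<phi>] ig by simp
      also have "\<bar>\<dots>\<bar> \<le> (\<integral>y. \<bar>J y\<bar> * e \<partial>lborel)"
      proof (rule order_trans[OF integral_abs_bound integral_mono])
        show "integrable lborel (\<lambda>y. \<bar>J y * \<phi> y - J y * g y\<bar>)" using int[OF \<phi>] ig by auto
        show "integrable lborel (\<lambda>y. \<bar>J y\<bar> * e)" using J(1) by auto
        show "\<bar>J y * \<phi> y - J y * g y\<bar> \<le> \<bar>J y\<bar> * e" for y
        proof (cases "y \<in> K")
          case True
          then show ?thesis using g(2)[OF True]
            by (auto simp: abs_mult simp flip: right_diff_distrib intro!: mult_left_mono)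
        qed (simp add: J)
      qed
      also have "\<dots> = A * e" by (simp add: A_def)
      finally show ?thesis .
    qed
    note le = this
    have "A \<ge> 0" by (simp add: A_def)
    have "\<bar>\<integral>y. J y * \<phi> y \<partial>lborel\<bar> \<le> 0 + e" if "e > 0" for e
    proof -
      have "\<bar>\<integral>y. J y * \<phi> y \<partial>lborel\<bar> \<le> A * (e / (A + 1))" using \<open>A \<ge> 0\<close> that by (intro le) auto
      also have "\<dots> \<le> e" using \<open>A \<ge> 0\<close> that by (simp add: field_simps)
      finally show ?thesis by simp
    qed
    then have "\<bar>\<integral>y. J y * \<phi> y \<partial>lborel\<bar> \<le> 0" by (rule field_le_epsilon)
    then show ?thesis by simp
  qed
  have Jm: "J \<in> borel_measurable lborel" using J(1) by simp
  then have sm: "(\<lambda>y. sgn (J y)) \<in> borel_measurable lborel" by measurable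
  then have "(\<lambda>y. sgn (J y)) \<in> borel_measurable lebesgue" using measurable_completion by blast
  then have "(\<lambda>y. sgn (J y)) measurable_on UNIV"
    by (rule lebesgue_measurable_imp_measurable_on) simp
  then obtain N g where N: "negligible N" and g: "\<And>n. continuous_on UNIV (g n)"
    "\<And>x. x \<notin> N \<Longrightarrow> (\<lambda>n::nat. g n x) \<longlonglongrightarrow> sgn (J x)"
    unfolding measurable_on_def by auto
  \<comment> \<open>Truncation to [-1, 1] does not change the limit, since a sign lies in that
    range, and makes |J| a dominating function.\<close>
  define h where "h n x = max (-1) (min 1 (g n x))" for n x
  have hc: "continuous_on UNIV (h n)" for n unfolding h_def by (intro continuous_intros g)
  have "AE x in lebesgue. x \<notin> N"
    using N by (intro AE_not_in) (simp add: negligible_iff_null_sets)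
  then have AEN: "AE x in lborel. x \<notin> N" by (simp add: AE_completion_iff)
  have "(\<lambda>n. \<integral>y. J y * h n y \<partial>lborel) \<longlonglongrightarrow> (\<integral>y. J y * sgn (J y) \<partial>lborel)"
  proof (rule integral_dominated_convergence[where w = "\<lambda>y. \<bar>J y\<bar>"])
    show "(\<lambda>y. J y * sgn (J y)) \<in> borel_measurable lborel" using Jm sm by measurable
    show "(\<lambda>y. J y * h n y) \<in> borel_measurable lborel" for n using int[OF hc] by auto
    show "integrable lborel (\<lambda>y. \<bar>J y\<bar>)" using J(1) by simp
    show "AE x in lborel. (\<lambda>n. J x * h n x) \<longlonglongrightarrow> J x * sgn (J x)"
      using AEN
    proof eventually_elim
      case (elim x)
      have "(\<lambda>n. h n x) \<longlonglongrightarrow> max (-1) (min 1 (sgn (J x)))"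
        unfolding h_def by (intro tendsto_intros g elim)
      moreover have "max (-1) (min 1 (sgn (J x))) = sgn (J x)" by (simp add: sgn_real_def)
      ultimately show ?case by (intro tendsto_intros) simp
    qed
    show "AE x in lborel. norm (J x * h n x) \<le> \<bar>J x\<bar>" for n
    proof (rule AE_I2)
      fix x
      have "\<bar>h n x\<bar> \<le> 1" by (auto simp: h_def)
      then have "\<bar>J x\<bar> * \<bar>h n x\<bar> \<le> \<bar>J x\<bar> * 1" by (intro mult_left_mono) auto
      then show "norm (J x * h n x) \<le> \<bar>J x\<bar>" by (simp add: abs_mult)
    qed
  qed
  then have "(\<integral>y. J y * sgn (J y) \<partial>lborel) = 0" by (simp only: cont0[OF hc] LIMSEQ_const_iff)
  then have "(\<integral>y. \<bar>J y\<bar> \<partial>lborel) = 0" unfolding abs_sgn .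
  then have "AE y in lborel. \<bar>J y\<bar> = 0"
    using J(1) by (subst (asm) integral_nonneg_eq_0_iff_AE) auto
  then show ?thesis by simp
qed

text \<open>The weighted integral differs from the integral of \<open>G\<close> by at most A
  (exp(\<kappa> c) - 1), with A the integral of |G|, which is small for small \<kappa>. The
  threshold \<kappa>0 is uniform in \<theta>, because \<theta> will depend on the direction of
  observation.\<close>

lemma perturbed_integral_nonzero:
  fixes G :: "real \<Rightarrow> real"
  assumes G: "integrable lborel G" and nz: "(\<integral>s. G s \<partial>lborel) \<noteq> 0" and c: "c \<ge> 0"
  shows "\<exists>\<kappa>0>0. \<forall>\<kappa> \<theta>. 0 < \<kappa> \<longrightarrow> \<kappa> < \<kappa>0 \<longrightarrow> (\<forall>s. G s \<noteq> 0 \<longrightarrow> \<bar>\<theta> s\<bar> \<le> \<kappa> * c) \<longrightarrow>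
    (\<lambda>s. G s * exp (\<theta> s)) \<in> borel_measurable lborel \<longrightarrow> (\<integral>s. G s * exp (\<theta> s) \<partial>lborel) \<noteq> (0::real)"
proof -
  define I where "I = (\<integral>s. G s \<partial>lborel)"
  define A where "A = (\<integral>s. \<bar>G s\<bar> \<partial>lborel)"
  have "((\<lambda>\<kappa>::real. A * (exp (\<kappa> * c) - 1)) \<longlongrightarrow> A * (exp (0 * c) - 1)) (at_right 0)"
    by (intro tendsto_intros)
  then have lim: "((\<lambda>\<kappa>::real. A * (exp (\<kappa> * c) - 1)) \<longlongrightarrow> 0) (at_right 0)" by simp
  have "\<bar>I\<bar> > 0" using nz by (simp add: I_def)
  from order_tendstoD(2)[OF lim this] obtain \<kappa>0 where \<kappa>0: "\<kappa>0 > 0" "\<And>\<kappa>. 0 < \<kappa> \<Longrightarrow> \<kappa> < \<kappa>0 \<Longrightarrow> A * (exp (\<kappa> * c) - 1) < \<bar>I\<bar>"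
    unfolding eventually_at_right[OF zero_less_one] by auto
  have "(\<integral>s. G s * exp (\<theta> s) \<partial>lborel) \<noteq> 0"
    if \<kappa>: "0 < \<kappa>" "\<kappa> < \<kappa>0" and \<theta>: "\<And>s. G s \<noteq> 0 \<Longrightarrow> \<bar>\<theta> s\<bar> \<le> \<kappa> * c"
      and m: "(\<lambda>s. G s * exp (\<theta> s)) \<in> borel_measurable lborel" for \<kappa> \<theta>
  proof
    assume 0: "(\<integral>s. G s * exp (\<theta> s) \<partial>lborel) = 0"
    have b: "\<bar>G s * exp (\<theta> s)\<bar> \<le> \<bar>G s\<bar> * exp (\<kappa> * c)" for s
      using \<theta>[of s] by (cases "G s = 0") (auto simp: abs_mult intro!: mult_left_mono)
    have i: "integrable lborel (\<lambda>s. G s * exp (\<theta> s))"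
    proof (rule Bochner_Integration.integrable_bound)
      show "integrable lborel (\<lambda>s. \<bar>G s\<bar> * exp (\<kappa> * c))" using G by simp
      show "AE s in lborel. norm (G s * exp (\<theta> s)) \<le> norm (\<bar>G s\<bar> * exp (\<kappa> * c))"
        using b by (intro AE_I2) (simp add: abs_mult)
    qed (rule m)
    have "- I = (\<integral>s. G s * exp (\<theta> s) - G s \<partial>lborel)"
      using 0 i G by (simp add: I_def)
    also have "\<bar>\<dots>\<bar> \<le> (\<integral>s. \<bar>G s\<bar> * (exp (\<kappa> * c) - 1) \<partial>lborel)"
    proof (rule order_trans[OF integral_abs_bound integral_mono])
      show "integrable lborel (\<lambda>s. \<bar>G s * exp (\<theta> s) - G s\<bar>)" using i G by auto
      show "integrable lborel (\<lambda>s. \<bar>G s\<bar> * (exp (\<kappa> * c) - 1))" using G by auto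
      show "\<bar>G s * exp (\<theta> s) - G s\<bar> \<le> \<bar>G s\<bar> * (exp (\<kappa> * c) - 1)" for s
      proof (cases "G s = 0")
        case False
        have e: "exp (\<theta> s) \<le> exp (\<kappa> * c)" using \<theta>[OF False] by auto
        have "exp (- (\<kappa> * c)) \<le> exp (\<theta> s)" using \<theta>[OF False] by auto
        \<comment> \<open>Turns the lower bound into 1 - exp(-\<kappa> c) <= exp(\<kappa> c) - 1, so
          that both signs of \<theta> obey the same estimate.\<close>
        moreover have "exp (\<kappa> * c) + exp (- (\<kappa> * c)) \<ge> 2"
          using cosh_real_ge_1[of "\<kappa> * c"] by (simp add: cosh_field_def)
        ultimately have "\<bar>exp (\<theta> s) - 1\<bar> \<le> exp (\<kappa> * c) - 1" using e by linarith
        then have "\<bar>G s\<bar> * \<bar>exp (\<theta> s) - 1\<bar> \<le> \<bar>G s\<bar> * (exp (\<kappa> * c) - 1)" by (intro mult_left_mono) auto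
        then show ?thesis by (simp add: algebra_simps flip: abs_mult)
      qed simp
    qed
    also have "\<dots> = A * (exp (\<kappa> * c) - 1)" by (simp add: A_def)
    finally show False using \<kappa>0(2)[OF \<kappa>] by simp
  qed
  then show ?thesis using \<kappa>0(1) by blast
qed

section \<open>The static uniqueness theorem\<close>

lemma integral_restrict_pair:
  fixes h :: "real \<times> (real^3) \<Rightarrow> real"
  assumes S: "S \<in> sets borel" and K: "K \<in> sets borel"
    and h: "integrable (restrict_space (lborel \<Otimes>\<^sub>M lborel) (S \<times> K)) h"
  shows "(\<integral>m. h m \<partial>restrict_space (lborel \<Otimes>\<^sub>M lborel) (S \<times> K)) =
    (\<integral>s. indicator S s * (\<integral>y. indicator K y * h (s, y) \<partial>lborel) \<partial>lborel)"
proof -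
  have SK: "S \<times> K \<in> sets (lborel \<Otimes>\<^sub>M (lborel :: (real^3) measure))" using S K by auto
  then have i: "integrable (lborel \<Otimes>\<^sub>M lborel) (\<lambda>m. indicator (S \<times> K) m *\<^sub>R h m)"
    using h by (simp add: integrable_restrict_space)
  have "(\<integral>m. h m \<partial>restrict_space (lborel \<Otimes>\<^sub>M lborel) (S \<times> K)) = (\<integral>m. indicator (S \<times> K) m *\<^sub>R h m \<partial>(lborel \<Otimes>\<^sub>M lborel))"
    using SK by (simp add: integral_restrict_space)
  also have "\<dots> = (\<integral>s. (\<integral>y. indicator (S \<times> K) (s, y) *\<^sub>R h (s, y) \<partial>lborel) \<partial>lborel)"
    using lborel_pair.integral_fst'[OF i] by simp
  also have "\<dots> = (\<integral>s. indicator S s * (\<integral>y. indicator K y * h (s, y) \<partial>lborel) \<partial>lborel)"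
    by (simp add: indicator_times mult.assoc)
  finally show ?thesis .
qed

text \<open>The hypotheses \<open>trace\<close>, \<open>div\<close> and \<open>div'\<close> are all
  that remains of the Maxwell system: the tangential trace of the potential of the moving source,
  integrated over time, and two moment identities for each position of the source. They are
  available for every positive \<kappa>, and small \<kappa> is where the motion factor is
  controlled.\<close>

theorem static_uniqueness:
  fixes J :: "real^3 \<Rightarrow> real^3" and a :: "real \<Rightarrow> real^3" and g :: "real \<Rightarrow> real"
  assumes T\<^sub>0: "T\<^sub>0 > 0" and K: "compact K" and J: "integrable lborel J" "\<And>y. y \<notin> K \<Longrightarrow> J y = 0"
    and a: "continuous_on {0..T\<^sub>0} a" and g: "continuous_on {0..T\<^sub>0} g"
    and D: "\<And>s y. s \<in> {0..T\<^sub>0} \<Longrightarrow> y \<in> K \<Longrightarrow> norm (a s + y) \<le> D" "0 \<le> D" "D < R"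
    and A: "\<And>s. s \<in> {0..T\<^sub>0} \<Longrightarrow> norm (a s) \<le> A"
    and \<Gamma>: "openin (top_of_set (sphere 0 R)) \<Gamma>" "\<Gamma> \<noteq> {}"
    and nz: "(\<integral>s. indicator {0..T\<^sub>0} s * g s \<partial>lborel) \<noteq> 0"
    and trace: "\<And>\<kappa> x u v. \<kappa> > 0 \<Longrightarrow> x \<in> \<Gamma> \<Longrightarrow>
      (\<integral>s. indicator {0..T\<^sub>0} s * (g s * exp (- \<kappa> * s) *
         (\<integral>y. J y \<bullet> (yuk \<kappa> ((norm (x - (a s + y)))\<^sup>2) *\<^sub>R ((x \<bullet> v) *\<^sub>R u - (x \<bullet> u) *\<^sub>R v)) \<partial>lborel)) \<partial>lborel) = 0"
    and div: "\<And>\<kappa> s x. \<kappa> > 0 \<Longrightarrow> s \<in> {0..T\<^sub>0} \<Longrightarrow> D < norm x \<Longrightarrow>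
      (\<integral>y. J y \<bullet> (yuk \<kappa> ((norm (x - (a s + y)))\<^sup>2) *\<^sub>R (x - (a s + y))) \<partial>lborel) = 0"
    and div': "\<And>\<kappa> s x. \<kappa> > 0 \<Longrightarrow> s \<in> {0..T\<^sub>0} \<Longrightarrow> D < norm x \<Longrightarrow>
      (\<integral>y. J y \<bullet> (yuk' \<kappa> ((norm (x - (a s + y)))\<^sup>2) *\<^sub>R (x - (a s + y))) \<partial>lborel) = 0"
  shows "AE y in lborel. J y = 0"
proof -
  let ?S = "{0..T\<^sub>0}"
  have Km: "K \<in> sets borel" using borel_compact[OF K] .
  define M where "M = restrict_space (lborel \<Otimes>\<^sub>M (lborel :: (real^3) measure)) (?S \<times> K)"
  define Y where "Y = (\<lambda>(s, y). a s + y)"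
  have space: "space M = ?S \<times> K" by (simp add: M_def space_restrict_space space_pair_measure)
  have sets: "sets M = sets (restrict_space borel (?S \<times> K))"
    unfolding M_def by (intro sets_restrict_space_cong) (simp add: borel_prod[symmetric] cong: sets_pair_measure_cong)
  have SK: "?S \<times> K \<in> sets (lborel \<Otimes>\<^sub>M (lborel :: (real^3) measure))" using Km by auto
  have Ym: "Y \<in> borel_measurable M"
  proof -
    have "continuous_on (?S \<times> K) Y" unfolding Y_def case_prod_beta
      by (intro continuous_intros continuous_on_compose2[OF a]) auto
    then show ?thesis using borel_measurable_continuous_on_restrict sets measurable_cong_sets by blast
  qed
  have ce: "continuous_on ?S (\<lambda>s. g s * exp (c * s))" for c by (intro continuous_intros g)
  have cm: "(\<lambda>s. indicator ?S s * (g s * exp (c * s))) \<in> borel_measurable borel" for c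
    using borel_measurable_continuous_on_indicator[OF _ ce] by simp
  have ci: "integrable lborel (\<lambda>s. indicator ?S s * (g s * exp (c * s)))" for c
    using borel_integrable_atLeastAtMost'[OF ce] by (simp add: set_integrable_def)
  have Jm: "J \<in> borel_measurable borel" using J(1) by simp
  \<comment> \<open>Density on space-time: what is emitted at time \<open>s\<close> carries the
    weight exp(-\<kappa> s), and \<open>Y\<close> places it at \<open>a s + y\<close>.\<close>
  define f where "f \<kappa> = (\<lambda>(s, y). (g s * exp (- \<kappa> * s)) *\<^sub>R J y)" for \<kappa>
  have fi: "integrable M (f \<kappa>)" for \<kappa>
  proof -
    have "integrable (lborel \<Otimes>\<^sub>M lborel) (\<lambda>(s, y). (indicator ?S s * (g s * exp (- \<kappa> * s))) *\<^sub>R J y)"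
    proof (rule lborel_pair.Fubini_integrable)
      show "(\<lambda>(s, y). (indicator ?S s * (g s * exp (- \<kappa> * s))) *\<^sub>R J y) \<in> borel_measurable (lborel \<Otimes>\<^sub>M lborel)"
        using cm[of "- \<kappa>"] Jm by measurable
      have "integrable lborel (\<lambda>s. \<bar>indicator ?S s * (g s * exp (- \<kappa> * s))\<bar> * (\<integral>y. norm (J y) \<partial>lborel))"
        using ci[of "- \<kappa>"] by (intro integrable_mult_left integrable_abs)
      then show "integrable lborel (\<lambda>s. \<integral>y. norm (case (s, y) of (s, y) \<Rightarrow> (indicator ?S s * (g s * exp (- \<kappa> * s))) *\<^sub>R J y) \<partial>lborel)"
        by simp
      show "AE s in lborel. integrable lborel (\<lambda>y. case (s, y) of (s, y) \<Rightarrow> (indicator ?S s * (g s * exp (- \<kappa> * s))) *\<^sub>R J y)"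
        using J(1) by simp
    qed
    also have "(\<lambda>(s, y). (indicator ?S s * (g s * exp (- \<kappa> * s))) *\<^sub>R J y) = (\<lambda>m. indicator (?S \<times> K) m *\<^sub>R f \<kappa> m)"
      using J(2) by (auto simp: f_def fun_eq_iff indicator_def)
    finally show ?thesis unfolding M_def using SK by (simp add: integrable_restrict_space)
  qed
  have fubini: "integrable M (\<lambda>m. f \<kappa> m \<bullet> w (Y m)) \<and> (\<integral>m. f \<kappa> m \<bullet> w (Y m) \<partial>M) =
     (\<integral>s. indicator ?S s * (g s * exp (- \<kappa> * s) * (\<integral>y. J y \<bullet> w (a s + y) \<partial>lborel)) \<partial>lborel)"
    if w: "continuous_on (cball 0 D) w" for \<kappa> and w :: "real^3 \<Rightarrow> real^3"
  proof
    have Yc: "m \<in> space M \<Longrightarrow> Y m \<in> cball 0 D" for m using D(1) by (auto simp: space Y_def)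
    have "integrable M (\<lambda>m. (f \<kappa> m \<bullet> axis i 1) *\<^sub>R (w (Y m) \<bullet> axis i 1))" for i
      by (rule integrable_scaleR_continuous[OF _ Ym Yc compact_cball, where \<phi> = "\<lambda>y. w y \<bullet> axis i 1"])
         (use fi w in \<open>auto intro!: continuous_intros\<close>)
    then have "integrable M (\<lambda>m. \<Sum>i\<in>UNIV. (f \<kappa> m \<bullet> axis i 1) * (w (Y m) \<bullet> axis i 1))" by auto
    then show i: "integrable M (\<lambda>m. f \<kappa> m \<bullet> w (Y m))"
      unfolding inner_axis by (simp add: inner_vec_def)
    have 1: "(\<integral>m. f \<kappa> m \<bullet> w (Y m) \<partial>M) = (\<integral>s. indicator ?S s * (\<integral>y. indicator K y * (f \<kappa> (s, y) \<bullet> w (Y (s, y))) \<partial>lborel) \<partial>lborel)"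
      using i unfolding M_def by (intro integral_restrict_pair Km) auto
    have 2: "(\<integral>y. indicator K y * (f \<kappa> (s, y) \<bullet> w (Y (s, y))) \<partial>lborel) = (\<integral>y. (g s * exp (- \<kappa> * s)) * (J y \<bullet> w (a s + y)) \<partial>lborel)" for s
      using J(2) by (intro Bochner_Integration.integral_cong) (auto simp: f_def Y_def indicator_def)
    show "(\<integral>m. f \<kappa> m \<bullet> w (Y m) \<partial>M) =
     (\<integral>s. indicator ?S s * (g s * exp (- \<kappa> * s) * (\<integral>y. J y \<bullet> w (a s + y) \<partial>lborel)) \<partial>lborel)"
      unfolding 1 2 by simp
  qed
  \<comment> \<open>The exponential of \<kappa> \<omega> . (a s + y) is a product, so by Fubini the
    far field splits into a factor of the motion and the Laplace transform of a component of
    \<open>J\<close>.\<close>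
  have far: "(\<integral>s. (indicator ?S s * g s) * exp (\<kappa> * (\<omega> \<bullet> a s - s)) \<partial>lborel) * (\<integral>y. (J y \<bullet> u) * exp (\<kappa> * (\<omega> \<bullet> y)) \<partial>lborel) = 0"
    if kap: "\<kappa> > 0" and \<omega>: "norm \<omega> = 1" for \<kappa> \<omega> u
  proof -
    interpret yukawa_potential M Y D R \<kappa>
      by unfold_locales (use Ym D kap in \<open>auto simp: space Y_def\<close>)
    have cy: "continuous_on (cball 0 D) (\<lambda>y. yuk \<kappa> ((norm (x - y))\<^sup>2))" "continuous_on (cball 0 D) (\<lambda>y. yuk' \<kappa> ((norm (x - y))\<^sup>2))"
      if "D < norm x" for x
      using dist_pos[OF that] by (auto intro!: continuous_intros)
    have Z: "pot (\<lambda>m. f \<kappa> m \<bullet> u) x = 0" if "R \<le> norm x" for x u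
    proof (rule pot_tangential[OF fi _ _ _ that])
      fix x u v :: "real^3" assume x: "norm x = R"
      show "pot (\<lambda>m. f \<kappa> m \<bullet> u) x * (x \<bullet> v) = pot (\<lambda>m. f \<kappa> m \<bullet> v) x * (x \<bullet> u)"
      proof (rule tangential_zero_extends[OF fi \<Gamma> _ x])
        fix x :: "real^3" assume x: "x \<in> \<Gamma>"
        then have "norm x = R" using \<Gamma>(1) by (auto simp: openin_open)
        then have out: "D < norm x" using D by simp
        have i: "integrable M (\<lambda>m. (f \<kappa> m \<bullet> u) * yuk \<kappa> ((norm (x - Y m))\<^sup>2))" for u
          using fi cy(1)[OF out] by (intro integrable_kernel) auto
        let ?w = "(x \<bullet> v) *\<^sub>R u - (x \<bullet> u) *\<^sub>R v"
        have "pot (\<lambda>m. f \<kappa> m \<bullet> u) x * (x \<bullet> v) - pot (\<lambda>m. f \<kappa> m \<bullet> v) x * (x \<bullet> u)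
          = (\<integral>m. f \<kappa> m \<bullet> (yuk \<kappa> ((norm (x - Y m))\<^sup>2) *\<^sub>R ?w) \<partial>M)"
        proof -
          have "f \<kappa> m \<bullet> (yuk \<kappa> ((norm (x - Y m))\<^sup>2) *\<^sub>R ?w) =
            (f \<kappa> m \<bullet> u) * yuk \<kappa> ((norm (x - Y m))\<^sup>2) * (x \<bullet> v) - (f \<kappa> m \<bullet> v) * yuk \<kappa> ((norm (x - Y m))\<^sup>2) * (x \<bullet> u)" for m
            by (simp add: inner_diff_right algebra_simps)
          then show ?thesis unfolding pot_def using i by simp
        qed
        also have "\<dots> = 0"
        proof -
          have c: "continuous_on (cball 0 D) (\<lambda>y. yuk \<kappa> ((norm (x - y))\<^sup>2) *\<^sub>R ?w)"
            by (intro continuous_intros cy(1)[OF out])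
          show ?thesis unfolding conjunct2[OF fubini[OF c]] by (rule trace[OF kap x])
        qed
        finally show "pot (\<lambda>m. f \<kappa> m \<bullet> u) x * (x \<bullet> v) = pot (\<lambda>m. f \<kappa> m \<bullet> v) x * (x \<bullet> u)" by simp
      qed
    next
      fix x :: "real^3" assume x: "D < norm x"
      have z: "(\<integral>s. indicator ?S s * (g s * exp (- \<kappa> * s) * q s) \<partial>lborel) = 0" if "\<And>s. s \<in> ?S \<Longrightarrow> q s = 0" for q
      proof -
        have "(\<lambda>s. indicator ?S s * (g s * exp (- \<kappa> * s) * q s)) = (\<lambda>_. 0)" using that by (auto simp: fun_eq_iff indicator_def)
        then show ?thesis by simp
      qed
      show "(\<integral>m. (f \<kappa> m \<bullet> (x - Y m)) * yuk \<kappa> ((norm (x - Y m))\<^sup>2) \<partial>M) = 0"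
      proof -
        have c: "continuous_on (cball 0 D) (\<lambda>y. yuk \<kappa> ((norm (x - y))\<^sup>2) *\<^sub>R (x - y))"
          by (intro continuous_intros cy(1)[OF x])
        have "(\<integral>m. (f \<kappa> m \<bullet> (x - Y m)) * yuk \<kappa> ((norm (x - Y m))\<^sup>2) \<partial>M) =
          (\<integral>m. f \<kappa> m \<bullet> (yuk \<kappa> ((norm (x - Y m))\<^sup>2) *\<^sub>R (x - Y m)) \<partial>M)" by (simp add: mult.commute)
        also have "\<dots> = 0" unfolding conjunct2[OF fubini[OF c]] by (rule z) (rule div[OF kap _ x])
        finally show ?thesis .
      qed
      show "(\<integral>m. (f \<kappa> m \<bullet> (x - Y m)) * yuk' \<kappa> ((norm (x - Y m))\<^sup>2) \<partial>M) = 0"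
      proof -
        have c: "continuous_on (cball 0 D) (\<lambda>y. yuk' \<kappa> ((norm (x - y))\<^sup>2) *\<^sub>R (x - y))"
          by (intro continuous_intros cy(2)[OF x])
        have "(\<integral>m. (f \<kappa> m \<bullet> (x - Y m)) * yuk' \<kappa> ((norm (x - Y m))\<^sup>2) \<partial>M) =
          (\<integral>m. f \<kappa> m \<bullet> (yuk' \<kappa> ((norm (x - Y m))\<^sup>2) *\<^sub>R (x - Y m)) \<partial>M)" by (simp add: mult.commute)
        also have "\<dots> = 0" unfolding conjunct2[OF fubini[OF c]] by (rule z) (rule div'[OF kap _ x])
        finally show ?thesis .
      qed
    qed
    have "0 = (\<integral>m. f \<kappa> m \<bullet> (exp (\<kappa> * (\<omega> \<bullet> Y m)) *\<^sub>R u) \<partial>M)"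
      using far_field_zero[OF _ Z \<omega>, of u] fi by (simp add: mult.commute)
    also have "\<dots> = (\<integral>s. indicator ?S s * (g s * exp (- \<kappa> * s) * (\<integral>y. J y \<bullet> (exp (\<kappa> * (\<omega> \<bullet> (a s + y))) *\<^sub>R u) \<partial>lborel)) \<partial>lborel)"
      by (rule conjunct2[OF fubini]) (intro continuous_intros)
    also have "\<dots> = (\<integral>s. (indicator ?S s * g s) * exp (\<kappa> * (\<omega> \<bullet> a s - s)) * (\<integral>y. (J y \<bullet> u) * exp (\<kappa> * (\<omega> \<bullet> y)) \<partial>lborel) \<partial>lborel)"
    proof (rule Bochner_Integration.integral_cong[OF refl])
      fix s
      have "(\<integral>y. J y \<bullet> (exp (\<kappa> * (\<omega> \<bullet> (a s + y))) *\<^sub>R u) \<partial>lborel) = (\<integral>y. exp (\<kappa> * (\<omega> \<bullet> a s)) * ((J y \<bullet> u) * exp (\<kappa> * (\<omega> \<bullet> y))) \<partial>lborel)"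
        by (simp add: inner_add_right distrib_left exp_add mult_ac)
      also have "\<dots> = exp (\<kappa> * (\<omega> \<bullet> a s)) * (\<integral>y. (J y \<bullet> u) * exp (\<kappa> * (\<omega> \<bullet> y)) \<partial>lborel)" by simp
      moreover have "exp (\<kappa> * (\<omega> \<bullet> a s - s)) = exp (- \<kappa> * s) * exp (\<kappa> * (\<omega> \<bullet> a s))"
        by (simp add: algebra_simps flip: exp_add)
      ultimately show "indicator ?S s * (g s * exp (- \<kappa> * s) * (\<integral>y. J y \<bullet> (exp (\<kappa> * (\<omega> \<bullet> (a s + y))) *\<^sub>R u) \<partial>lborel)) =
        (indicator ?S s * g s) * exp (\<kappa> * (\<omega> \<bullet> a s - s)) * (\<integral>y. (J y \<bullet> u) * exp (\<kappa> * (\<omega> \<bullet> y)) \<partial>lborel)"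
        by simp
    qed
    finally show ?thesis by simp
  qed
  have A0: "A \<ge> 0" using order_trans[OF norm_ge_zero A[of 0]] T\<^sub>0 by simp
  have Gi: "integrable lborel (\<lambda>s. indicator ?S s * g s)" using ci[of 0] by simp
  obtain \<kappa>0 where \<kappa>0: "\<kappa>0 > 0" and pert: "\<And>\<kappa> \<theta>. 0 < \<kappa> \<Longrightarrow> \<kappa> < \<kappa>0 \<Longrightarrow>
     (\<And>s. indicator ?S s * g s \<noteq> 0 \<Longrightarrow> \<bar>\<theta> s\<bar> \<le> \<kappa> * (A + T\<^sub>0)) \<Longrightarrow>
     (\<lambda>s. indicator ?S s * g s * exp (\<theta> s)) \<in> borel_measurable lborel \<Longrightarrow>
     (\<integral>s. indicator ?S s * g s * exp (\<theta> s) \<partial>lborel) \<noteq> 0"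
    using perturbed_integral_nonzero[OF Gi nz, of "A + T\<^sub>0"] A0 T\<^sub>0 by auto
  have "AE y in lborel. J y \<bullet> axis i 1 = 0" for i
  proof (rule exp_moments_zero_imp_AE_zero[OF _ _ K])
    show Ji: "integrable lborel (\<lambda>y. J y \<bullet> axis i 1)" using J(1) by simp
    show J0: "y \<notin> K \<Longrightarrow> J y \<bullet> axis i 1 = 0" for y using J(2) by simp
    show "(\<integral>y. J y \<bullet> axis i 1 * exp (\<xi> \<bullet> y) \<partial>lborel) = 0" for \<xi>
    proof (rule exp_moments_extend[OF Ji J0 K \<kappa>0])
      fix \<kappa> and \<omega> :: "real^3" assume \<kappa>: "0 < \<kappa>" "\<kappa> < \<kappa>0" and \<omega>: "norm \<omega> = 1"
      have "(\<integral>s. (indicator ?S s * g s) * exp (\<kappa> * (\<omega> \<bullet> a s - s)) \<partial>lborel) \<noteq> 0"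
      proof (rule pert[OF \<kappa>])
        fix s assume "indicator ?S s * g s \<noteq> 0"
        then have s: "s \<in> ?S" by (auto simp: indicator_def split: if_splits)
        have "\<bar>\<omega> \<bullet> a s\<bar> \<le> A" using Cauchy_Schwarz_ineq2[of \<omega> "a s"] \<omega> A[OF s] by simp
        then have "\<bar>\<omega> \<bullet> a s - s\<bar> \<le> A + T\<^sub>0" using s by auto
        then show "\<bar>\<kappa> * (\<omega> \<bullet> a s - s)\<bar> \<le> \<kappa> * (A + T\<^sub>0)" using \<kappa> by (simp add: abs_mult)
      next
        have "continuous_on ?S (\<lambda>s. g s * exp (\<kappa> * (\<omega> \<bullet> a s - s)))" using g a by (intro continuous_intros)
        from borel_measurable_continuous_on_indicator[OF _ this]
        show "(\<lambda>s. indicator ?S s * g s * exp (\<kappa> * (\<omega> \<bullet> a s - s))) \<in> borel_measurable lborel" by (simp add: mult.assoc)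
      qed
      then show "(\<integral>y. J y \<bullet> axis i 1 * exp (\<kappa> * (\<omega> \<bullet> y)) \<partial>lborel) = 0"
        using far[OF \<kappa>(1) \<omega>, of "axis i 1"] by simp
    qed
  qed
  then have "AE y in lborel. \<forall>i\<in>UNIV. J y \<bullet> axis i 1 = 0" by (intro AE_finite_allI) auto
  then show ?thesis by eventually_elim (simp add: vec_eq_iff inner_axis)
qed

section \<open>Pairings of $L^2$ fields with smooth weights\<close>

lemma Cauchy_Schwarz_integral:
  fixes f h :: "'a \<Rightarrow> real"
  assumes m: "f \<in> borel_measurable M" "h \<in> borel_measurable M"
    and i: "integrable M (\<lambda>x. (f x)\<^sup>2)" "integrable M (\<lambda>x. (h x)\<^sup>2)"
  shows "integrable M (\<lambda>x. f x * h x)"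
    and "\<bar>\<integral>x. f x * h x \<partial>M\<bar> \<le> sqrt (\<integral>x. (f x)\<^sup>2 \<partial>M) * sqrt (\<integral>x. (h x)\<^sup>2 \<partial>M)"
proof -
  show fh: "integrable M (\<lambda>x. f x * h x)"
  proof (rule Bochner_Integration.integrable_bound)
    show "integrable M (\<lambda>x. (f x)\<^sup>2 + (h x)\<^sup>2)" using i by simp
    show "(\<lambda>x. f x * h x) \<in> borel_measurable M" using m by measurable
    have "\<bar>f x * h x\<bar> \<le> (f x)\<^sup>2 + (h x)\<^sup>2" for x
    proof -
      have "0 \<le> (\<bar>f x\<bar> - \<bar>h x\<bar>)\<^sup>2" by simp
      then have "2 * (\<bar>f x\<bar> * \<bar>h x\<bar>) \<le> (f x)\<^sup>2 + (h x)\<^sup>2" by (simp add: power2_diff)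
      moreover have "0 \<le> \<bar>f x\<bar> * \<bar>h x\<bar>" by simp
      ultimately show ?thesis unfolding abs_mult by linarith
    qed
    then show "AE x in M. norm (f x * h x) \<le> norm ((f x)\<^sup>2 + (h x)\<^sup>2)" by (intro AE_I2) simp
  qed
  let ?F = "\<integral>x. (f x)\<^sup>2 \<partial>M" and ?H = "\<integral>x. (h x)\<^sup>2 \<partial>M" and ?C = "\<integral>x. f x * h x \<partial>M"
  have q: "0 \<le> ?F - 2 * c * ?C + c\<^sup>2 * ?H" for c
  proof -
    have "(\<integral>x. (f x - c * h x)\<^sup>2 \<partial>M) = (\<integral>x. (f x)\<^sup>2 - 2 * c * (f x * h x) + c\<^sup>2 * (h x)\<^sup>2 \<partial>M)"
      by (rule Bochner_Integration.integral_cong) (auto simp: power2_eq_square algebra_simps)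
    also have "\<dots> = ?F - 2 * c * ?C + c\<^sup>2 * ?H" using fh i by simp
    finally show ?thesis using Bochner_Integration.integral_nonneg[of M "\<lambda>x. (f x - c * h x)\<^sup>2"] by simp
  qed
  have "?C\<^sup>2 \<le> ?F * ?H"
  proof (cases "?H = 0")
    case True
    have "?C = 0"
    proof (rule ccontr)
      assume "?C \<noteq> 0"
      \<comment> \<open>With a vanishing quadratic term, this value of \<open>c\<close> turns the
        nonnegative expression into -1.\<close>
      then show False using q[of "(?F + 1) / (2 * ?C)"] True by simp
    qed
    then show ?thesis using True by simp
  next
    case False
    have "?H \<ge> 0" by simp
    then have H: "?H > 0" using False by linarith
    have "0 \<le> (?F - 2 * (?C / ?H) * ?C + (?C / ?H)\<^sup>2 * ?H) * ?H" using q[of "?C / ?H"] H by simp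
    also have "\<dots> = ?F * ?H - ?C\<^sup>2" using H by (simp add: field_simps power2_eq_square)
    finally show ?thesis by simp
  qed
  then have "sqrt (?C\<^sup>2) \<le> sqrt (?F * ?H)" by (rule real_sqrt_le_mono)
  then show "\<bar>?C\<bar> \<le> sqrt ?F * sqrt ?H" by (simp add: real_sqrt_mult)
qed

lemma L2_measurable: "u \<in> L2 \<Longrightarrow> u \<in> borel_measurable borel"
  by (simp add: L2_def)

lemma L2_norm_nonneg [simp]: "0 \<le> L2_norm u"
  by (simp add: L2_norm_def)

lemma L2_norm_sq: "(L2_norm u)\<^sup>2 = (\<integral>x. (norm (u x))\<^sup>2 \<partial>lborel)"
  by (simp add: L2_norm_def)

lemma L2_inner_sq:
  assumes u: "u \<in> L2"
  shows "integrable lborel (\<lambda>x. (u x \<bullet> v)\<^sup>2)" "sqrt (\<integral>x. (u x \<bullet> v)\<^sup>2 \<partial>lborel) \<le> norm v * L2_norm u"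
proof -
  have le: "(u x \<bullet> v)\<^sup>2 \<le> (norm v)\<^sup>2 * (norm (u x))\<^sup>2" for x
    using Cauchy_Schwarz_ineq[of "u x" v] by (simp add: power2_norm_eq_inner mult.commute)
  have iu: "integrable lborel (\<lambda>x. (norm v)\<^sup>2 * (norm (u x))\<^sup>2)" using u by (simp add: L2_def)
  show i: "integrable lborel (\<lambda>x. (u x \<bullet> v)\<^sup>2)"
    by (rule Bochner_Integration.integrable_bound[OF iu]) (use le L2_measurable[OF u] in auto)
  have "sqrt (\<integral>x. (u x \<bullet> v)\<^sup>2 \<partial>lborel) \<le> sqrt (\<integral>x. (norm v)\<^sup>2 * (norm (u x))\<^sup>2 \<partial>lborel)"
    by (intro real_sqrt_le_mono integral_mono i iu le)
  also have "\<dots> = norm v * L2_norm u" by (simp add: real_sqrt_mult L2_norm_def)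
  finally show "sqrt (\<integral>x. (u x \<bullet> v)\<^sup>2 \<partial>lborel) \<le> norm v * L2_norm u" .
qed

lemma L2_pairing:
  assumes u: "u \<in> L2" and \<phi>: "\<phi> \<in> borel_measurable borel" "integrable lborel (\<lambda>x. (\<phi> x)\<^sup>2)"
  shows "integrable lborel (\<lambda>x. \<phi> x * (u x \<bullet> v))"
    and "\<bar>\<integral>x. \<phi> x * (u x \<bullet> v) \<partial>lborel\<bar> \<le> sqrt (\<integral>x. (\<phi> x)\<^sup>2 \<partial>lborel) * (norm v * L2_norm u)"
proof -
  have m: "\<phi> \<in> borel_measurable lborel" "(\<lambda>x. u x \<bullet> v) \<in> borel_measurable lborel" using \<phi> L2_measurable[OF u] by auto
  note cs = Cauchy_Schwarz_integral[OF m \<phi>(2) L2_inner_sq(1)[OF u]]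
  show "integrable lborel (\<lambda>x. \<phi> x * (u x \<bullet> v))" by (rule cs(1))
  have "\<bar>\<integral>x. \<phi> x * (u x \<bullet> v) \<partial>lborel\<bar> \<le> sqrt (\<integral>x. (\<phi> x)\<^sup>2 \<partial>lborel) * sqrt (\<integral>x. (u x \<bullet> v)\<^sup>2 \<partial>lborel)" by (rule cs(2))
  also have "\<dots> \<le> sqrt (\<integral>x. (\<phi> x)\<^sup>2 \<partial>lborel) * (norm v * L2_norm u)"
    by (intro mult_left_mono L2_inner_sq(2) u) auto
  finally show "\<bar>\<integral>x. \<phi> x * (u x \<bullet> v) \<partial>lborel\<bar> \<le> sqrt (\<integral>x. (\<phi> x)\<^sup>2 \<partial>lborel) * (norm v * L2_norm u)" .
qed

lemma integrable_sq_indicator_cball: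
  fixes \<phi> :: "real^3 \<Rightarrow> real"
  assumes \<phi>: "\<phi> \<in> borel_measurable borel" and b: "\<And>x. \<bar>\<phi> x\<bar> \<le> C * indicator (cball x0 \<rho>) x"
  shows "integrable lborel (\<lambda>x. (\<phi> x)\<^sup>2)"
    and "sqrt (\<integral>x. (\<phi> x)\<^sup>2 \<partial>lborel) \<le> \<bar>C\<bar> * sqrt (measure lborel (cball x0 \<rho>))"
proof -
  have le: "(\<phi> x)\<^sup>2 \<le> C\<^sup>2 * indicator (cball x0 \<rho>) x" for x
  proof -
    have "(\<phi> x)\<^sup>2 \<le> (C * indicator (cball x0 \<rho>) x)\<^sup>2" using power_mono[OF b[of x], of 2] by simp
    then show ?thesis by (cases "x \<in> cball x0 \<rho>") auto
  qed
  have ii: "integrable lborel (\<lambda>x. C\<^sup>2 * indicator (cball x0 \<rho>) x :: real)"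
    using emeasure_bounded_finite[OF bounded_cball, of x0 \<rho>] by (intro integrable_mult_right integrable_real_indicator) auto
  show i: "integrable lborel (\<lambda>x. (\<phi> x)\<^sup>2)"
    by (rule Bochner_Integration.integrable_bound[OF ii]) (use le \<phi> in auto)
  have "(\<integral>x. (\<phi> x)\<^sup>2 \<partial>lborel) \<le> (\<integral>x. C\<^sup>2 * indicator (cball x0 \<rho>) x \<partial>lborel)"
    by (intro integral_mono i ii le)
  also have "\<dots> = C\<^sup>2 * measure lborel (cball x0 \<rho>)" by simp
  finally have "sqrt (\<integral>x. (\<phi> x)\<^sup>2 \<partial>lborel) \<le> sqrt (C\<^sup>2 * measure lborel (cball x0 \<rho>))" by (rule real_sqrt_le_mono)
  then show "sqrt (\<integral>x. (\<phi> x)\<^sup>2 \<partial>lborel) \<le> \<bar>C\<bar> * sqrt (measure lborel (cball x0 \<rho>))" by (simp add: real_sqrt_mult)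
qed

lemma L2_scaleR: "u \<in> L2 \<Longrightarrow> (\<lambda>x. c *\<^sub>R u x) \<in> L2"
  by (auto simp: L2_def power_mult_distrib)

lemma L2_norm_scaleR: "L2_norm (\<lambda>x. c *\<^sub>R u x) = \<bar>c\<bar> * L2_norm u"
  by (simp add: L2_norm_def power_mult_distrib real_sqrt_mult)

text \<open>The estimate comes from the pointwise inequality |a + b|^2 <= 2 |a|^2 + 2 |b|^2; it is
  used to show that L2-valued functions of time stay bounded.\<close>

lemma L2_combination:
  assumes "u \<in> L2" "w \<in> L2"
  shows "(\<lambda>x. u x + w x) \<in> L2" "(\<lambda>x. u x - w x) \<in> L2"
    "(L2_norm (\<lambda>x. u x + w x))\<^sup>2 \<le> 2 * (L2_norm u)\<^sup>2 + 2 * (L2_norm w)\<^sup>2"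
proof -
  have le: "(norm (a + b))\<^sup>2 \<le> 2 * (norm a)\<^sup>2 + 2 * (norm b)\<^sup>2" for a b :: "real^3"
  proof -
    have "(norm (a + b))\<^sup>2 \<le> (norm a + norm b)\<^sup>2" by (intro power_mono norm_triangle_ineq) auto
    also have "\<dots> \<le> 2 * (norm a)\<^sup>2 + 2 * (norm b)\<^sup>2"
      using zero_le_power2[of "norm a - norm b"] by (simp add: power2_sum power2_diff)
    finally show ?thesis .
  qed
  have m: "u \<in> borel_measurable borel" "w \<in> borel_measurable borel" using assms by (auto simp: L2_def)
  have i: "integrable lborel (\<lambda>x. 2 * (norm (u x))\<^sup>2 + 2 * (norm (w x))\<^sup>2)" using assms by (auto simp: L2_def)
  have ip: "integrable lborel (\<lambda>x. (norm (u x + w x))\<^sup>2)"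
    by (rule Bochner_Integration.integrable_bound[OF i]) (use le m in auto)
  have im: "integrable lborel (\<lambda>x. (norm (u x - w x))\<^sup>2)"
    by (rule Bochner_Integration.integrable_bound[OF i]) (use le[of "u _" "- w _"] m in auto)
  show "(\<lambda>x. u x + w x) \<in> L2" "(\<lambda>x. u x - w x) \<in> L2" using ip im m by (auto simp: L2_def)
  have "(\<integral>x. (norm (u x + w x))\<^sup>2 \<partial>lborel) \<le> (\<integral>x. 2 * (norm (u x))\<^sup>2 + 2 * (norm (w x))\<^sup>2 \<partial>lborel)"
    by (intro integral_mono ip i le)
  also have "\<dots> = 2 * (L2_norm u)\<^sup>2 + 2 * (L2_norm w)\<^sup>2" unfolding L2_norm_sq using assms by (simp add: L2_def)
  finally show "(L2_norm (\<lambda>x. u x + w x))\<^sup>2 \<le> 2 * (L2_norm u)\<^sup>2 + 2 * (L2_norm w)\<^sup>2" unfolding L2_norm_sq .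
qed

text \<open>Only a product rule against smooth weights is needed, so the $L^2$-valued calculus stays at the level
  of scalar pairings.\<close>

lemma pairing_deriv:
  fixes z z' :: "real \<Rightarrow> real^3 \<Rightarrow> real"
  assumes u: "has_L2_deriv S u u'" and t: "t \<in> S" and "convex S"
    and z: "\<And>s y. s \<in> S \<Longrightarrow> ((\<lambda>s. z s y) has_real_derivative z' s y) (at s)"
    and zb: "\<And>s y. s \<in> S \<Longrightarrow> \<bar>z s y\<bar> \<le> C * indicator (cball x0 \<rho>) y"
    and zb': "\<And>s y. s \<in> S \<Longrightarrow> \<bar>z' s y\<bar> \<le> C * indicator (cball x0 \<rho>) y"
    and zm: "\<And>s. z s \<in> borel_measurable borel" "\<And>s. z' s \<in> borel_measurable borel"
  shows "((\<lambda>s. \<integral>y. z s y * (u s y \<bullet> v) \<partial>lborel) has_real_derivative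
     (\<integral>y. z t y * (u' t y \<bullet> v) \<partial>lborel) + (\<integral>y. z' t y * (u t y \<bullet> v) \<partial>lborel)) (at t within S)"
proof -
  define m where "m = sqrt (measure lborel (cball x0 \<rho>))"
  have m0: "m \<ge> 0" by (simp add: m_def)
  have C0: "C \<ge> 0 \<or> \<rho> < 0"
  proof (cases "\<rho> < 0")
    case False
    then show ?thesis using order_trans[OF abs_ge_zero zb[OF t, of x0]] by simp
  qed simp
  have uL: "u s \<in> L2" "u' s \<in> L2" if "s \<in> S" for s using u that by (auto simp: has_L2_deriv_def)
  note zs = integrable_sq_indicator_cball[OF zm(1) zb, folded m_def]
  note zs' = integrable_sq_indicator_cball[OF zm(2) zb', folded m_def]
  have lip: "\<bar>z s y - z t y\<bar> \<le> (C * \<bar>s - t\<bar>) * indicator (cball x0 \<rho>) y" if "s \<in> S" for s y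
    using field_differentiable_bound[OF \<open>convex S\<close>, of "\<lambda>s. z s y" "\<lambda>s. z' s y" "C * indicator (cball x0 \<rho>) y" s t]
      has_field_derivative_at_within[OF z] zb' that t by (simp add: mult_ac)
  have dm: "(\<lambda>y. z s y - z t y) \<in> borel_measurable borel" for s using zm by measurable
  note ds = integrable_sq_indicator_cball[OF dm lip, folded m_def]
  define q where "q s = (\<lambda>y. (1 / (s - t)) *\<^sub>R (u s y - u t y) - u' t y)" for s
  have qL: "q s \<in> L2" if "s \<in> S" for s
    unfolding q_def by (intro L2_combination L2_scaleR uL that t)
  define A where "A s = (\<integral>y. z s y * (q s y \<bullet> v) \<partial>lborel)" for s
  define B where "B s = (\<integral>y. (z s y - z t y) * (u' t y \<bullet> v) \<partial>lborel)" for s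
  define D where "D s = (\<integral>y. (z s y - z t y) / (s - t) * (u t y \<bullet> v) \<partial>lborel)" for s
  define p where "p s = (\<integral>y. z s y * (u s y \<bullet> v) \<partial>lborel)" for s
  define L where "L = (\<integral>y. z t y * (u' t y \<bullet> v) \<partial>lborel)"
  \<comment> \<open>Discrete product rule. \<open>A\<close> tends to zero by differentiability in
    L2, \<open>B\<close> because the weights are uniformly Lipschitz in time, and \<open>D\<close>
    converges by dominated convergence to the pairing with the differentiated weight.\<close>
  have quot: "(p s - p t) / (s - t) = A s + (B s + L) + D s" if s: "s \<in> S" "s \<noteq> t" for s
  proof -
    have i1: "integrable lborel (\<lambda>y. z s y * (q s y \<bullet> v))" by (rule L2_pairing(1)[OF qL[OF s(1)] zm(1) zs(1)[OF s(1)]])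
    have i2: "integrable lborel (\<lambda>y. (z s y - z t y) * (u' t y \<bullet> v))" by (rule L2_pairing(1)[OF uL(2)[OF t] dm ds(1)[OF s(1)]])
    have i3: "integrable lborel (\<lambda>y. z t y * (u' t y \<bullet> v))" by (rule L2_pairing(1)[OF uL(2)[OF t] zm(1) zs(1)[OF t]])
    have i4: "integrable lborel (\<lambda>y. (z s y - z t y) / (s - t) * (u t y \<bullet> v))"
      using L2_pairing(1)[OF uL(1)[OF t] dm ds(1)[OF s(1)], of v] by simp
    have i5: "integrable lborel (\<lambda>y. z s y * (u s y \<bullet> v))" "integrable lborel (\<lambda>y. z t y * (u t y \<bullet> v))"
      by (rule L2_pairing(1)[OF uL(1)[OF s(1)] zm(1) zs(1)[OF s(1)]], rule L2_pairing(1)[OF uL(1)[OF t] zm(1) zs(1)[OF t]])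
    have "(p s - p t) / (s - t) = (\<integral>y. (z s y * (u s y \<bullet> v) - z t y * (u t y \<bullet> v)) / (s - t) \<partial>lborel)"
      unfolding p_def using i5 by simp
    also have "\<dots> = (\<integral>y. z s y * (q s y \<bullet> v) + ((z s y - z t y) * (u' t y \<bullet> v) + z t y * (u' t y \<bullet> v)) + (z s y - z t y) / (s - t) * (u t y \<bullet> v) \<partial>lborel)"
    proof (rule Bochner_Integration.integral_cong[OF refl])
      fix y
      have qv: "q s y \<bullet> v = (u s y \<bullet> v - u t y \<bullet> v) / (s - t) - u' t y \<bullet> v"
        by (simp add: q_def inner_diff_left)
      show "(z s y * (u s y \<bullet> v) - z t y * (u t y \<bullet> v)) / (s - t) =
        z s y * (q s y \<bullet> v) + ((z s y - z t y) * (u' t y \<bullet> v) + z t y * (u' t y \<bullet> v)) + (z s y - z t y) / (s - t) * (u t y \<bullet> v)"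
        unfolding qv by (simp add: diff_divide_distrib algebra_simps)
    qed
    also have "\<dots> = A s + (B s + L) + D s" unfolding A_def B_def D_def L_def using i1 i2 i3 i4 by simp
    finally show ?thesis .
  qed
  have At: "(A \<longlongrightarrow> 0) (at t within S)"
  proof (rule Lim_null_comparison)
    show "eventually (\<lambda>s. norm (A s) \<le> \<bar>C\<bar> * m * (norm v * L2_norm (q s))) (at t within S)"
      unfolding eventually_at_filter
    proof (intro always_eventually allI impI)
      fix s assume "s \<in> S"
      have "\<bar>A s\<bar> \<le> sqrt (\<integral>y. (z s y)\<^sup>2 \<partial>lborel) * (norm v * L2_norm (q s))"
        unfolding A_def by (rule L2_pairing(2)[OF qL zm(1) zs(1)]) fact+
      also have "\<dots> \<le> \<bar>C\<bar> * m * (norm v * L2_norm (q s))" using zs(2)[OF \<open>s \<in> S\<close>] by (intro mult_right_mono) auto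
      finally show "norm (A s) \<le> \<bar>C\<bar> * m * (norm v * L2_norm (q s))" by simp
    qed
    have "((\<lambda>s. L2_norm (q s)) \<longlongrightarrow> 0) (at t within S)" using u t by (auto simp: has_L2_deriv_def q_def)
    then have "((\<lambda>s. \<bar>C\<bar> * m * (norm v * L2_norm (q s))) \<longlongrightarrow> \<bar>C\<bar> * m * (norm v * 0)) (at t within S)" by (intro tendsto_intros)
    then show "((\<lambda>s. \<bar>C\<bar> * m * (norm v * L2_norm (q s))) \<longlongrightarrow> 0) (at t within S)" by simp
  qed
  have Bt: "(B \<longlongrightarrow> 0) (at t within S)"
  proof (rule Lim_null_comparison)
    show "eventually (\<lambda>s. norm (B s) \<le> \<bar>C * \<bar>s - t\<bar>\<bar> * m * (norm v * L2_norm (u' t))) (at t within S)"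
      unfolding eventually_at_filter
    proof (intro always_eventually allI impI)
      fix s assume "s \<in> S"
      have "\<bar>B s\<bar> \<le> sqrt (\<integral>y. (z s y - z t y)\<^sup>2 \<partial>lborel) * (norm v * L2_norm (u' t))"
        unfolding B_def by (rule L2_pairing(2)[OF uL(2)[OF t] dm ds(1)[OF \<open>s \<in> S\<close>]])
      also have "\<dots> \<le> \<bar>C * \<bar>s - t\<bar>\<bar> * m * (norm v * L2_norm (u' t))" using ds(2)[OF \<open>s \<in> S\<close>] by (intro mult_right_mono) auto
      finally show "norm (B s) \<le> \<bar>C * \<bar>s - t\<bar>\<bar> * m * (norm v * L2_norm (u' t))" by simp
    qed
    have "((\<lambda>s. \<bar>C * \<bar>s - t\<bar>\<bar> * m * (norm v * L2_norm (u' t))) \<longlongrightarrow> \<bar>C * \<bar>t - t\<bar>\<bar> * m * (norm v * L2_norm (u' t))) (at t within S)"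
      by (intro tendsto_intros)
    then show "((\<lambda>s. \<bar>C * \<bar>s - t\<bar>\<bar> * m * (norm v * L2_norm (u' t))) \<longlongrightarrow> 0) (at t within S)" by simp
  qed
  have Dt: "(D \<longlongrightarrow> (\<integral>y. z' t y * (u t y \<bullet> v) \<partial>lborel)) (at t within S)"
    unfolding tendsto_at_iff_sequentially comp_def
  proof (intro allI impI)
    fix X assume X: "\<forall>i. X i \<in> S - {t}" "X \<longlonglongrightarrow> t"
    have um: "u t \<in> borel_measurable borel" by (rule L2_measurable[OF uL(1)[OF t]])
    have bm: "(\<lambda>y. C * indicator (cball x0 \<rho>) y :: real) \<in> borel_measurable borel"
      by (intro borel_measurable_times borel_measurable_indicator) auto
    have bi: "integrable lborel (\<lambda>y. C * indicator (cball x0 \<rho>) y * (u t y \<bullet> v))"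
      by (rule L2_pairing(1)[OF uL(1)[OF t] bm integrable_sq_indicator_cball(1)[OF bm, of "\<bar>C\<bar>" x0 \<rho>]]) (auto simp: indicator_def)
    show "(\<lambda>i. D (X i)) \<longlonglongrightarrow> (\<integral>y. z' t y * (u t y \<bullet> v) \<partial>lborel)"
      unfolding D_def
    proof (rule integral_dominated_convergence[where w = "\<lambda>y. \<bar>C * indicator (cball x0 \<rho>) y * (u t y \<bullet> v)\<bar>"])
      show "(\<lambda>y. z' t y * (u t y \<bullet> v)) \<in> borel_measurable lborel" using zm(2)[of t] um by measurable
      show "(\<lambda>y. (z (X i) y - z t y) / (X i - t) * (u t y \<bullet> v)) \<in> borel_measurable lborel" for i
        using zm(1)[of "X i"] zm(1)[of t] um by measurable
      show "integrable lborel (\<lambda>y. \<bar>C * indicator (cball x0 \<rho>) y * (u t y \<bullet> v)\<bar>)" using bi by (rule integrable_abs)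
      show "AE y in lborel. (\<lambda>i. (z (X i) y - z t y) / (X i - t) * (u t y \<bullet> v)) \<longlonglongrightarrow> z' t y * (u t y \<bullet> v)"
      proof (intro AE_I2 tendsto_intros)
        fix y
        have "((\<lambda>s. (z s y - z t y) / (s - t)) \<longlongrightarrow> z' t y) (at t)"
          using z[OF t, of y] by (simp add: has_field_derivative_iff)
        then show "(\<lambda>i. (z (X i) y - z t y) / (X i - t)) \<longlonglongrightarrow> z' t y"
          using X unfolding tendsto_at_iff_sequentially comp_def by auto
      qed
      show "AE y in lborel. norm ((z (X i) y - z t y) / (X i - t) * (u t y \<bullet> v)) \<le> \<bar>C * indicator (cball x0 \<rho>) y * (u t y \<bullet> v)\<bar>" for i
      proof (intro AE_I2)
        fix y
        have X': "X i \<in> S" "X i \<noteq> t" using X(1) by auto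
        have "\<bar>z (X i) y - z t y\<bar> / \<bar>X i - t\<bar> \<le> C * indicator (cball x0 \<rho>) y"
          using lip[OF X'(1), of y] X'(2) by (simp add: divide_le_eq mult_ac)
        then have "\<bar>z (X i) y - z t y\<bar> / \<bar>X i - t\<bar> \<le> \<bar>C * indicator (cball x0 \<rho>) y\<bar>" by linarith
        then show "norm ((z (X i) y - z t y) / (X i - t) * (u t y \<bullet> v)) \<le> \<bar>C * indicator (cball x0 \<rho>) y * (u t y \<bullet> v)\<bar>"
          unfolding real_norm_def abs_mult abs_divide by (intro mult_right_mono) (auto simp: abs_mult)
      qed
    qed
  qed
  have "((\<lambda>s. A s + (B s + L) + D s) \<longlongrightarrow> 0 + (0 + L) + (\<integral>y. z' t y * (u t y \<bullet> v) \<partial>lborel)) (at t within S)"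
    by (intro tendsto_intros At Bt Dt)
  then have "((\<lambda>s. A s + (B s + L) + D s) \<longlongrightarrow> L + (\<integral>y. z' t y * (u t y \<bullet> v) \<partial>lborel)) (at t within S)" by simp
  then have "((\<lambda>s. (p s - p t) / (s - t)) \<longlongrightarrow> L + (\<integral>y. z' t y * (u t y \<bullet> v) \<partial>lborel)) (at t within S)"
    by (rule Lim_transform_eventually) (auto simp: eventually_at_filter quot)
  then show ?thesis by (simp add: has_field_derivative_iff p_def L_def)
qed

section \<open>Bounds in time for L2-valued functions\<close>

lemma bounded_if_locally_bounded:
  fixes f :: "real \<Rightarrow> real"
  assumes S: "compact S" and loc: "\<And>t. t \<in> S \<Longrightarrow> \<exists>B. eventually (\<lambda>s. f s \<le> B) (at t within S)"
  shows "\<exists>B. \<forall>s\<in>S. f s \<le> B"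
proof (rule ccontr)
  assume "\<not> ?thesis"
  then have "\<forall>n. \<exists>s\<in>S. f s > real n" by (meson not_le)
  then obtain X where X: "\<And>n. X n \<in> S" "\<And>n. f (X n) > real n" by metis
  obtain t r where t: "t \<in> S" "strict_mono r" "(X \<circ> r) \<longlonglongrightarrow> t"
    using S X(1) unfolding compact_def by metis
  obtain B where B: "eventually (\<lambda>s. f s \<le> B) (at t within S)" using loc[OF t(1)] by blast
  then have "eventually (\<lambda>s. s \<in> S \<longrightarrow> s \<noteq> t \<longrightarrow> f s \<le> B) (nhds t)" by (simp add: eventually_at_filter eventually_mono)
  then have "eventually (\<lambda>n. (X \<circ> r) n \<in> S \<longrightarrow> (X \<circ> r) n \<noteq> t \<longrightarrow> f ((X \<circ> r) n) \<le> B) sequentially"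
    by (rule eventually_compose_filterlim) (rule t(3))
  then have "eventually (\<lambda>n. f ((X \<circ> r) n) \<le> max B (f t)) sequentially"
    by eventually_elim (use X(1) in \<open>auto simp: le_max_iff_disj\<close>)
  moreover have "eventually (\<lambda>n. real n > max B (f t)) sequentially"
    using filterlim_at_top_dense[of real sequentially] filterlim_real_sequentially by blast
  ultimately have "eventually (\<lambda>n. False) sequentially"
  proof eventually_elim
    case (elim n)
    have "real n \<le> real (r n)" using seq_suble[OF t(2)] by simp
    then show ?case using elim X(2)[of "r n"] by simp
  qed
  then show False by simp
qed

lemma L2_norm_locally_bounded:
  assumes "u t \<in> L2" and "\<And>s. s \<in> S \<Longrightarrow> u s \<in> L2"
    and "((\<lambda>s. L2_norm (\<lambda>x. u s x - u t x)) \<longlongrightarrow> 0) (at t within S)"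
  shows "\<exists>B. eventually (\<lambda>s. L2_norm (u s) \<le> B) (at t within S)"
proof -
  define b where "b = sqrt (2 + 2 * (L2_norm (u t))\<^sup>2)"
  have "eventually (\<lambda>s. L2_norm (\<lambda>x. u s x - u t x) < 1) (at t within S)"
    using order_tendstoD(2)[OF assms(3), of 1] by simp
  moreover have "eventually (\<lambda>s. s \<in> S) (at t within S)" by (simp add: eventually_at_filter)
  ultimately have "eventually (\<lambda>s. L2_norm (u s) \<le> b) (at t within S)"
  proof eventually_elim
    case (elim s)
    have "(L2_norm (\<lambda>x. (u s x - u t x) + u t x))\<^sup>2 \<le> 2 * (L2_norm (\<lambda>x. u s x - u t x))\<^sup>2 + 2 * (L2_norm (u t))\<^sup>2"
      by (intro L2_combination assms elim)
    moreover have "(L2_norm (\<lambda>x. u s x - u t x))\<^sup>2 \<le> 1" using elim power_mono[of "L2_norm (\<lambda>x. u s x - u t x)" 1 2] by simp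
    ultimately have "(L2_norm (u s))\<^sup>2 \<le> 2 + 2 * (L2_norm (u t))\<^sup>2" by simp
    then show ?case unfolding b_def by (rule real_le_rsqrt)
  qed
  then show ?thesis by blast
qed

lemma C_L2_bounded:
  assumes "C_L2 S u" "compact S" shows "\<exists>B. \<forall>s\<in>S. L2_norm (u s) \<le> B"
  using assms by (intro bounded_if_locally_bounded L2_norm_locally_bounded) (auto simp: C_L2_def)

lemma has_L2_deriv_bounded:
  assumes u: "has_L2_deriv S u u'" and S: "compact S" shows "\<exists>B. \<forall>s\<in>S. L2_norm (u s) \<le> B"
proof (intro bounded_if_locally_bounded L2_norm_locally_bounded S)
  fix t assume t: "t \<in> S"
  have L: "u s \<in> L2" "u' s \<in> L2" if "s \<in> S" for s using u that by (auto simp: has_L2_deriv_def)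
  then show "u t \<in> L2" "s \<in> S \<Longrightarrow> u s \<in> L2" for s using t by auto
  define q where "q s = (\<lambda>y. (1 / (s - t)) *\<^sub>R (u s y - u t y) - u' t y)" for s
  have q: "((\<lambda>s. L2_norm (q s)) \<longlongrightarrow> 0) (at t within S)" using u t by (auto simp: has_L2_deriv_def q_def)
  show "((\<lambda>s. L2_norm (\<lambda>x. u s x - u t x)) \<longlongrightarrow> 0) (at t within S)"
  proof (rule Lim_null_comparison)
    show "eventually (\<lambda>s. norm (L2_norm (\<lambda>x. u s x - u t x)) \<le> \<bar>s - t\<bar> * sqrt (2 * (L2_norm (q s))\<^sup>2 + 2 * (L2_norm (u' t))\<^sup>2)) (at t within S)"
      unfolding eventually_at_filter
    proof (intro always_eventually allI impI)
      fix s assume s: "s \<noteq> t" "s \<in> S"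
      have qL: "q s \<in> L2" unfolding q_def by (intro L2_combination L2_scaleR L s t)
      have "(\<lambda>x. u s x - u t x) = (\<lambda>x. (s - t) *\<^sub>R (q s x + u' t x))" using s by (simp add: q_def)
      then have "L2_norm (\<lambda>x. u s x - u t x) = \<bar>s - t\<bar> * L2_norm (\<lambda>x. q s x + u' t x)"
        using L2_norm_scaleR[of "s - t"] by simp
      moreover have "L2_norm (\<lambda>x. q s x + u' t x) \<le> sqrt (2 * (L2_norm (q s))\<^sup>2 + 2 * (L2_norm (u' t))\<^sup>2)"
        by (intro real_le_rsqrt L2_combination qL L t)
      ultimately show "norm (L2_norm (\<lambda>x. u s x - u t x)) \<le> \<bar>s - t\<bar> * sqrt (2 * (L2_norm (q s))\<^sup>2 + 2 * (L2_norm (u' t))\<^sup>2)"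
        by (simp add: mult_left_mono)
    qed
    have "((\<lambda>s. \<bar>s - t\<bar> * sqrt (2 * (L2_norm (q s))\<^sup>2 + 2 * (L2_norm (u' t))\<^sup>2)) \<longlongrightarrow> \<bar>t - t\<bar> * sqrt (2 * 0\<^sup>2 + 2 * (L2_norm (u' t))\<^sup>2)) (at t within S)"
      by (intro tendsto_intros q)
    then show "((\<lambda>s. \<bar>s - t\<bar> * sqrt (2 * (L2_norm (q s))\<^sup>2 + 2 * (L2_norm (u' t))\<^sup>2)) \<longlongrightarrow> 0) (at t within S)" by simp
  qed
qed

section \<open>Weak derivatives tested against smooth functions\<close>

lemma pd_test_function:
  assumes \<phi>: "test_function \<phi>" shows "test_function (pd i \<phi>)"
  unfolding test_function_def
proof (intro conjI allI)
  show "partial_derivs \<alpha> (pd i \<phi>) differentiable_on UNIV" for \<alpha>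
  proof -
    have "partial_derivs \<alpha> (pd i \<phi>) = partial_derivs (\<alpha> @ [i]) \<phi>"
      unfolding partial_derivs_append by (simp add: pd_def[abs_def])
    then show ?thesis using \<phi> by (simp only: test_function_def)
  qed
  let ?K = "closure {x. \<phi> x \<noteq> 0}"
  have "pd i \<phi> x = 0" if x: "x \<notin> ?K" for x
  proof -
    have "(\<phi> has_derivative (\<lambda>_. 0)) (at x)"
    proof (rule has_derivative_transform_within_open[of "\<lambda>_. 0" _ x UNIV "- ?K"])
      show "y \<in> - ?K \<Longrightarrow> 0 = \<phi> y" for y using closure_subset[of "{x. \<phi> x \<noteq> 0}"] by auto
    qed (use x in auto)
    then show ?thesis by (simp add: pd_def frechet_derivative_at[symmetric])
  qed
  then have "{x. pd i \<phi> x \<noteq> 0} \<subseteq> ?K" by auto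
  then have "closure {x. pd i \<phi> x \<noteq> 0} \<subseteq> ?K" by (simp add: closure_minimal)
  then show "compact (closure {x. pd i \<phi> x \<noteq> 0})"
    using \<phi> unfolding test_function_def
    by (metis closed_closure compact_Int_closed inf.absorb_iff2)
qed

lemma test_function_continuous: "test_function \<phi> \<Longrightarrow> continuous_on UNIV \<phi>"
  unfolding test_function_def by (metis differentiable_imp_continuous_on partial_derivs.simps(1))

lemma test_function_bound:
  assumes \<phi>: "test_function \<phi>"
  obtains K C where "compact K" "\<And>x. \<bar>\<phi> x\<bar> \<le> C * indicator K x" "C \<ge> 0"
proof -
  let ?K = "closure {x. \<phi> x \<noteq> 0}"
  have K: "compact ?K" using \<phi> by (simp add: test_function_def)
  obtain C where C: "\<And>x. x \<in> ?K \<Longrightarrow> norm (\<phi> x) \<le> C"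
    using compact_imp_bounded[OF compact_continuous_image[OF continuous_on_subset[OF test_function_continuous[OF \<phi>]] K]]
    unfolding bounded_iff by auto
  have "\<bar>\<phi> x\<bar> \<le> max C 0 * indicator ?K x" for x
    using C[of x] closure_subset[of "{x. \<phi> x \<noteq> 0}"] by (cases "x \<in> ?K") auto
  then show ?thesis by (rule that[OF K]) simp
qed

lemma test_function_cball_bound:
  assumes \<phi>: "test_function \<phi>"
  obtains \<rho> C where "\<And>x. \<bar>\<phi> x\<bar> \<le> C * indicator (cball 0 \<rho>) x"
proof -
  obtain K C where K: "compact K" "\<And>x. \<bar>\<phi> x\<bar> \<le> C * indicator K x" "C \<ge> 0"
    using test_function_bound[OF \<phi>] by blast
  obtain \<rho> where "K \<subseteq> cball 0 \<rho>" using compact_imp_bounded[OF K(1)] by (auto simp: bounded_iff subset_iff)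
  then have "\<bar>\<phi> x\<bar> \<le> C * indicator (cball 0 \<rho>) x" for x
    using K(2)[of x] K(3) by (cases "x \<in> K") auto
  then show ?thesis using that by blast
qed

lemma test_function_measurable: "test_function \<phi> \<Longrightarrow> \<phi> \<in> borel_measurable borel"
  by (intro borel_measurable_continuous_onI test_function_continuous)

lemma integrable_test_function_scaleR:
  assumes \<phi>: "test_function \<phi>" and w: "locally_integrable w"
  shows "integrable lborel (\<lambda>x. \<phi> x *\<^sub>R w x)"
proof -
  obtain K C where K: "compact K" "\<And>x. \<bar>\<phi> x\<bar> \<le> C * indicator K x" "C \<ge> 0"
    using test_function_bound[OF \<phi>] by blast
  have i: "integrable lborel (\<lambda>x. indicator K x *\<^sub>R w x)"
    using w K(1) by (simp add: locally_integrable_def set_integrable_def)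
  have eq: "\<phi> x *\<^sub>R w x = \<phi> x *\<^sub>R (indicator K x *\<^sub>R w x)" for x
    using K(2)[of x] by (cases "x \<in> K") auto
  show ?thesis unfolding eq
  proof (rule Bochner_Integration.integrable_bound)
    show "integrable lborel (\<lambda>x. C *\<^sub>R (indicator K x *\<^sub>R w x))" using i by (intro integrable_scaleR_right)
    show "(\<lambda>x. \<phi> x *\<^sub>R (indicator K x *\<^sub>R w x)) \<in> borel_measurable lborel"
      using borel_measurable_scaleR[OF _ borel_measurable_integrable[OF i], of \<phi>] test_function_measurable[OF \<phi>] by simp
    have "\<bar>\<phi> x\<bar> \<le> C" for x using K(2)[of x] K(3) by (cases "x \<in> K") auto
    then have "norm (\<phi> x *\<^sub>R v) \<le> norm (C *\<^sub>R v)" for x and v :: "real^3"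
      using K(3) by (simp add: mult_right_mono)
    then show "AE x in lborel. norm (\<phi> x *\<^sub>R (indicator K x *\<^sub>R w x)) \<le> norm (C *\<^sub>R (indicator K x *\<^sub>R w x))"
      by (intro AE_I2)
  qed
qed

lemma weak_deriv_works:
  assumes "u \<in> H2" "length \<alpha> \<le> 2" shows "has_weak_deriv \<alpha> u (weak_deriv \<alpha> u)"
  unfolding weak_deriv_def using assms by (intro someI_ex[of "has_weak_deriv \<alpha> u"]) (auto simp: H2_def)

lemma weak_deriv_first:
  assumes "has_weak_deriv [i] u w" "test_function \<phi>"
  shows "(\<integral>x. pd i \<phi> x *\<^sub>R u x \<partial>lborel) = - (\<integral>x. \<phi> x *\<^sub>R w x \<partial>lborel)"
  using assms by (simp add: has_weak_deriv_def pd_def)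

text \<open>Using \<open>pd j \<phi>\<close> as a test function for the derivative in direction
  \<open>i\<close> leaves exactly the second-order pairing; the two signs cancel.\<close>

lemma weak_deriv_second:
  assumes "has_weak_deriv [i] u w" "has_weak_deriv [i, j] u v"
  shows "has_weak_deriv [j] w v"
  unfolding has_weak_deriv_def
proof (intro conjI allI impI)
  show "locally_integrable w" "locally_integrable v" using assms by (auto simp: has_weak_deriv_def)
  fix \<phi> assume \<phi>: "test_function \<phi>"
  have "(\<integral>x. pd i (pd j \<phi>) x *\<^sub>R u x \<partial>lborel) = (\<integral>x. \<phi> x *\<^sub>R v x \<partial>lborel)"
    using assms(2) \<phi> by (simp add: has_weak_deriv_def pd_def[abs_def])
  then show "(\<integral>x. partial_derivs [j] \<phi> x *\<^sub>R w x \<partial>lborel) = (-1) ^ length [j] *\<^sub>R (\<integral>x. \<phi> x *\<^sub>R v x \<partial>lborel)"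
    using weak_deriv_first[OF assms(1) pd_test_function[OF \<phi>], of j] by (simp add: pd_def[abs_def])
qed

section \<open>Curl and divergence in weak form\<close>

lemma bounded_linear_cross3: "bounded_linear (cross3 a)"
  by (intro linear_conv_bounded_linear[THEN iffD1] linearI) (auto simp: cross_add_right cross_mult_right)

lemma weak_curl_eq: "weak_curl u x = (\<Sum>i\<in>UNIV. cross3 (axis i 1) (weak_deriv [i] u x))"
  by (simp add: weak_curl_def vec_eq_iff forall_3 sum_3 cross3_def axis_def)

lemma locally_integrable_cross3_sum:
  assumes "\<And>i::3. locally_integrable (w i)"
  shows "locally_integrable (\<lambda>x. \<Sum>i\<in>UNIV. cross3 (axis i 1) (w i x))"
  unfolding locally_integrable_def set_integrable_def
proof (intro allI impI)
  fix K :: "(real^3) set" assume "compact K"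
  then have "integrable lborel (\<lambda>x. indicator K x *\<^sub>R w i x)" for i
    using assms[of i] by (simp add: locally_integrable_def set_integrable_def)
  then have "integrable lborel (\<lambda>x. \<Sum>i\<in>UNIV. cross3 (axis i 1) (indicator K x *\<^sub>R w i x))"
    by (intro Bochner_Integration.integrable_sum integrable_bounded_linear[OF bounded_linear_cross3])
  then show "integrable lborel (\<lambda>x. indicator K x *\<^sub>R (\<Sum>i\<in>UNIV. cross3 (axis i 1) (w i x)))"
    by (simp add: scaleR_sum_right cross_mult_right)
qed

lemma integral_cross3_sum:
  assumes "test_function \<phi>" "\<And>i::3. locally_integrable (w i)"
  shows "(\<integral>x. \<phi> x *\<^sub>R (\<Sum>i\<in>UNIV. cross3 (axis i 1) (w i x)) \<partial>lborel) =
    (\<Sum>i\<in>UNIV. cross3 (axis i 1) (\<integral>x. \<phi> x *\<^sub>R w i x \<partial>lborel))"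
proof -
  note i = integrable_test_function_scaleR[OF assms(1) assms(2)]
  have "(\<integral>x. \<phi> x *\<^sub>R (\<Sum>i\<in>UNIV. cross3 (axis i 1) (w i x)) \<partial>lborel) =
    (\<integral>x. (\<Sum>i\<in>UNIV. cross3 (axis i 1) (\<phi> x *\<^sub>R w i x)) \<partial>lborel)"
    by (simp add: scaleR_sum_right cross_mult_right)
  also have "\<dots> = (\<Sum>i\<in>UNIV. cross3 (axis i 1) (\<integral>x. \<phi> x *\<^sub>R w i x \<partial>lborel))"
    using i by (subst Bochner_Integration.integral_sum)
      (auto intro!: integrable_bounded_linear[OF bounded_linear_cross3] sum.cong integral_bounded_linear[OF bounded_linear_cross3])
  finally show ?thesis .
qed

text \<open>The operator \<open>weak_deriv\<close> is a choice, so the outer curl in a double curl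
  acquires its meaning only once the inner curl is shown to have weak derivatives. Second
  derivatives of an H2 field provide them.\<close>

lemma has_weak_deriv_curl:
  assumes u: "u \<in> H2" shows "\<exists>v. has_weak_deriv [j] (weak_curl u) v"
proof -
  let ?v = "\<lambda>x. \<Sum>i\<in>UNIV. cross3 (axis i 1) (weak_deriv [i, j] u x)"
  have d: "has_weak_deriv [j] (weak_deriv [i] u) (weak_deriv [i, j] u)" for i
    using weak_deriv_second[OF weak_deriv_works[OF u] weak_deriv_works[OF u]] by simp
  have l: "locally_integrable (weak_deriv [i] u)" "locally_integrable (weak_deriv [i, j] u)" for i
    using d[of i] by (auto simp: has_weak_deriv_def)
  have c: "weak_curl u = (\<lambda>x. \<Sum>i\<in>UNIV. cross3 (axis i 1) (weak_deriv [i] u x))" by (rule ext) (rule weak_curl_eq)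
  have "has_weak_deriv [j] (weak_curl u) ?v"
    unfolding has_weak_deriv_def c
  proof (intro conjI allI impI locally_integrable_cross3_sum l)
    fix \<phi> assume \<phi>: "test_function \<phi>"
    have "(\<integral>x. pd j \<phi> x *\<^sub>R (\<Sum>i\<in>UNIV. cross3 (axis i 1) (weak_deriv [i] u x)) \<partial>lborel) =
      (\<Sum>i\<in>UNIV. cross3 (axis i 1) (- (\<integral>x. \<phi> x *\<^sub>R weak_deriv [i, j] u x \<partial>lborel)))"
      using integral_cross3_sum[OF pd_test_function[OF \<phi>] l(1)] weak_deriv_first[OF d \<phi>] by simp
    also have "\<dots> = - (\<integral>x. \<phi> x *\<^sub>R ?v x \<partial>lborel)"
      using integral_cross3_sum[OF \<phi> l(2)] by (simp add: cross_minus_right sum_negf)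
    finally show "(\<integral>x. partial_derivs [j] \<phi> x *\<^sub>R (\<Sum>i\<in>UNIV. cross3 (axis i 1) (weak_deriv [i] u x)) \<partial>lborel) =
       (-1) ^ length [j] *\<^sub>R (\<integral>x. \<phi> x *\<^sub>R ?v x \<partial>lborel)" by (simp add: pd_def[abs_def])
  qed
  then show ?thesis by blast
qed

lemma weak_curl_curl:
  assumes u: "u \<in> H2" and \<phi>: "test_function \<phi>"
  shows "integrable lborel (\<lambda>x. \<phi> x *\<^sub>R weak_curl (weak_curl u) x)"
    and "(\<integral>x. \<phi> x *\<^sub>R weak_curl (weak_curl u) x \<partial>lborel) =
      (\<Sum>j\<in>UNIV. \<Sum>i\<in>UNIV. cross3 (axis j 1) (cross3 (axis i 1) (\<integral>x. pd i (pd j \<phi>) x *\<^sub>R u x \<partial>lborel)))"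
proof -
  have d: "has_weak_deriv [j] (weak_curl u) (weak_deriv [j] (weak_curl u))" for j
    unfolding weak_deriv_def using someI_ex[OF has_weak_deriv_curl[OF u]] .
  then have l: "locally_integrable (weak_deriv [j] (weak_curl u))" for j by (auto simp: has_weak_deriv_def)
  have w: "has_weak_deriv [i] u (weak_deriv [i] u)" for i using weak_deriv_works[OF u] by simp
  then have lw: "locally_integrable (weak_deriv [i] u)" for i by (auto simp: has_weak_deriv_def)
  show "integrable lborel (\<lambda>x. \<phi> x *\<^sub>R weak_curl (weak_curl u) x)"
    unfolding weak_curl_eq[of "weak_curl u"]
    by (rule integrable_test_function_scaleR[OF \<phi> locally_integrable_cross3_sum[OF l]])
  have 1: "(\<integral>x. pd j \<phi> x *\<^sub>R weak_curl u x \<partial>lborel) =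
     (\<Sum>i\<in>UNIV. cross3 (axis i 1) (- (\<integral>x. pd i (pd j \<phi>) x *\<^sub>R u x \<partial>lborel)))" for j
    unfolding weak_curl_eq[of u] integral_cross3_sum[OF pd_test_function[OF \<phi>] lw]
    using weak_deriv_first[OF w pd_test_function[OF \<phi>]] by simp
  have "(\<integral>x. \<phi> x *\<^sub>R weak_curl (weak_curl u) x \<partial>lborel) = (\<Sum>j\<in>UNIV. cross3 (axis j 1) (- (\<integral>x. pd j \<phi> x *\<^sub>R weak_curl u x \<partial>lborel)))"
    unfolding weak_curl_eq[of "weak_curl u"] integral_cross3_sum[OF \<phi> l] weak_deriv_first[OF d \<phi>] by simp
  then show "(\<integral>x. \<phi> x *\<^sub>R weak_curl (weak_curl u) x \<partial>lborel) =
      (\<Sum>j\<in>UNIV. \<Sum>i\<in>UNIV. cross3 (axis j 1) (cross3 (axis i 1) (\<integral>x. pd i (pd j \<phi>) x *\<^sub>R u x \<partial>lborel)))"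
    unfolding 1 by (simp add: cross_minus_right sum_negf linear_sum[OF bounded_linear.linear[OF bounded_linear_cross3]])
qed

text \<open>Minus the distributional divergence of \<open>w\<close> tested against \<phi>.\<close>

definition div_pairing :: "field \<Rightarrow> (real^3 \<Rightarrow> real) \<Rightarrow> real" where
  "div_pairing w \<phi> = (\<Sum>k\<in>UNIV. (\<integral>x. pd k \<phi> x *\<^sub>R w x \<partial>lborel) $ k)"

text \<open>Symmetry of mixed derivatives at every order, carried as a property of its own; the wave
  kernels acquire it from their function algebra.\<close>

definition commuting_pds :: "(real^3 \<Rightarrow> real) \<Rightarrow> bool" where
  "commuting_pds \<phi> \<longleftrightarrow> (\<forall>\<alpha> i j. pd i (pd j (partial_derivs \<alpha> \<phi>)) = pd j (pd i (partial_derivs \<alpha> \<phi>)))"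

lemma commuting_pds:
  assumes "commuting_pds \<phi>"
  shows "pd i (pd j \<phi>) = pd j (pd i \<phi>)" "pd i (pd j (pd k \<phi>)) = pd j (pd i (pd k \<phi>))" "commuting_pds (pd i \<phi>)"
proof -
  show "pd i (pd j \<phi>) = pd j (pd i \<phi>)" using assms[unfolded commuting_pds_def, rule_format, of i j "[]"] by simp
  show "pd i (pd j (pd k \<phi>)) = pd j (pd i (pd k \<phi>))"
    using assms[unfolded commuting_pds_def, rule_format, of i j "[k]"] by (simp add: pd_def[abs_def])
  show "commuting_pds (pd i \<phi>)"
    unfolding commuting_pds_def
  proof (intro allI)
    fix \<alpha> k j
    have "partial_derivs \<alpha> (pd i \<phi>) = partial_derivs (\<alpha> @ [i]) \<phi>"
      unfolding partial_derivs_append by (simp add: pd_def[abs_def])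
    then show "pd k (pd j (partial_derivs \<alpha> (pd i \<phi>))) = pd j (pd k (partial_derivs \<alpha> (pd i \<phi>)))"
      using assms by (simp only: commuting_pds_def)
  qed
qed

lemma ax: "axis k (1::real) $ i = (if i = k then 1 else 0)"
  by (simp add: axis_def)

text \<open>The distributional form of div curl = 0: third derivatives of \<phi> are symmetric, and
  after expanding the double cross products all terms cancel in pairs.\<close>

lemma div_curl_curl:
  assumes u: "u \<in> H2" and \<phi>: "test_function \<phi>" "commuting_pds \<phi>"
  shows "div_pairing (weak_curl (weak_curl u)) \<phi> = 0"
proof -
  define U where "U i j k = (\<integral>x. pd i (pd j (pd k \<phi>)) x *\<^sub>R u x \<partial>lborel)" for i j k
  have sym: "U i j k = U j i k" "U i j k = U i k j" for i j k
    unfolding U_def using commuting_pds[OF \<phi>(2)] by metis+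
  have "div_pairing (weak_curl (weak_curl u)) \<phi> = (\<Sum>k\<in>UNIV. (\<Sum>j\<in>UNIV. \<Sum>i\<in>UNIV. cross3 (axis j 1) (cross3 (axis i 1) (U i j k))) $ k)"
    unfolding div_pairing_def weak_curl_curl(2)[OF u pd_test_function[OF \<phi>(1)]] U_def ..
  also have "\<dots> = 0"
    unfolding Lagrange by (simp add: sum_3 inner_axis inner_axis' ax sym(1)[of 2 1] sym(1)[of 3 1] sym(1)[of 3 2]
        sym(2)[of _ 2 1] sym(2)[of _ 3 1] sym(2)[of _ 3 2])
  finally show ?thesis .
qed

text \<open>The identity curl curl = grad div - Laplacian, moved to the test function. The
  assumption on \<open>pd i \<phi>\<close> removes the gradient of the divergence.\<close>

lemma curl_curl_laplacian:
  assumes u: "u \<in> H2" and \<phi>: "test_function \<phi>" "commuting_pds \<phi>" and div: "\<And>i. div_pairing u (pd i \<phi>) = 0"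
  shows "(\<integral>x. \<phi> x *\<^sub>R weak_curl (weak_curl u) x \<partial>lborel) = - (\<Sum>i\<in>UNIV. \<integral>x. pd i (pd i \<phi>) x *\<^sub>R u x \<partial>lborel)"
proof -
  define U where "U i j = (\<integral>x. pd i (pd j \<phi>) x *\<^sub>R u x \<partial>lborel)" for i j
  have sym: "U i j = U j i" for i j
    unfolding U_def using commuting_pds[OF \<phi>(2)] by metis
  have d: "(\<Sum>j\<in>UNIV. U j i $ j) = 0" for i using div[of i] by (simp add: div_pairing_def U_def)
  have "(\<integral>x. \<phi> x *\<^sub>R weak_curl (weak_curl u) x \<partial>lborel) = (\<Sum>j\<in>UNIV. \<Sum>i\<in>UNIV. cross3 (axis j 1) (cross3 (axis i 1) (U i j)))"
    unfolding weak_curl_curl(2)[OF u \<phi>(1)] U_def ..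
  also have "\<dots> = - (\<Sum>i\<in>UNIV. U i i)"
    using d[of 1] d[of 2] d[of 3]
    unfolding Lagrange by (simp add: sum_3 inner_axis inner_axis' ax vec_eq_iff forall_3 sym[of 2 1] sym[of 3 1] sym[of 3 2] algebra_simps)
  finally show ?thesis unfolding U_def .
qed

lemma div_free_pairing:
  assumes J: "J \<in> H2" "AE x in lborel. weak_div J x = 0" and \<phi>: "test_function \<phi>"
  shows "div_pairing J \<phi> = 0"
proof -
  have w: "has_weak_deriv [k] J (weak_deriv [k] J)" for k using weak_deriv_works[OF J(1)] by simp
  then have i: "integrable lborel (\<lambda>x. \<phi> x *\<^sub>R weak_deriv [k] J x)" for k
    by (intro integrable_test_function_scaleR[OF \<phi>]) (auto simp: has_weak_deriv_def)
  have "div_pairing J \<phi> = - (\<Sum>k\<in>UNIV. (\<integral>x. \<phi> x *\<^sub>R weak_deriv [k] J x \<partial>lborel) $ k)"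
    unfolding div_pairing_def weak_deriv_first[OF w \<phi>] by (simp add: sum_negf)
  also have "(\<Sum>k\<in>UNIV. (\<integral>x. \<phi> x *\<^sub>R weak_deriv [k] J x \<partial>lborel) $ k) = (\<Sum>k\<in>UNIV. \<integral>x. \<phi> x * weak_deriv [k] J x $ k \<partial>lborel)"
    using integral_bounded_linear[OF bounded_linear_vec_nth i] by (simp add: scaleR_vec_def)
  also have "\<dots> = (\<integral>x. \<phi> x * weak_div J x \<partial>lborel)"
    unfolding weak_div_def sum_distrib_left
    using integrable_bounded_linear[OF bounded_linear_vec_nth i]
    by (subst Bochner_Integration.integral_sum) auto
  also have "\<dots> = (\<integral>x. 0 \<partial>lborel)"
  proof -
    have "AE x in lborel. \<phi> x * weak_div J x = 0" using J(2) by eventually_elim simp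
    then show ?thesis by (simp only: integral_eq_zero_AE integral_zero)
  qed
  finally show ?thesis by simp
qed

section \<open>Translation of test functions and of the source\<close>

lemma partial_derivs_translate:
  assumes "\<And>\<alpha>. partial_derivs \<alpha> \<phi> differentiable_on UNIV"
  shows "partial_derivs \<alpha> (\<lambda>x. \<phi> (x + a)) = (\<lambda>x. partial_derivs \<alpha> \<phi> (x + a))"
proof (induction \<alpha>)
  case (Cons i \<alpha>)
  have "frechet_derivative (\<lambda>x. partial_derivs \<alpha> \<phi> (x + a)) (at x) = frechet_derivative (partial_derivs \<alpha> \<phi>) (at (x + a))" for x
  proof -
    have "(partial_derivs \<alpha> \<phi> has_derivative frechet_derivative (partial_derivs \<alpha> \<phi>) (at (x + a))) (at (x + a))"
      using assms[of \<alpha>] by (simp add: differentiable_on_def frechet_derivative_works)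
    moreover have "((\<lambda>x. x + a) has_derivative (\<lambda>h. h)) (at x)" by (auto intro!: derivative_eq_intros)
    ultimately have "((\<lambda>x. partial_derivs \<alpha> \<phi> (x + a)) has_derivative frechet_derivative (partial_derivs \<alpha> \<phi>) (at (x + a))) (at x)"
      using diff_chain_at[of "\<lambda>x. x + a" "\<lambda>h. h" x] by (simp add: comp_def)
    then show ?thesis by (rule frechet_derivative_at[symmetric])
  qed
  then show ?case using Cons by simp
qed simp

lemma test_function_translate:
  assumes \<phi>: "test_function \<phi>" shows "test_function (\<lambda>x. \<phi> (x + a))" "pd k (\<lambda>x. \<phi> (x + a)) = (\<lambda>x. pd k \<phi> (x + a))"
proof -
  have d: "\<And>\<alpha>. partial_derivs \<alpha> \<phi> differentiable_on UNIV" using \<phi> by (auto simp: test_function_def)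
  note t = partial_derivs_translate[OF d]
  show "pd k (\<lambda>x. \<phi> (x + a)) = (\<lambda>x. pd k \<phi> (x + a))" using t[of "[k]" a] by (simp add: pd_def[abs_def])
  have "(\<lambda>x. partial_derivs \<alpha> \<phi> (x + a)) differentiable_on UNIV" for \<alpha>
    using d[of \<alpha>] differentiable_chain_at[of "\<lambda>x. x + a" _ "partial_derivs \<alpha> \<phi>"]
    by (auto simp: differentiable_on_def comp_def)
  moreover obtain \<rho> C where b: "\<And>x. \<bar>\<phi> x\<bar> \<le> C * indicator (cball 0 \<rho>) x" using test_function_cball_bound[OF \<phi>] by blast
  have "{x. \<phi> (x + a) \<noteq> 0} \<subseteq> cball (- a) \<rho>"
  proof
    fix x assume "x \<in> {x. \<phi> (x + a) \<noteq> 0}"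
    then have "x + a \<in> cball 0 \<rho>" using b[of "x + a"] by (cases "x + a \<in> cball 0 \<rho>") auto
    moreover have "- a - x = - (x + a)" by simp
    ultimately show "x \<in> cball (- a) \<rho>" by (simp only: mem_cball dist_norm norm_minus_cancel diff_0)
  qed
  then have "compact (closure {x. \<phi> (x + a) \<noteq> 0})" by (meson bounded_cball bounded_subset compact_closure)
  ultimately show "test_function (\<lambda>x. \<phi> (x + a))" unfolding test_function_def t by blast
qed

lemma integral_translate:
  fixes F :: "real^3 \<Rightarrow> 'b::{banach, second_countable_topology}"
  assumes "F \<in> borel_measurable borel"
  shows "(\<integral>x. F (x + a) \<partial>lborel) = (\<integral>x. F x \<partial>lborel)"
  using integral_distr[of "(+) a" lborel borel F] assms lborel_distr_plus[of a] by (simp add: add.commute)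

lemma div_free_translate:
  assumes J: "J \<in> H2" "AE x in lborel. weak_div J x = 0" and \<phi>: "test_function \<phi>"
  shows "div_pairing (\<lambda>x. J (x - a)) \<phi> = 0"
proof -
  have "(\<integral>x. pd k \<phi> x *\<^sub>R J (x - a) \<partial>lborel) = (\<integral>x. pd k (\<lambda>x. \<phi> (x + a)) x *\<^sub>R J x \<partial>lborel)" for k
  proof -
    have [measurable]: "J \<in> borel_measurable borel" "pd k \<phi> \<in> borel_measurable borel"
      using J L2_measurable test_function_measurable[OF pd_test_function[OF \<phi>]] by (auto simp: H2_def)
    have "(\<lambda>x. pd k \<phi> x *\<^sub>R J (x - a)) \<in> borel_measurable borel" by measurable
    from integral_translate[OF this, of a] show ?thesis by (simp add: test_function_translate(2)[OF \<phi>])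
  qed
  then have "div_pairing (\<lambda>x. J (x - a)) \<phi> = div_pairing J (\<lambda>x. \<phi> (x + a))" by (simp add: div_pairing_def)
  then show ?thesis using div_free_pairing[OF J test_function_translate(1)[OF \<phi>]] by simp
qed

section \<open>Singular kernels and approximate identities\<close>

text \<open>A dyadic form of integration in polar coordinates: if \<open>f\<close> is at most
  \<open>c k\<close> somewhere in a family of balls covering its support, it is dominated by the sum
  of these constants on the balls, whose volumes are proportional to \<open>r k ^ 3\<close>.\<close>

lemma integrable_dyadic_bound:
  fixes f :: "real^3 \<Rightarrow> real"
  assumes f: "f \<in> borel_measurable borel" "\<And>y. 0 \<le> f y"
    and c: "\<And>k. 0 \<le> c k" and r: "\<And>k. 0 \<le> r k"
    and le: "\<And>y. f y \<noteq> 0 \<Longrightarrow> \<exists>k::nat. y \<in> ball p (r k) \<and> f y \<le> c k"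
    and sum: "(\<lambda>k. c k * r k ^ 3) sums S"
  shows "integrable lborel f" "(\<integral>y. f y \<partial>lborel) \<le> unit_ball_vol 3 * S"
proof -
  define V where "V = unit_ball_vol 3"
  have V: "V \<ge> 0" by (simp add: V_def)
  have S: "S \<ge> 0" using sums_le[OF _ sums_zero sum] c r by auto
  have 1: "ennreal (f y) \<le> (\<Sum>k. ennreal (c k) * indicator (ball p (r k)) y)" for y
  proof (cases "f y = 0")
    case False
    then obtain k where k: "y \<in> ball p (r k)" "f y \<le> c k" using le by blast
    then have "ennreal (f y) \<le> ennreal (c k) * indicator (ball p (r k)) y" by (simp add: ennreal_leI)
    also have "\<dots> \<le> (\<Sum>k. ennreal (c k) * indicator (ball p (r k)) y)"
    proof -
      have "F k \<le> suminf F" for F :: "nat \<Rightarrow> ennreal" using sum_le_suminf[of F "{k}"] by simp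
      then show ?thesis .
    qed
    finally show ?thesis .
  qed simp
  have em: "emeasure lborel (ball p (r k)) = ennreal (V * r k ^ 3)" for k
    using emeasure_ball[OF r, of p k] by (simp add: V_def)
  have "(\<integral>\<^sup>+y. ennreal (f y) \<partial>lborel) \<le> (\<integral>\<^sup>+y. (\<Sum>k. ennreal (c k) * indicator (ball p (r k)) y) \<partial>lborel)"
    by (intro nn_integral_mono 1)
  also have "\<dots> = (\<Sum>k. ennreal (c k) * ennreal (V * r k ^ 3))"
  proof -
    have m: "(\<lambda>y. ennreal (c k) * indicator (ball p (r k)) y) \<in> borel_measurable lborel" for k
      by (intro borel_measurable_times_ennreal borel_measurable_const borel_measurable_indicator) auto
    have "(\<integral>\<^sup>+y. ennreal (c k) * indicator (ball p (r k)) y \<partial>lborel) = ennreal (c k) * ennreal (V * r k ^ 3)" for k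
      unfolding em[symmetric] by (rule nn_integral_cmult_indicator) simp
    then show ?thesis unfolding nn_integral_suminf[OF m] by simp
  qed
  also have "\<dots> = (\<Sum>k. ennreal (V * (c k * r k ^ 3)))"
    using c r V by (simp add: ennreal_mult[symmetric] mult_ac)
  also have "\<dots> = ennreal (V * S)"
    using sums_mult[OF sum, of V] c r V by (intro suminf_ennreal_eq) auto
  finally have le2: "(\<integral>\<^sup>+y. ennreal (f y) \<partial>lborel) \<le> ennreal (V * S)" .
  show i: "integrable lborel f"
    using f le2 by (intro integrableI_nonneg) (auto simp: top.not_eq_extremum intro: le_less_trans)
  have "ennreal (\<integral>y. f y \<partial>lborel) \<le> ennreal (V * S)"
    using le2 nn_integral_eq_integral[OF i] f by simp
  then show "(\<integral>y. f y \<partial>lborel) \<le> unit_ball_vol 3 * S"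
    using V S by (simp add: V_def)
qed

text \<open>In the shell between radii \<rho> / 2^(k+1) and \<rho> / 2^k the integrand is at most
  (2^(k+1) / \<rho>)^2. The ball radius is doubled because the balls are open, and the resulting
  terms 32 \<rho> / 2^k add up to 64 \<rho>. The function bounds the advanced waves in L2 uniformly
  in \<epsilon>.\<close>

lemma integrable_inverse_norm_sq:
  assumes \<rho>: "\<rho> > 0"
  shows "integrable lborel (\<lambda>y. (indicator (cball x0 \<rho>) y / norm (y - x0 :: real^3))\<^sup>2)"
proof (rule integrable_dyadic_bound(1)[where p = x0 and c = "\<lambda>k. (2 ^ (k+1) / \<rho>)\<^sup>2" and r = "\<lambda>k. 2 * \<rho> / 2 ^ k"
      and S = "64 * \<rho>"])
  show "(\<lambda>y. (indicator (cball x0 \<rho>) y / norm (y - x0))\<^sup>2) \<in> borel_measurable borel"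
    by (intro borel_measurable_power borel_measurable_divide borel_measurable_indicator borel_measurable_norm borel_measurable_diff) auto
  have "(\<lambda>k. 32 * \<rho> * (1/2) ^ k) sums (32 * \<rho> * (1 / (1 - 1/2)))"
    by (intro sums_mult geometric_sums) auto
  moreover have "(2 ^ (k+1) / \<rho>)\<^sup>2 * (2 * \<rho> / 2 ^ k) ^ 3 = 32 * \<rho> * (1/2) ^ k" for k
    using \<rho> by (simp add: power2_eq_square power3_eq_cube field_simps power_one_over)
  ultimately show "(\<lambda>k. (2 ^ (k+1) / \<rho>)\<^sup>2 * (2 * \<rho> / 2 ^ k) ^ 3) sums (64 * \<rho>)" by simp
  fix y assume "(indicator (cball x0 \<rho>) y / norm (y - x0))\<^sup>2 \<noteq> (0::real)"
  then have y: "y \<in> cball x0 \<rho>" "y \<noteq> x0" by (auto simp: indicator_def split: if_splits)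
  define d where "d = norm (y - x0)"
  have d: "0 < d" "d \<le> \<rho>" using y by (auto simp: d_def dist_norm norm_minus_commute)
  obtain n where n: "(1/2::real) ^ n < d / \<rho>" using real_arch_pow_inv[of "d / \<rho>" "1/2"] d \<rho> by auto
  define k where "k = (LEAST n. (1/2::real) ^ n < d / \<rho>)"
  have k: "(1/2::real) ^ k < d / \<rho>" unfolding k_def by (rule LeastI) (rule n)
  have "k \<noteq> 0" using k d \<rho> by (cases "k = 0") (auto simp: field_simps)
  then obtain j where j: "k = Suc j" by (cases k) auto
  have "\<not> (1/2::real) ^ j < d / \<rho>" using not_less_Least[of j "\<lambda>n. (1/2::real) ^ n < d / \<rho>"] j by (simp add: k_def)
  then have 1: "d \<le> \<rho> / 2 ^ j" using \<rho> by (simp add: field_simps power_one_over)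
  have 2: "1 / d < 2 ^ (j + 1) / \<rho>" using k j \<rho> d by (simp add: field_simps power_one_over)
  have "y \<in> ball x0 (2 * \<rho> / 2 ^ j)"
  proof -
    have "dist x0 y = d" by (simp add: d_def dist_norm norm_minus_commute)
    moreover have "\<rho> / 2 ^ j < 2 * \<rho> / 2 ^ j" using \<rho> by (simp add: divide_strict_right_mono)
    ultimately show ?thesis using 1 by (simp only: mem_ball)
  qed
  moreover have "(indicator (cball x0 \<rho>) y / norm (y - x0))\<^sup>2 \<le> (2 ^ (j+1) / \<rho>)\<^sup>2"
    using 2 y d by (intro power_mono) (auto simp: d_def[symmetric])
  ultimately show "\<exists>k. y \<in> ball x0 (2 * \<rho> / 2 ^ k) \<and> (indicator (cball x0 \<rho>) y / norm (y - x0))\<^sup>2 \<le> (2 ^ (k+1) / \<rho>)\<^sup>2"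
    by blast
qed (use \<rho> in auto)

section \<open>The approximate identity formed by the kernels
  \<open>\<epsilon>\<^sup>2 / r^5\<close>\<close>

lemma radius_bounds:
  assumes "\<epsilon> > 0"
  shows "radius x0 \<epsilon> y \<ge> \<epsilon>" "radius x0 \<epsilon> y \<ge> norm (y - x0)" "radius x0 \<epsilon> y > 0"
  using assms by (auto simp: radius_def intro!: real_le_rsqrt add_nonneg_pos)

lemma continuous_radius: "continuous_on S (radius x0 \<epsilon>)"
  unfolding radius_def by (intro continuous_intros)

lemma radius_measurable [measurable]: "radius x0 \<epsilon> \<in> borel_measurable borel"
  by (intro borel_measurable_continuous_onI continuous_radius)

text \<open>The kernel scales so that its mass is independent of \<epsilon>. If k is least with |y -
  x0| < \<epsilon> 2^k, then r >= \<epsilon> 2^k / 2; the ball of radius \<epsilon> 2^k contributes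
  32 / 4^k, and these terms add up to 128 / 3.\<close>

lemma approximate_identity_mass:
  assumes \<epsilon>: "\<epsilon> > 0"
  shows "integrable lborel (\<lambda>y. \<epsilon>\<^sup>2 * inverse (radius x0 \<epsilon> y) ^ 5)"
    and "(\<integral>y. \<epsilon>\<^sup>2 * inverse (radius x0 \<epsilon> y) ^ 5 \<partial>lborel) \<le> unit_ball_vol 3 * (128 / 3)"
proof -
  have m: "(\<lambda>y. \<epsilon>\<^sup>2 * inverse (radius x0 \<epsilon> y) ^ 5) \<in> borel_measurable borel" by measurable
  have "(\<lambda>k. 32 * (1/4) ^ k) sums (32 * (1 / (1 - 1/4)) :: real)"
    by (intro sums_mult geometric_sums) auto
  moreover have "32 / \<epsilon> ^ 3 / 32 ^ k * (\<epsilon> * 2 ^ k) ^ 3 = 32 * (1/4) ^ k" for k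
  proof -
    have "(32::real) ^ k = 2 ^ k * 2 ^ k * 2 ^ k * 4 ^ k" by (simp flip: power_mult_distrib)
    then show ?thesis using \<epsilon> by (simp add: power3_eq_cube field_simps power_one_over)
  qed
  ultimately have s: "(\<lambda>k. 32 / \<epsilon> ^ 3 / 32 ^ k * (\<epsilon> * 2 ^ k) ^ 3) sums (128 / 3)" by simp
  have le: "\<exists>k. y \<in> ball x0 (\<epsilon> * 2 ^ k) \<and> \<epsilon>\<^sup>2 * inverse (radius x0 \<epsilon> y) ^ 5 \<le> 32 / \<epsilon> ^ 3 / 32 ^ k" for y
  proof -
    define d where "d = norm (y - x0)"
    have rb: "\<epsilon> \<le> radius x0 \<epsilon> y" "d \<le> radius x0 \<epsilon> y" "0 < radius x0 \<epsilon> y"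
      unfolding d_def by (rule radius_bounds[OF \<epsilon>])+
    obtain n where n: "d / \<epsilon> < (2::real) ^ n" using real_arch_pow[of 2 "d / \<epsilon>"] by auto
    define k where "k = (LEAST n. d / \<epsilon> < (2::real) ^ n)"
    have k: "d / \<epsilon> < (2::real) ^ k" unfolding k_def by (rule LeastI) (rule n)
    then have near: "dist x0 y < \<epsilon> * 2 ^ k" using \<epsilon> by (simp add: d_def field_simps dist_norm norm_minus_commute)
    have "\<epsilon> * 2 ^ k / 2 \<le> radius x0 \<epsilon> y"
    proof (cases k)
      case 0
      then show ?thesis using rb \<epsilon> by simp
    next
      case (Suc j)
      have "\<not> d / \<epsilon> < (2::real) ^ j" using not_less_Least[of j "\<lambda>n. d / \<epsilon> < (2::real) ^ n"] Suc by (simp add: k_def)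
      then have "\<epsilon> * 2 ^ j \<le> d" using \<epsilon> by (simp add: field_simps)
      then show ?thesis using rb Suc by simp
    qed
    then have "inverse (radius x0 \<epsilon> y) ^ 5 \<le> inverse (\<epsilon> * 2 ^ k / 2) ^ 5"
      using \<epsilon> rb by (intro power_mono le_imp_inverse_le) auto
    then have "\<epsilon>\<^sup>2 * inverse (radius x0 \<epsilon> y) ^ 5 \<le> \<epsilon>\<^sup>2 * inverse (\<epsilon> * 2 ^ k / 2) ^ 5" by (intro mult_left_mono) auto
    also have "\<dots> = 32 / \<epsilon> ^ 3 / 32 ^ k"
    proof -
      have "(32::real) ^ k = (2 ^ k) ^ 5" by (simp flip: power_mult add: mult.commute[of k 5] power_mult)
      then show ?thesis using \<epsilon> by (simp add: field_simps eval_nat_numeral)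
    qed
    finally show ?thesis using near by auto
  qed
  show "integrable lborel (\<lambda>y. \<epsilon>\<^sup>2 * inverse (radius x0 \<epsilon> y) ^ 5)"
    by (rule integrable_dyadic_bound(1)[OF m _ _ _ _ s, of x0]) (use \<epsilon> le radius_bounds[OF \<epsilon>] in \<open>auto simp: less_imp_le\<close>)
  show "(\<integral>y. \<epsilon>\<^sup>2 * inverse (radius x0 \<epsilon> y) ^ 5 \<partial>lborel) \<le> unit_ball_vol 3 * (128 / 3)"
    by (rule integrable_dyadic_bound(2)[OF m _ _ _ _ s, of x0]) (use \<epsilon> le radius_bounds[OF \<epsilon>] in \<open>auto simp: less_imp_le\<close>)
qed

text \<open>Near \<open>x0\<close> the function \<open>w\<close> is small while the kernels have
  bounded mass; away from \<open>x0\<close> the kernels are of size \<epsilon>^2. Since the limit is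
  zero, upper bounds on the mass suffice.\<close>

lemma approximate_identity_limit:
  fixes w :: "real^3 \<Rightarrow> real" and e :: "nat \<Rightarrow> real^3 \<Rightarrow> real"
  assumes \<epsilon>: "\<And>n. \<epsilon> n > 0" "\<epsilon> \<longlonglongrightarrow> 0" and w: "continuous_on UNIV w" "w x0 = 0"
    and e: "\<And>n. e n \<in> borel_measurable borel"
    and b: "\<And>n y. \<bar>e n y\<bar> \<le> B * ((\<epsilon> n)\<^sup>2 * inverse (radius x0 (\<epsilon> n) y) ^ 5) * indicator (cball x0 T) y"
    and B: "B > 0"
  shows "(\<lambda>n. \<integral>y. e n y * w y \<partial>lborel) \<longlonglongrightarrow> 0"
proof (rule tendstoI)
  fix c :: real assume c: "c > 0"
  define L where "L = unit_ball_vol 3 * (128 / 3)"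
  have L: "L \<ge> 0" by (simp add: L_def)
  define q where "q n y = (\<epsilon> n)\<^sup>2 * inverse (radius x0 (\<epsilon> n) y) ^ 5" for n y
  have q: "integrable lborel (q n)" "(\<integral>y. q n y \<partial>lborel) \<le> L" "0 \<le> q n y" for n y
    unfolding q_def L_def using approximate_identity_mass[OF \<epsilon>(1)] radius_bounds[OF \<epsilon>(1)] by (auto simp: less_imp_le)
  obtain W where "\<forall>z\<in>w ` cball x0 T. norm z \<le> W"
    using compact_imp_bounded[OF compact_continuous_image[OF continuous_on_subset[OF w(1)] compact_cball[of x0 T]]]
    unfolding bounded_iff by blast
  then have W: "norm (w y) \<le> W" if "y \<in> cball x0 T" for y using that by blast
  define V where "V = measure lborel (cball x0 T)"
  \<comment> \<open>Chosen so that the part near \<open>x0\<close> contributes at most c / 2; the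
    summand 1 keeps the denominator positive.\<close>
  define \<eta> where "\<eta> = c / (2 * B * (L + 1))"
  have \<eta>: "\<eta> > 0" using c B L by (simp add: \<eta>_def)
  obtain \<delta> where \<delta>: "\<delta> > 0" "\<And>y. dist y x0 < \<delta> \<Longrightarrow> \<bar>w y\<bar> < \<eta>"
    using w \<eta> unfolding continuous_on_iff by (metis UNIV_I dist_real_def diff_0_right)
  have pt: "\<bar>e n y * w y\<bar> \<le> B * (\<eta> * q n y + (\<epsilon> n)\<^sup>2 * inverse \<delta> ^ 5 * \<bar>W\<bar> * indicator (cball x0 T) y)" for n y
  proof (cases "y \<in> cball x0 T")
    case True
    have "q n y * \<bar>w y\<bar> \<le> \<eta> * q n y + (\<epsilon> n)\<^sup>2 * inverse \<delta> ^ 5 * \<bar>W\<bar>"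
    proof (cases "dist y x0 < \<delta>")
      case True
      then have "q n y * \<bar>w y\<bar> \<le> q n y * \<eta>" using \<delta>(2) q(3) by (intro mult_left_mono) (auto intro: less_imp_le)
      moreover have "0 \<le> (\<epsilon> n)\<^sup>2 * inverse \<delta> ^ 5 * \<bar>W\<bar>" using \<delta> by simp
      ultimately show ?thesis by (simp add: mult.commute)
    next
      case False
      moreover have "norm (y - x0) \<le> radius x0 (\<epsilon> n) y" by (rule radius_bounds(2)[OF \<epsilon>(1)])
      ultimately have "\<delta> \<le> radius x0 (\<epsilon> n) y" by (simp add: dist_norm)
      then have "inverse (radius x0 (\<epsilon> n) y) ^ 5 \<le> inverse \<delta> ^ 5" using \<delta>
        by (intro power_mono le_imp_inverse_le) auto
      then have "q n y \<le> (\<epsilon> n)\<^sup>2 * inverse \<delta> ^ 5" unfolding q_def by (intro mult_left_mono) auto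
      moreover have "\<bar>w y\<bar> \<le> \<bar>W\<bar>" using W[OF \<open>y \<in> cball x0 T\<close>] by simp
      ultimately have "q n y * \<bar>w y\<bar> \<le> (\<epsilon> n)\<^sup>2 * inverse \<delta> ^ 5 * \<bar>W\<bar>" using q(3) \<delta> by (intro mult_mono) auto
      moreover have "0 \<le> \<eta> * q n y" using \<eta> q(3) by simp
      ultimately show ?thesis by simp
    qed
    then have "B * (q n y * \<bar>w y\<bar>) \<le> B * (\<eta> * q n y + (\<epsilon> n)\<^sup>2 * inverse \<delta> ^ 5 * \<bar>W\<bar>)" using B by (intro mult_left_mono) auto
    moreover have "\<bar>e n y\<bar> * \<bar>w y\<bar> \<le> B * q n y * \<bar>w y\<bar>" using b[of n y] True by (intro mult_right_mono) (auto simp: q_def)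
    ultimately show ?thesis using True by (simp add: abs_mult mult.assoc)
  next
    case False
    then have "e n y = 0" using b[of n y] by simp
    then show ?thesis using B \<eta> q(3) \<delta> by simp
  qed
  have ic: "integrable lborel (\<lambda>y. indicator (cball x0 T) y :: real)"
    using emeasure_bounded_finite[OF bounded_cball, of x0 T] by (intro integrable_real_indicator) auto
  have iB: "integrable lborel (\<lambda>y. B * (\<eta> * q n y + (\<epsilon> n)\<^sup>2 * inverse \<delta> ^ 5 * \<bar>W\<bar> * indicator (cball x0 T) y))" for n
    using q(1) ic by (intro integrable_mult_right Bochner_Integration.integrable_add) auto
  have wm: "w \<in> borel_measurable borel" by (rule borel_measurable_continuous_onI[OF w(1)])
  have bound: "\<bar>\<integral>y. e n y * w y \<partial>lborel\<bar> \<le> B * (\<eta> * L) + (\<epsilon> n)\<^sup>2 * (B * (inverse \<delta> ^ 5 * \<bar>W\<bar> * V))" for n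
  proof -
    have ie: "integrable lborel (\<lambda>y. e n y * w y)"
    proof (rule Bochner_Integration.integrable_bound[OF iB])
      show "(\<lambda>y. e n y * w y) \<in> borel_measurable lborel" using e[of n] wm by measurable
      show "AE y in lborel. norm (e n y * w y) \<le> norm (B * (\<eta> * q n y + (\<epsilon> n)\<^sup>2 * inverse \<delta> ^ 5 * \<bar>W\<bar> * indicator (cball x0 T) y))"
        using pt by (intro AE_I2) (metis abs_ge_self order_trans real_norm_def)
    qed
    have "\<bar>\<integral>y. e n y * w y \<partial>lborel\<bar> \<le> (\<integral>y. B * (\<eta> * q n y + (\<epsilon> n)\<^sup>2 * inverse \<delta> ^ 5 * \<bar>W\<bar> * indicator (cball x0 T) y) \<partial>lborel)"
      by (rule order_trans[OF integral_abs_bound integral_mono[OF integrable_abs[OF ie] iB pt]])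
    also have "\<dots> = B * (\<eta> * (\<integral>y. q n y \<partial>lborel) + (\<epsilon> n)\<^sup>2 * inverse \<delta> ^ 5 * \<bar>W\<bar> * V)"
      using q(1)[of n] ic by (simp add: V_def)
    also have "\<dots> \<le> B * (\<eta> * L + (\<epsilon> n)\<^sup>2 * inverse \<delta> ^ 5 * \<bar>W\<bar> * V)"
      using B \<eta> q(2) by (intro mult_left_mono add_right_mono) auto
    finally show ?thesis by (simp add: algebra_simps)
  qed
  have "B * (\<eta> * L) = c / 2 * (L / (L + 1))" using B by (simp add: \<eta>_def)
  also have "\<dots> \<le> c / 2 * 1" using c L by (intro mult_left_mono) auto
  finally have half: "B * (\<eta> * L) \<le> c / 2" by simp
  have "(\<lambda>n. (\<epsilon> n)\<^sup>2 * (B * (inverse \<delta> ^ 5 * \<bar>W\<bar> * V))) \<longlonglongrightarrow> 0\<^sup>2 * (B * (inverse \<delta> ^ 5 * \<bar>W\<bar> * V))"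
    by (intro tendsto_intros \<epsilon>)
  then have "eventually (\<lambda>n. (\<epsilon> n)\<^sup>2 * (B * (inverse \<delta> ^ 5 * \<bar>W\<bar> * V)) < c / 2) sequentially"
    using c by (intro order_tendstoD(2)) auto
  then show "eventually (\<lambda>n. dist (\<integral>y. e n y * w y \<partial>lborel) 0 < c) sequentially"
  proof eventually_elim
    case (elim n)
    then show ?case using bound[of n] half by simp
  qed
qed

section \<open>Weak solutions of the Maxwell system\<close>

lemma L2_test_integrable:
  assumes w: "w \<in> L2" and \<phi>: "test_function \<phi>"
  shows "integrable lborel (\<lambda>x. \<phi> x *\<^sub>R w x)"
    and "(\<integral>x. \<phi> x *\<^sub>R w x \<partial>lborel) \<bullet> v = (\<integral>x. \<phi> x * (w x \<bullet> v) \<partial>lborel)"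
proof -
  obtain \<rho> C where b: "\<And>x. \<bar>\<phi> x\<bar> \<le> C * indicator (cball 0 \<rho>) x" using test_function_cball_bound[OF \<phi>] by blast
  have m: "\<phi> \<in> borel_measurable borel" by (rule test_function_measurable[OF \<phi>])
  have i: "integrable lborel (\<lambda>x. \<phi> x * (w x \<bullet> v))" for v
    by (rule L2_pairing(1)[OF w m integrable_sq_indicator_cball(1)[OF m b]])
  have "integrable lborel (\<lambda>x. \<Sum>k\<in>UNIV. (\<phi> x * (w x \<bullet> axis k 1)) *\<^sub>R axis k (1::real))"
    using i by (intro Bochner_Integration.integrable_sum integrable_scaleR_left) auto
  also have "(\<lambda>x. \<Sum>k\<in>UNIV. (\<phi> x * (w x \<bullet> axis k 1)) *\<^sub>R axis k (1::real)) = (\<lambda>x. \<phi> x *\<^sub>R w x)"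
    by (simp add: fun_eq_iff vec_eq_iff inner_axis ax if_distrib sum.delta cong: if_cong)
  finally show iv: "integrable lborel (\<lambda>x. \<phi> x *\<^sub>R w x)" .
  show "(\<integral>x. \<phi> x *\<^sub>R w x \<partial>lborel) \<bullet> v = (\<integral>x. \<phi> x * (w x \<bullet> v) \<partial>lborel)"
    using integral_inner_left[of v "lborel" "\<lambda>x. \<phi> x *\<^sub>R w x"] iv by simp
qed

lemma div_pairing_eq:
  assumes "w \<in> L2" "test_function \<phi>"
  shows "div_pairing w \<phi> = (\<Sum>k\<in>UNIV. \<integral>x. pd k \<phi> x * (w x \<bullet> axis k 1) \<partial>lborel)"
  unfolding div_pairing_def L2_test_integrable(2)[OF assms(1) pd_test_function[OF assms(2)], symmetric]
  by (simp add: inner_axis)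

lemma L2_translate:
  assumes "J \<in> L2" shows "(\<lambda>x. J (x - a)) \<in> L2" "L2_norm (\<lambda>x. J (x - a)) = L2_norm J"
proof -
  have m: "J \<in> borel_measurable borel" using assms by (rule L2_measurable)
  have i: "integrable lborel (\<lambda>x. (norm (J x))\<^sup>2)" using assms by (simp add: L2_def)
  have mt: "(\<lambda>x. J (x - a)) \<in> borel_measurable borel" using m by measurable
  have "integrable (distr lborel borel ((+) (- a))) (\<lambda>x. (norm (J x))\<^sup>2)" using i by (simp add: lborel_distr_plus)
  then have "integrable lborel (\<lambda>x. (norm (J (x - a)))\<^sup>2)"
    using m by (subst (asm) integrable_distr_eq) auto
  then show "(\<lambda>x. J (x - a)) \<in> L2" using mt by (simp add: L2_def)
  have m2: "(\<lambda>x. (norm (J x))\<^sup>2) \<in> borel_measurable borel" using m by measurable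
  show "L2_norm (\<lambda>x. J (x - a)) = L2_norm J"
    using integral_translate[OF m2, of "- a"] by (simp add: L2_norm_def)
qed

text \<open>The differential equation is imposed for positive times only, so derivatives in time are
  controlled in the interior of the interval and continuity has to reach the endpoints.\<close>

lemma constant_if_interior_deriv_zero:
  fixes f :: "real \<Rightarrow> real"
  assumes "\<And>s. s \<in> {0..\<tau>} \<Longrightarrow> (f has_real_derivative f' s) (at s within {0..\<tau>})"
    and "\<And>s. 0 < s \<Longrightarrow> s < \<tau> \<Longrightarrow> f' s = 0" and "t \<in> {0..\<tau>}"
  shows "f t = f 0"
proof (cases "t = 0")
  case False
  show ?thesis
  proof (rule DERIV_isconst_end[where f = f and a = 0 and b = t])
    show "0 < t" using False assms(3) by simp
    have "continuous_on {0..\<tau>} f" using assms(1) DERIV_continuous_on by blast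
    then show "continuous_on {0..t} f" by (rule continuous_on_subset) (use assms(3) in auto)
    show "(f has_real_derivative 0) (at x)" if "0 < x" "x < t" for x
      using assms(1)[of x] assms(2)[of x] assms(3) that at_within_Icc_at[of 0 x \<tau>] by simp
  qed
qed simp

lemma solution_L2:
  assumes "has_L2_deriv S u u'" "t \<in> S" shows "u t \<in> L2" "u' t \<in> L2"
  using assms by (auto simp: has_L2_deriv_def)

text \<open>A divergence-free source and its solution with the two time derivatives as parameters,
  since the integration by parts in time refers to all three fields.\<close>

locale maxwell_field =
  fixes J :: field and a :: "real \<Rightarrow> real^3" and g :: "real \<Rightarrow> real" and E E' E'' :: "real \<Rightarrow> field"
  assumes J: "J \<in> H2" "AE x in lborel. weak_div J x = 0"
    and E: "\<And>\<tau>. \<tau> > 0 \<Longrightarrow> C_H2 {0..\<tau>} E" "\<And>\<tau>. \<tau> > 0 \<Longrightarrow> has_L2_deriv {0..\<tau>} E E'"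
      "\<And>\<tau>. \<tau> > 0 \<Longrightarrow> has_L2_deriv {0..\<tau>} E' E''" "\<And>\<tau>. \<tau> > 0 \<Longrightarrow> C_L2 {0..\<tau>} E''"
    and eq: "\<And>t. t > 0 \<Longrightarrow> AE x in lborel. E'' t x + weak_curl (weak_curl (E t)) x = g t *\<^sub>R J (x - a t)"
    and init: "AE x in lborel. E 0 x = 0" "AE x in lborel. E' 0 x = 0"
begin

lemma JL: "J \<in> L2"
  using J by (simp add: H2_def)

lemma E_H2: "0 < t \<Longrightarrow> E t \<in> H2"
  using E(1)[of t] by (auto simp: C_H2_def)

lemma fields_L2:
  assumes "0 \<le> t" shows "E t \<in> L2" "E' t \<in> L2" "E'' t \<in> L2"
  using solution_L2[OF E(2)[of "t + 1"], of t] solution_L2[OF E(3)[of "t + 1"], of t] assms by auto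

lemma weak_equation:
  assumes \<phi>: "test_function \<phi>" and s: "s > 0"
  shows "(\<integral>x. \<phi> x *\<^sub>R E'' s x \<partial>lborel) = g s *\<^sub>R (\<integral>x. \<phi> x *\<^sub>R J (x - a s) \<partial>lborel)
    - (\<integral>x. \<phi> x *\<^sub>R weak_curl (weak_curl (E s)) x \<partial>lborel)"
proof -
  have iJ: "integrable lborel (\<lambda>x. g s *\<^sub>R (\<phi> x *\<^sub>R J (x - a s)))"
    by (intro integrable_scaleR_right L2_test_integrable(1)[OF L2_translate(1)[OF JL] \<phi>])
  have iE: "integrable lborel (\<lambda>x. \<phi> x *\<^sub>R E'' s x)"
    using fields_L2 s by (intro L2_test_integrable(1) \<phi>) auto
  note iC = weak_curl_curl(1)[OF E_H2[OF s] \<phi>]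
  have "(\<integral>x. \<phi> x *\<^sub>R E'' s x \<partial>lborel) = (\<integral>x. g s *\<^sub>R (\<phi> x *\<^sub>R J (x - a s)) - \<phi> x *\<^sub>R weak_curl (weak_curl (E s)) x \<partial>lborel)"
  proof (rule integral_cong_AE)
    show "(\<lambda>x. \<phi> x *\<^sub>R E'' s x) \<in> borel_measurable lborel" using iE by (rule borel_measurable_integrable)
    show "(\<lambda>x. g s *\<^sub>R (\<phi> x *\<^sub>R J (x - a s)) - \<phi> x *\<^sub>R weak_curl (weak_curl (E s)) x) \<in> borel_measurable lborel"
      using iJ iC by (intro borel_measurable_integrable Bochner_Integration.integrable_diff)
    show "AE x in lborel. \<phi> x *\<^sub>R E'' s x = g s *\<^sub>R (\<phi> x *\<^sub>R J (x - a s)) - \<phi> x *\<^sub>R weak_curl (weak_curl (E s)) x"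
      using eq[OF s]
    proof eventually_elim
      case (elim x)
      then have "E'' s x = g s *\<^sub>R J (x - a s) - weak_curl (weak_curl (E s)) x" by (simp add: algebra_simps)
      then show ?case by (simp add: scaleR_diff_right mult.commute)
    qed
  qed
  also have "\<dots> = (\<integral>x. g s *\<^sub>R (\<phi> x *\<^sub>R J (x - a s)) \<partial>lborel) - (\<integral>x. \<phi> x *\<^sub>R weak_curl (weak_curl (E s)) x \<partial>lborel)"
    by (rule Bochner_Integration.integral_diff[OF iJ iC])
  finally show ?thesis by (simp only: integral_scaleR_right)
qed

text \<open>Conservation of charge: tested with gradients, the equation loses both the double curl
  and the divergence-free source, so the second time derivative of the divergence vanishes. The
  initial data then remove the divergence itself.\<close>

lemma solution_div_free:
  assumes \<phi>: "test_function \<phi>" "commuting_pds \<phi>" and t: "t > 0"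
  shows "div_pairing (E t) \<phi> = 0"
proof -
  note pdt = pd_test_function[OF \<phi>(1)]
  note e = E(2)[OF t] and e' = E(3)[OF t]
  have d: "((\<lambda>s. div_pairing (u s) \<phi>) has_real_derivative div_pairing (u' s) \<phi>) (at s within {0..t})"
    if u: "has_L2_deriv {0..t} u u'" and s: "s \<in> {0..t}" for u u' s
  proof -
    have k: "((\<lambda>s. \<integral>x. pd k \<phi> x * (u s x \<bullet> axis k 1) \<partial>lborel) has_real_derivative (\<integral>x. pd k \<phi> x * (u' s x \<bullet> axis k 1) \<partial>lborel)) (at s within {0..t})" for k
    proof -
      obtain \<rho> C where b: "\<And>x. \<bar>pd k \<phi> x\<bar> \<le> C * indicator (cball 0 \<rho>) x" using test_function_cball_bound[OF pdt] by blast
      have "((\<lambda>s. \<integral>x. pd k \<phi> x * (u s x \<bullet> axis k 1) \<partial>lborel) has_real_derivative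
         (\<integral>x. pd k \<phi> x * (u' s x \<bullet> axis k 1) \<partial>lborel) + (\<integral>x. 0 * (u s x \<bullet> axis k 1) \<partial>lborel)) (at s within {0..t})"
        by (rule pairing_deriv[OF u s, where z = "\<lambda>_. pd k \<phi>" and z' = "\<lambda>_ _. 0" and C = C and \<rho> = \<rho> and ?x0.0 = 0])
          (use b order_trans[OF abs_ge_zero b] test_function_measurable[OF pdt] in auto)
      then show ?thesis by simp
    qed
    have "((\<lambda>s. \<Sum>k\<in>UNIV. \<integral>x. pd k \<phi> x * (u s x \<bullet> axis k 1) \<partial>lborel) has_real_derivative
       (\<Sum>k\<in>UNIV. \<integral>x. pd k \<phi> x * (u' s x \<bullet> axis k 1) \<partial>lborel)) (at s within {0..t})"
      by (intro DERIV_sum k)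
    then have "((\<lambda>s. \<Sum>k\<in>UNIV. \<integral>x. pd k \<phi> x * (u s x \<bullet> axis k 1) \<partial>lborel) has_real_derivative div_pairing (u' s) \<phi>) (at s within {0..t})"
      using solution_L2(2)[OF u s] \<phi> by (simp add: div_pairing_eq)
    then show ?thesis
      by (rule has_field_derivative_transform_within[OF _ zero_less_one s])
        (use solution_L2(1)[OF u] \<phi> in \<open>simp add: div_pairing_eq\<close>)
  qed
  have z: "div_pairing w \<phi> = 0" if "AE x in lborel. w x = 0" for w
  proof -
    have "(\<integral>x. pd k \<phi> x *\<^sub>R w x \<partial>lborel) = 0" for k
      by (rule integral_eq_zero_AE) (use that in eventually_elim, simp)
    then show ?thesis by (simp add: div_pairing_def)
  qed
  have E'': "div_pairing (E'' s) \<phi> = 0" if "0 < s" "s < t" for s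
  proof -
    have "div_pairing (E'' s) \<phi> = g s * div_pairing (\<lambda>x. J (x - a s)) \<phi> - div_pairing (weak_curl (weak_curl (E s))) \<phi>"
      unfolding div_pairing_def weak_equation[OF pdt that(1)] by (simp add: sum_subtractf sum_distrib_left)
    then show ?thesis using div_free_translate[OF J \<phi>(1)] div_curl_curl[OF E_H2[OF that(1)] \<phi>] by simp
  qed
  have "div_pairing (E' s) \<phi> = 0" if "s \<in> {0..t}" for s
    using constant_if_interior_deriv_zero[OF d[OF e'] E'' that] z[OF init(2)] by simp
  then have "div_pairing (E t) \<phi> = div_pairing (E 0) \<phi>"
    using t by (intro constant_if_interior_deriv_zero[OF d[OF e]]) auto
  then show ?thesis using z[OF init(1)] by simp
qed

end

section \<open>The regularized advanced wave and its wave operator\<close>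

locale wave_kernel =
  fixes P :: "nat \<Rightarrow> real \<Rightarrow> real" and x0 :: "real^3" and \<epsilon> T :: real
  assumes tower: "derivative_tower P" and eps: "\<epsilon> > 0" and T: "T > 0" and cut: "\<And>n t. T < t \<Longrightarrow> P n t = 0"
begin

abbreviation "rad \<equiv> radius x0 \<epsilon>"

definition wave :: "nat \<Rightarrow> real \<Rightarrow> real^3 \<Rightarrow> real" where
  "wave n s y = P n (s + rad y) * inverse (rad y)"

text \<open>The second time derivative of \<open>wave 0\<close> minus its Laplacian, as computed in
  \<open>laplacian_wave\<close>.\<close>

definition err :: "real \<Rightarrow> real^3 \<Rightarrow> real" where
  "err s y = \<epsilon>\<^sup>2 * (P 2 (s + rad y) * inverse (rad y) ^ 3 - 3 * P 1 (s + rad y) * inverse (rad y) ^ 4 + 3 * P 0 (s + rad y) * inverse (rad y) ^ 5)"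

lemma r: "rad y \<ge> \<epsilon>" "rad y \<ge> norm (y - x0)" "rad y > 0"
  by (rule radius_bounds[OF eps])+

lemma P_cont: "continuous_on S (P n)"
  using tower unfolding derivative_tower_def by (meson DERIV_continuous_on has_field_derivative_at_within)

lemma P_comp_meas: "(\<lambda>y. P n (s + rad y)) \<in> borel_measurable borel"
proof -
  have "P n \<in> borel_measurable borel" by (rule borel_measurable_continuous_onI[OF P_cont])
  then show ?thesis by measurable
qed

lemma wave_measurable: "wave n s \<in> borel_measurable borel"
  unfolding wave_def[abs_def] using P_comp_meas[of n s] by measurable

lemma err_measurable: "err s \<in> borel_measurable borel"
  unfolding err_def[abs_def] using P_comp_meas[of 0 s] P_comp_meas[of 1 s] P_comp_meas[of 2 s] by measurable

lemma wave_deriv: "((\<lambda>s. wave n s y) has_real_derivative wave (Suc n) s y) (at s)"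
proof -
  have "((\<lambda>s. s + rad y) has_real_derivative 1) (at s)" by (auto intro!: derivative_eq_intros)
  from DERIV_chain2[OF _ this, of "P n"] tower
  have "((\<lambda>s. P n (s + rad y)) has_real_derivative P (Suc n) (s + rad y) * 1) (at s)" by (auto simp: derivative_tower_def)
  then show ?thesis unfolding wave_def by (auto intro!: DERIV_cmult_right)
qed

lemma P_bounded: "\<exists>C>0. \<forall>n\<le>2. \<forall>t\<ge>0. \<bar>P n t\<bar> \<le> C"
proof -
  have "\<exists>C. \<forall>t\<ge>0. \<bar>P n t\<bar> \<le> C" for n
  proof -
    obtain C where C: "\<forall>z\<in>P n ` {0..T}. norm z \<le> C"
      using compact_imp_bounded[OF compact_continuous_image[OF P_cont[of "{0..T}" n] compact_Icc]] unfolding bounded_iff by blast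
    have "\<bar>P n t\<bar> \<le> max C 0" if "t \<ge> 0" for t
      using C cut[of t n] that by (cases "t \<le> T") (auto simp: le_max_iff_disj)
    then show ?thesis by blast
  qed
  then obtain C where C: "\<And>n t. t \<ge> 0 \<Longrightarrow> \<bar>P n t\<bar> \<le> C n" by metis
  have "\<bar>P n t\<bar> \<le> max 1 (max (C 0) (max (C 1) (C 2)))" if "n \<le> 2" "t \<ge> 0" for n t
  proof -
    have "n = 0 \<or> n = 1 \<or> n = 2" using that by auto
    then show ?thesis using C[OF that(2), of n] by auto
  qed
  then show ?thesis by (intro exI[of _ "max 1 (max (C 0) (max (C 1) (C 2)))"]) auto
qed

context
  fixes C assumes C: "C > 0" "\<And>n t. n \<le> 2 \<Longrightarrow> t \<ge> 0 \<Longrightarrow> \<bar>P n t\<bar> \<le> C"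
begin

lemma profile_bound:
  assumes "n \<le> 2" "s \<ge> 0" shows "\<bar>P n (s + rad y)\<bar> \<le> C * indicator (cball x0 T) y"
proof (cases "y \<in> cball x0 T")
  case True
  then show ?thesis using C(2)[OF assms(1), of "s + rad y"] assms(2) r(3)[of y] by simp
next
  case False
  then have "T < norm (y - x0)" by (simp add: dist_norm norm_minus_commute)
  then show ?thesis using cut[of "s + rad y" n] r(2)[of y] assms(2) False by simp
qed

lemma wave_bound:
  assumes "n \<le> 2" "s \<ge> 0" shows "\<bar>wave n s y\<bar> \<le> C / \<epsilon> * indicator (cball x0 T) y"
proof -
  have "\<bar>wave n s y\<bar> = \<bar>P n (s + rad y)\<bar> * inverse (rad y)" using r(3)[of y] by (simp add: wave_def abs_mult)
  also have "\<dots> \<le> (C * indicator (cball x0 T) y) * inverse \<epsilon>"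
    using profile_bound[OF assms, of y] r[of y] eps C by (intro mult_mono le_imp_inverse_le) auto
  finally show ?thesis by (simp add: divide_inverse mult_ac)
qed

text \<open>Since 1/r is at most 1/|y - x0|, which is locally square integrable in three dimensions,
  the L2 bound does not depend on \<epsilon>. The pointwise bound \<open>wave_bound\<close>
  degenerates as \<epsilon> tends to zero.\<close>

lemma wave_norm:
  assumes "n \<le> 2" "s \<ge> 0"
  shows "integrable lborel (\<lambda>y. (wave n s y)\<^sup>2)"
    and "sqrt (\<integral>y. (wave n s y)\<^sup>2 \<partial>lborel) \<le> C * sqrt (\<integral>y. (indicator (cball x0 T) y / norm (y - x0))\<^sup>2 \<partial>lborel)"
proof -
  show i: "integrable lborel (\<lambda>y. (wave n s y)\<^sup>2)"
    by (rule integrable_sq_indicator_cball(1)[OF wave_measurable wave_bound[OF assms]])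
  have ii: "integrable lborel (\<lambda>y. C\<^sup>2 * (indicator (cball x0 T) y / norm (y - x0))\<^sup>2)"
    using integrable_inverse_norm_sq[OF T, of x0] by (rule integrable_mult_right)
  have "AE y in lborel. y \<noteq> x0" by (rule AE_lborel_singleton)
  then have "AE y in lborel. (wave n s y)\<^sup>2 \<le> C\<^sup>2 * (indicator (cball x0 T) y / norm (y - x0))\<^sup>2"
  proof eventually_elim
    case (elim y)
    then have n: "norm (y - x0) > 0" by simp
    have "\<bar>wave n s y\<bar> = \<bar>P n (s + rad y)\<bar> * inverse (rad y)" using r(3)[of y] by (simp add: wave_def abs_mult)
    also have "\<dots> \<le> (C * indicator (cball x0 T) y) * inverse (norm (y - x0))"
    proof (rule mult_mono[OF profile_bound[OF assms]])
      show "inverse (rad y) \<le> inverse (norm (y - x0))" by (rule le_imp_inverse_le[OF r(2) n])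
    qed (use C less_imp_le[OF r(3)] in simp_all)
    finally have "\<bar>wave n s y\<bar> \<le> C * (indicator (cball x0 T) y / norm (y - x0))" by (simp add: divide_inverse mult_ac)
    then have "\<bar>wave n s y\<bar>\<^sup>2 \<le> (C * (indicator (cball x0 T) y / norm (y - x0)))\<^sup>2" by (intro power_mono) auto
    then show ?case by (simp only: power_mult_distrib power2_abs)
  qed
  then have "(\<integral>y. (wave n s y)\<^sup>2 \<partial>lborel) \<le> (\<integral>y. C\<^sup>2 * (indicator (cball x0 T) y / norm (y - x0))\<^sup>2 \<partial>lborel)"
    by (rule integral_mono_AE[OF i ii])
  then have "sqrt (\<integral>y. (wave n s y)\<^sup>2 \<partial>lborel) \<le> sqrt (C\<^sup>2 * (\<integral>y. (indicator (cball x0 T) y / norm (y - x0))\<^sup>2 \<partial>lborel))"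
    by (intro real_sqrt_le_mono) simp
  then show "sqrt (\<integral>y. (wave n s y)\<^sup>2 \<partial>lborel) \<le> C * sqrt (\<integral>y. (indicator (cball x0 T) y / norm (y - x0))\<^sup>2 \<partial>lborel)"
    using C by (simp add: real_sqrt_mult)
qed

text \<open>On the support r is at most \<open>T\<close>, so r^(-3) and r^(-4) are at most T^2
  r^(-5) and T r^(-5). Together with the coefficients 1, 3, 3 this gives the polynomial in
  \<open>T\<close>.\<close>

lemma err_bound:
  assumes s: "s \<ge> 0"
  shows "\<bar>err s y\<bar> \<le> C * (T\<^sup>2 + 3 * T + 3) * (\<epsilon>\<^sup>2 * inverse (rad y) ^ 5) * indicator (cball x0 T) y"
proof (cases "rad y \<le> T")
  case True
  then have y: "y \<in> cball x0 T" using r(2)[of y] by (simp add: dist_norm norm_minus_commute)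
  define q where "q = inverse (rad y)"
  have q: "q > 0" using r(3) by (simp add: q_def)
  have qr: "rad y * q = 1" using r(3)[of y] by (simp add: q_def)
  have q3: "q ^ 3 = (rad y)\<^sup>2 * q ^ 5" "q ^ 4 = rad y * q ^ 5" using qr by algebra+
  have "(rad y)\<^sup>2 \<le> T\<^sup>2" using True r(3)[of y] by (intro power_mono) auto
  then have le: "q ^ 3 \<le> T\<^sup>2 * q ^ 5" "q ^ 4 \<le> T * q ^ 5" unfolding q3 using True q by (auto intro!: mult_right_mono)
  have b: "\<bar>P n (s + rad y)\<bar> \<le> C" if "n \<le> 2" for n using C(2)[OF that, of "s + rad y"] s r(3)[of y] by simp
  have "\<bar>P 2 (s + rad y) * q ^ 3 - 3 * P 1 (s + rad y) * q ^ 4 + 3 * P 0 (s + rad y) * q ^ 5\<bar>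
    \<le> \<bar>P 2 (s + rad y)\<bar> * q ^ 3 + 3 * (\<bar>P 1 (s + rad y)\<bar> * q ^ 4) + 3 * (\<bar>P 0 (s + rad y)\<bar> * q ^ 5)"
  proof -
    have "\<bar>P n (s + rad y) * q ^ k\<bar> = \<bar>P n (s + rad y)\<bar> * q ^ k" for n k using q by (simp add: abs_mult)
    from this[of 2 3] this[of 1 4] this[of 0 5] show ?thesis by linarith
  qed
  also have "\<dots> \<le> C * (T\<^sup>2 * q ^ 5) + 3 * (C * (T * q ^ 5)) + 3 * (C * q ^ 5)"
    using b[of 0] b[of 1] b[of 2] le q C by (intro add_mono mult_left_mono mult_mono) auto
  also have "\<dots> = C * (T\<^sup>2 + 3 * T + 3) * q ^ 5" by (simp add: algebra_simps)
  finally have "\<epsilon>\<^sup>2 * \<bar>P 2 (s + rad y) * q ^ 3 - 3 * P 1 (s + rad y) * q ^ 4 + 3 * P 0 (s + rad y) * q ^ 5\<bar> \<le> \<epsilon>\<^sup>2 * (C * (T\<^sup>2 + 3 * T + 3) * q ^ 5)"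
    by (intro mult_left_mono) auto
  then show ?thesis using y unfolding err_def q_def[symmetric] by (simp add: abs_mult mult_ac)
next
  case False
  then have "P n (s + rad y) = 0" for n using s by (intro cut) simp
  then show ?thesis using C T r(3)[of y] by (simp add: err_def less_imp_le)
qed

end

end

lemma (in wave_kernel) wave_test:
  assumes s: "s \<ge> 0" shows "test_function (wave n s)" "commuting_pds (wave n s)"
    "(\<Sum>i\<in>UNIV. pd i (pd i (wave 0 s)) y) = wave 2 s y - err s y"
proof -
  interpret rp: radial_profile P x0 \<epsilon> s by unfold_locales (rule tower, rule eps)
  have w: "wave n s \<in> fun_algebra rp.atoms" for n
    unfolding wave_def[abs_def] by (intro rp.atom_intros)
  show "test_function (wave n s)"
  proof (rule fun_algebra_test_function[OF rp.atoms_smooth w])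
    fix y assume "T < norm (y - x0)"
    then show "wave n s y = 0" using r(2)[of y] s by (simp add: wave_def cut)
  qed
  show "commuting_pds (wave n s)"
    unfolding commuting_pds_def
    using rp.pd_commute[OF fun_algebra_partial_derivs[OF rp.atoms_smooth w]] by blast
  show "(\<Sum>i\<in>UNIV. pd i (pd i (wave 0 s)) y) = wave 2 s y - err s y"
    using rp.laplacian_wave[of 0 y] by (simp add: wave_def[abs_def] err_def numeral_2_eq_2)
qed

section \<open>Duality between the electric field and the advanced wave\<close>

context maxwell_field begin

text \<open>The spatial half of the duality, at a fixed time: with div E = 0 the double curl is
  minus the Laplacian, which is moved to the kernel and replaced there by \<open>wave 2\<close>
  minus \<open>err\<close>.\<close>

lemma wave_identity:
  fixes p :: "real^3"
  assumes "wave_kernel P \<epsilon> T" and s: "s > 0"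
  shows "(\<integral>y. wave_kernel.err P p \<epsilon> s y * (E s y \<bullet> v) \<partial>lborel) = g s * (\<integral>y. wave_kernel.wave P p \<epsilon> 0 s y * (J (y - a s) \<bullet> v) \<partial>lborel)
     + (\<integral>y. wave_kernel.wave P p \<epsilon> 2 s y * (E s y \<bullet> v) \<partial>lborel) - (\<integral>y. wave_kernel.wave P p \<epsilon> 0 s y * (E'' s y \<bullet> v) \<partial>lborel)"
proof -
  interpret wave_kernel P p \<epsilon> T by fact
  let ?\<phi> = "wave_kernel.wave P p \<epsilon> 0 s"
  have s0: "s \<ge> 0" using s by simp
  note t = wave_test[OF s0, of 0]
  note EL = fields_L2[OF s0]
  have dp: "div_pairing (E s) (pd i ?\<phi>) = 0" for i
    by (rule solution_div_free[OF pd_test_function[OF t(1)] commuting_pds(3)[OF t(2)] s])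
  have ip: "integrable lborel (\<lambda>y. pd i (pd i ?\<phi>) y * (E s y \<bullet> v))" for i
  proof -
    have "integrable lborel (\<lambda>y. (pd i (pd i ?\<phi>) y *\<^sub>R E s y) \<bullet> v)"
      by (intro integrable_inner_left) (rule L2_test_integrable(1)[OF EL(1) pd_test_function[OF pd_test_function[OF t(1)]]])
    then show ?thesis by simp
  qed
  have i2: "integrable lborel (\<lambda>y. wave_kernel.wave P p \<epsilon> 2 s y * (E s y \<bullet> v))"
  proof -
    have "integrable lborel (\<lambda>y. (wave_kernel.wave P p \<epsilon> 2 s y *\<^sub>R E s y) \<bullet> v)"
      by (intro integrable_inner_left) (rule L2_test_integrable(1)[OF EL(1) wave_test(1)[OF s0]])
    then show ?thesis by simp
  qed
  have "(\<integral>x. ?\<phi> x *\<^sub>R E'' s x \<partial>lborel) = g s *\<^sub>R (\<integral>x. ?\<phi> x *\<^sub>R J (x - a s) \<partial>lborel)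
     + (\<Sum>i\<in>UNIV. \<integral>x. pd i (pd i ?\<phi>) x *\<^sub>R E s x \<partial>lborel)"
    unfolding weak_equation[OF t(1) s] curl_curl_laplacian[OF E_H2[OF s] t(1,2) dp] by simp
  then have "(\<integral>x. ?\<phi> x *\<^sub>R E'' s x \<partial>lborel) \<bullet> v = g s * ((\<integral>x. ?\<phi> x *\<^sub>R J (x - a s) \<partial>lborel) \<bullet> v)
     + (\<Sum>i\<in>UNIV. (\<integral>x. pd i (pd i ?\<phi>) x *\<^sub>R E s x \<partial>lborel) \<bullet> v)"
    by (simp add: inner_add_left inner_sum_left)
  then have "(\<integral>y. ?\<phi> y * (E'' s y \<bullet> v) \<partial>lborel) = g s * (\<integral>y. ?\<phi> y * (J (y - a s) \<bullet> v) \<partial>lborel)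
     + (\<Sum>i\<in>UNIV. \<integral>y. pd i (pd i ?\<phi>) y * (E s y \<bullet> v) \<partial>lborel)"
    by (simp only: L2_test_integrable(2)[OF EL(3) t(1)] L2_test_integrable(2)[OF L2_translate(1)[OF JL] t(1)]
        L2_test_integrable(2)[OF EL(1) pd_test_function[OF pd_test_function[OF t(1)]]])
  also have "(\<Sum>i\<in>UNIV. \<integral>y. pd i (pd i ?\<phi>) y * (E s y \<bullet> v) \<partial>lborel) = (\<integral>y. (\<Sum>i\<in>UNIV. pd i (pd i ?\<phi>) y) * (E s y \<bullet> v) \<partial>lborel)"
    unfolding sum_distrib_right using ip by (subst Bochner_Integration.integral_sum) auto
  finally have 1: "(\<integral>y. ?\<phi> y * (E'' s y \<bullet> v) \<partial>lborel) = g s * (\<integral>y. ?\<phi> y * (J (y - a s) \<bullet> v) \<partial>lborel)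
     + (\<integral>y. (\<Sum>i\<in>UNIV. pd i (pd i ?\<phi>) y) * (E s y \<bullet> v) \<partial>lborel)" .
  have isum: "integrable lborel (\<lambda>y. (\<Sum>i\<in>UNIV. pd i (pd i ?\<phi>) y) * (E s y \<bullet> v))"
    unfolding sum_distrib_right using ip by (rule Bochner_Integration.integrable_sum)
  have "err s y = wave 2 s y - (\<Sum>i\<in>UNIV. pd i (pd i ?\<phi>) y)" for y
    using wave_test(3)[OF s0, of y] by simp
  then have "(\<integral>y. err s y * (E s y \<bullet> v) \<partial>lborel) = (\<integral>y. wave 2 s y * (E s y \<bullet> v) - (\<Sum>i\<in>UNIV. pd i (pd i ?\<phi>) y) * (E s y \<bullet> v) \<partial>lborel)"
    by (simp add: left_diff_distrib)
  also have "\<dots> = (\<integral>y. wave 2 s y * (E s y \<bullet> v) \<partial>lborel) - (\<integral>y. (\<Sum>i\<in>UNIV. pd i (pd i ?\<phi>) y) * (E s y \<bullet> v) \<partial>lborel)"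
    using i2 isum by (rule Bochner_Integration.integral_diff)
  finally show ?thesis using 1 by simp
qed

text \<open>Green's identity in time. The bilinear expression \<open>F\<close> vanishes at time 0 by
  the initial data and at time \<open>T\<close> because the profile is evaluated beyond its cutoff;
  its derivative is the source pairing minus the pairing with \<open>err\<close>.\<close>

lemma duality:
  fixes p :: "real^3"
  assumes "wave_kernel P \<epsilon> T"
  defines "wave \<equiv> wave_kernel.wave P p \<epsilon>" and "err \<equiv> wave_kernel.err P p \<epsilon>"
  shows "((\<lambda>s. g s * (\<integral>y. wave 0 s y * (J (y - a s) \<bullet> v) \<partial>lborel) - (\<integral>y. err s y * (E s y \<bullet> v) \<partial>lborel)) has_integral 0) {0..T}"
proof -
  interpret wk: wave_kernel P p \<epsilon> T by fact
  obtain C where C: "C > 0" "\<And>n t. n \<le> 2 \<Longrightarrow> t \<ge> 0 \<Longrightarrow> \<bar>P n t\<bar> \<le> C" using wk.P_bounded by blast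
  have d: "((\<lambda>s. \<integral>y. wave n s y * (u s y \<bullet> v) \<partial>lborel) has_real_derivative
      (\<integral>y. wave n s y * (u' s y \<bullet> v) \<partial>lborel) + (\<integral>y. wave (Suc n) s y * (u s y \<bullet> v) \<partial>lborel)) (at s within {0..T})"
    if u: "has_L2_deriv {0..T} u u'" and s: "s \<in> {0..T}" and n: "n \<le> 1" for u u' s n
    unfolding wave_def
  proof (rule pairing_deriv[OF u s])
    show "\<bar>wk.wave n s y\<bar> \<le> C / \<epsilon> * indicator (cball p T) y" "\<bar>wk.wave (Suc n) s y\<bar> \<le> C / \<epsilon> * indicator (cball p T) y"
      if "s \<in> {0..T}" for s y using wk.wave_bound[OF C, of n s y] wk.wave_bound[OF C, of "Suc n" s y] that n by auto
  qed (auto intro: wk.wave_deriv wk.wave_measurable)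
  define F where "F s = (\<integral>y. wave 0 s y * (E' s y \<bullet> v) \<partial>lborel) - (\<integral>y. wave 1 s y * (E s y \<bullet> v) \<partial>lborel)" for s
  define F' where "F' s = (\<integral>y. wave 0 s y * (E'' s y \<bullet> v) \<partial>lborel) - (\<integral>y. wave 2 s y * (E s y \<bullet> v) \<partial>lborel)" for s
  have dF: "(F has_real_derivative F' s) (at s within {0..T})" if s: "s \<in> {0..T}" for s
    unfolding F_def[abs_def] F'_def
    by (rule DERIV_cong[OF DERIV_diff[OF d[OF E(3)[OF wk.T] s, of 0] d[OF E(2)[OF wk.T] s, of 1]]]) (auto simp: numeral_2_eq_2)
  have Fint: "(F' has_integral (F T - F 0)) {0..T}"
  proof (rule fundamental_theorem_of_calculus)
    show "(F has_vector_derivative F' s) (at s within {0..T})" if "s \<in> {0..T}" for s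
      using dF[OF that] by (simp add: has_real_derivative_iff_has_vector_derivative)
  qed (use wk.T in simp)
  have wT: "wave n T y = 0" for n y
    using wk.cut[of "T + radius p \<epsilon> y" n] wk.r(3)[of y] by (simp add: wave_def wk.wave_def)
  have "F T = 0" by (simp add: F_def wT)
  moreover have "F 0 = 0"
  proof -
    have "(\<integral>y. h y * (w y \<bullet> v) \<partial>lborel) = 0" if "AE y in lborel. w y = 0" for h and w :: field
      by (rule integral_eq_zero_AE) (use that in eventually_elim, simp)
    then show ?thesis using init by (simp add: F_def)
  qed
  ultimately have "(F' has_integral 0) (cbox 0 T)" using Fint by simp
  \<comment> \<open>The equation is given for positive times only, so the integrands are compared in
    the open interval.\<close>
  then have "((\<lambda>s. g s * (\<integral>y. wave 0 s y * (J (y - a s) \<bullet> v) \<partial>lborel) - (\<integral>y. err s y * (E s y \<bullet> v) \<partial>lborel)) has_integral 0) (cbox 0 T)"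
  proof (rule has_integral_spike_interior)
    fix s assume "s \<in> box 0 T"
    then have s: "s > 0" by (simp add: box_real)
    show "g s * (\<integral>y. wave 0 s y * (J (y - a s) \<bullet> v) \<partial>lborel) - (\<integral>y. err s y * (E s y \<bullet> v) \<partial>lborel) = F' s"
      using wave_identity[OF assms(1) s, where v = v and p = p] by (simp add: F'_def wave_def err_def)
  qed
  then show ?thesis by simp
qed

text \<open>The kernels \<open>err\<close> have bounded mass but unbounded L2 norm as \<epsilon>
  tends to zero, while the field is controlled in L2. The identity of the duality rewrites the
  pairing through waves, whose L2 norms are uniform in \<epsilon>. The bound provides the domination
  in time when \<epsilon> tends to zero.\<close>

lemma err_pairing_bounded:
  fixes p :: "real^3"
  assumes P: "\<And>\<epsilon>. \<epsilon> > 0 \<Longrightarrow> wave_kernel P \<epsilon> T" and g: "continuous_on {0..T} g"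
  shows "\<exists>B. \<forall>\<epsilon> s. \<epsilon> > 0 \<longrightarrow> s \<in> {0..T} \<longrightarrow> \<bar>\<integral>y. wave_kernel.err P p \<epsilon> s y * (E s y \<bullet> v) \<partial>lborel\<bar> \<le> B"
proof -
  interpret w1: wave_kernel P p 1 T using P[of 1] by simp
  obtain C where C: "C > 0" "\<And>n t. n \<le> 2 \<Longrightarrow> t \<ge> 0 \<Longrightarrow> \<bar>P n t\<bar> \<le> C" using w1.P_bounded by blast
  obtain B0 where B0: "\<And>s. s \<in> {0..T} \<Longrightarrow> L2_norm (E s) \<le> B0" using has_L2_deriv_bounded[OF E(2)[OF w1.T] compact_Icc] by blast
  obtain B2 where B2: "\<And>s. s \<in> {0..T} \<Longrightarrow> L2_norm (E'' s) \<le> B2" using C_L2_bounded[OF E(4)[OF w1.T] compact_Icc] by blast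
  obtain G where "\<forall>z\<in>g ` {0..T}. norm z \<le> G"
    using compact_imp_bounded[OF compact_continuous_image[OF g compact_Icc]] unfolding bounded_iff by blast
  then have G: "\<bar>g s\<bar> \<le> G" if "s \<in> {0..T}" for s using that by auto
  define Z where "Z = C * sqrt (\<integral>y. (indicator (cball p T) y / norm (y - p))\<^sup>2 \<partial>lborel)"
  have Z: "Z \<ge> 0" using C by (simp add: Z_def)
  define B where "B = G * (Z * (norm v * L2_norm J)) + Z * (norm v * B0) + Z * (norm v * B2)"
  have "\<bar>\<integral>y. wave_kernel.err P p \<epsilon> s y * (E s y \<bullet> v) \<partial>lborel\<bar> \<le> B" if \<epsilon>: "\<epsilon> > 0" and s: "s \<in> {0..T}" for \<epsilon> s
  proof -
    interpret wk: wave_kernel P p \<epsilon> T by (rule P[OF \<epsilon>])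
    have s0: "s \<ge> 0" using s by simp
    have G0: "G \<ge> 0" using G[OF s] by simp
    have pb: "\<bar>\<integral>y. wk.wave n s y * (u y \<bullet> v) \<partial>lborel\<bar> \<le> Z * (norm v * b)" if "n \<le> 2" "u \<in> L2" "L2_norm u \<le> b" for n u b
    proof -
      have "\<bar>\<integral>y. wk.wave n s y * (u y \<bullet> v) \<partial>lborel\<bar> \<le> sqrt (\<integral>y. (wk.wave n s y)\<^sup>2 \<partial>lborel) * (norm v * L2_norm u)"
        by (rule L2_pairing(2)[OF that(2) wk.wave_measurable wk.wave_norm(1)[OF C that(1) s0]])
      also have "\<dots> \<le> Z * (norm v * b)"
        using wk.wave_norm(2)[OF C that(1) s0] that(3) Z unfolding Z_def[symmetric]
        by (intro mult_mono mult_left_mono) auto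
      finally show ?thesis .
    qed
    show ?thesis
    proof (cases "s = 0")
      case True
      have "(\<integral>y. wk.err s y * (E s y \<bullet> v) \<partial>lborel) = 0"
        by (rule integral_eq_zero_AE) (use init(1) in eventually_elim, simp add: True)
      moreover have "0 \<le> B" unfolding B_def using Z G0 order_trans[OF L2_norm_nonneg B0[OF s]] order_trans[OF L2_norm_nonneg B2[OF s]] by auto
      ultimately show ?thesis by simp
    next
      case False
      then have "s > 0" using s by simp
      from wave_identity[OF P[OF \<epsilon>] this, where v = v and p = p]
      have "\<bar>\<integral>y. wk.err s y * (E s y \<bullet> v) \<partial>lborel\<bar> \<le> \<bar>g s\<bar> * \<bar>\<integral>y. wk.wave 0 s y * (J (y - a s) \<bullet> v) \<partial>lborel\<bar>
        + \<bar>\<integral>y. wk.wave 2 s y * (E s y \<bullet> v) \<partial>lborel\<bar> + \<bar>\<integral>y. wk.wave 0 s y * (E'' s y \<bullet> v) \<partial>lborel\<bar>"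
        unfolding abs_mult[symmetric] by linarith
      also have "\<dots> \<le> B"
        unfolding B_def
        using G[OF s] G0 fields_L2[OF s0] L2_translate[OF JL, of "a s"] B0[OF s] B2[OF s]
        by (intro add_mono mult_mono pb) auto
      finally show ?thesis .
    qed
  qed
  then show ?thesis by blast
qed

end

section \<open>Passing to the singular kernels\<close>

lemma continuous_on_source:
  fixes f :: "real^3 \<Rightarrow> real" and \<phi> :: "real \<Rightarrow> real^3 \<Rightarrow> real"
  assumes f: "integrable lborel f" "\<And>y. y \<notin> K \<Longrightarrow> f y = 0" and K: "compact K"
    and \<phi>: "continuous_on (U \<times> K) (\<lambda>(z, y). \<phi> z y)"
  shows "continuous_on U (\<lambda>z. \<integral>y. f y * \<phi> z y \<partial>lborel)"
proof -
  define M where "M = restrict_space (lborel :: (real^3) measure) K"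
  have Km: "K \<in> sets lborel" using borel_compact[OF K] by simp
  have ind: "indicator K y * f y = f y" "indicator K y * (f y * c) = f y * c" for y c
    using f(2)[of y] by (auto simp: indicator_def)
  have fM: "integrable M f" unfolding M_def using Km f(1) by (simp add: integrable_restrict_space ind)
  have "continuous_on U (\<lambda>z. \<integral>y. f y *\<^sub>R \<phi> z y \<partial>M)"
    by (rule continuous_on_integral_parameter[OF fM _ _ K \<phi>])
      (auto simp: M_def space_restrict_space intro: measurable_restrict_space1)
  moreover have "(\<integral>y. f y *\<^sub>R \<phi> z y \<partial>M) = (\<integral>y. f y * \<phi> z y \<partial>lborel)" for z
    unfolding M_def using Km by (simp add: integral_restrict_space ind)
  ultimately show ?thesis by simp
qed

lemma integral_limit_on_support:
  fixes f :: "real^3 \<Rightarrow> real"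
  assumes f: "integrable lborel f" "\<And>y. y \<notin> K \<Longrightarrow> f y = 0"
    and \<phi>: "\<And>n. \<phi> n \<in> borel_measurable borel" "\<psi> \<in> borel_measurable borel"
    and lim: "\<And>y. y \<in> K \<Longrightarrow> (\<lambda>n. \<phi> n y) \<longlonglongrightarrow> \<psi> y"
    and b: "\<And>n y. y \<in> K \<Longrightarrow> \<bar>\<phi> n y\<bar> \<le> B"
  shows "(\<lambda>n. \<integral>y. f y * \<phi> n y \<partial>lborel) \<longlonglongrightarrow> (\<integral>y. f y * \<psi> y \<partial>lborel)"
    and "\<bar>\<integral>y. f y * \<phi> n y \<partial>lborel\<bar> \<le> (\<integral>y. \<bar>f y\<bar> \<partial>lborel) * B"
proof -
  have le: "\<bar>f y * \<phi> n y\<bar> \<le> \<bar>f y\<bar> * B" for n y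
  proof (cases "y \<in> K")
    case True
    then show ?thesis using b[OF True, of n] by (simp add: abs_mult mult_left_mono)
  qed (simp add: f)
  have fm: "f \<in> borel_measurable borel" using f(1) by simp
  have m: "(\<lambda>y. f y * \<phi> n y) \<in> borel_measurable lborel" "(\<lambda>y. f y * \<psi> y) \<in> borel_measurable lborel" for n
    using fm \<phi> by measurable
  have i: "integrable lborel (\<lambda>y. \<bar>f y\<bar> * B)" using f(1) by simp
  show "(\<lambda>n. \<integral>y. f y * \<phi> n y \<partial>lborel) \<longlonglongrightarrow> (\<integral>y. f y * \<psi> y \<partial>lborel)"
  proof (rule integral_dominated_convergence[OF m(2) m(1) i])
    show "AE y in lborel. (\<lambda>n. f y * \<phi> n y) \<longlonglongrightarrow> f y * \<psi> y"
    proof (rule AE_I2)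
      show "(\<lambda>n. f y * \<phi> n y) \<longlonglongrightarrow> f y * \<psi> y" for y
        using lim[of y] f(2)[of y] by (cases "y \<in> K") (auto intro: tendsto_intros)
    qed
    show "AE y in lborel. norm (f y * \<phi> n y) \<le> \<bar>f y\<bar> * B" for n using le by simp
  qed
  have "integrable lborel (\<lambda>y. f y * \<phi> n y)"
    by (rule Bochner_Integration.integrable_bound[OF i m(1)]) (use le in \<open>auto intro: order_trans[OF _ abs_ge_self]\<close>)
  then have "\<bar>\<integral>y. f y * \<phi> n y \<partial>lborel\<bar> \<le> (\<integral>y. \<bar>f y\<bar> * B \<partial>lborel)"
    by (intro order_trans[OF integral_abs_bound integral_mono[OF integrable_abs i le]])
  then show "\<bar>\<integral>y. f y * \<phi> n y \<partial>lborel\<bar> \<le> (\<integral>y. \<bar>f y\<bar> \<partial>lborel) * B" by simp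
qed

lemma radius_tendsto:
  assumes "\<epsilon> \<longlonglongrightarrow> 0" shows "(\<lambda>n. radius c (\<epsilon> n) y) \<longlonglongrightarrow> norm (y - c)"
proof -
  have "(\<lambda>n. radius c (\<epsilon> n) y) \<longlonglongrightarrow> sqrt ((norm (y - c))\<^sup>2 + 0\<^sup>2)"
    unfolding radius_def by (intro tendsto_intros assms)
  then show ?thesis by simp
qed

lemma cutoff_tower:
  fixes \<kappa> :: real
  assumes "T1 < T"
  obtains P where "derivative_tower P" "\<And>n t. T < t \<Longrightarrow> P n t = 0"
    "\<And>t. t \<le> T1 \<Longrightarrow> P 0 t = exp (- \<kappa> * t)" "\<And>t. t < T1 \<Longrightarrow> P 1 t = - \<kappa> * exp (- \<kappa> * t)"
proof -
  obtain P where P: "derivative_tower P" "\<forall>t\<le>T1. P 0 t = exp (- \<kappa> * t)" "\<forall>t\<ge>T. P 0 t = 0"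
    using ex_smooth_cutoff[OF assms] by blast
  have "P n t = 0" if "T < t" for n t
    by (rule derivative_tower_eq_on_open[OF P(1), of "\<lambda>_ _. 0" "{T<..}"])
      (use P(3) that in \<open>auto simp: derivative_tower_def\<close>)
  moreover have "P 1 t = - \<kappa> * exp (- \<kappa> * t)" if "t < T1" for t
  proof -
    have "derivative_tower (\<lambda>n t. (- \<kappa>) ^ n * exp (- \<kappa> * t))"
      unfolding derivative_tower_def by (auto intro!: derivative_eq_intros)
    then have "P 1 t = (- \<kappa>) ^ 1 * exp (- \<kappa> * t)"
      using derivative_tower_eq_on_open[OF P(1), of "\<lambda>n t. (- \<kappa>) ^ n * exp (- \<kappa> * t)" "{..<T1}" t 1] P(2) that by simp
    then show ?thesis by simp
  qed
  ultimately show ?thesis using that P by blast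
qed

text \<open>The field \<open>h y *\<^sub>R (y - c)\<close> is the gradient of the test function
  \<Phi>, and gradients are orthogonal to divergence-free fields.\<close>

lemma div_free_radial_moment:
  assumes J: "J \<in> H2" "AE x in lborel. weak_div J x = 0" and \<Phi>: "test_function \<Phi>"
    and pd: "\<And>k y. pd k \<Phi> y = h y * (y - c) $ k"
  shows "(\<integral>y. h y * (J y \<bullet> (y - c)) \<partial>lborel) = 0" "integrable lborel (\<lambda>y. h y * (J y \<bullet> (y - c)))"
proof -
  have JL: "J \<in> L2" using J by (simp add: H2_def)
  have i: "integrable lborel (\<lambda>y. pd k \<Phi> y * (J y \<bullet> axis k 1))" for k
  proof -
    have "integrable lborel (\<lambda>y. (pd k \<Phi> y *\<^sub>R J y) \<bullet> axis k 1)"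
      by (intro integrable_inner_left) (rule L2_test_integrable(1)[OF JL pd_test_function[OF \<Phi>]])
    then show ?thesis by simp
  qed
  have eq: "(\<Sum>k\<in>UNIV. pd k \<Phi> y * (J y \<bullet> axis k 1)) = h y * (J y \<bullet> (y - c))" for y
    unfolding pd inner_axis by (simp add: inner_vec_def sum_distrib_left mult_ac)
  have "0 = (\<Sum>k\<in>UNIV. \<integral>y. pd k \<Phi> y * (J y \<bullet> axis k 1) \<partial>lborel)"
    using div_free_pairing[OF J \<Phi>] by (simp only: div_pairing_eq[OF JL \<Phi>])
  also have "\<dots> = (\<integral>y. (\<Sum>k\<in>UNIV. pd k \<Phi> y * (J y \<bullet> axis k 1)) \<partial>lborel)"
    using i by (subst Bochner_Integration.integral_sum) auto
  finally show "(\<integral>y. h y * (J y \<bullet> (y - c)) \<partial>lborel) = 0" by (simp only: eq)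
  have "integrable lborel (\<lambda>y. \<Sum>k\<in>UNIV. pd k \<Phi> y * (J y \<bullet> axis k 1))" using i by (intro Bochner_Integration.integrable_sum)
  then show "integrable lborel (\<lambda>y. h y * (J y \<bullet> (y - c)))" by (simp only: eq)
qed

text \<open>Both vector kernels are gradients of radial functions: with r = |y - c|, the first is a
  multiple of the gradient of exp(-\<kappa> r) and the second of exp(-\<kappa> r) / r. These
  functions are not smooth at \<open>c\<close> and not compactly supported, so a cutoff profile of
  the regularized radius is used; \<open>K\<close> stays away from \<open>c\<close>, and the limit
  \<epsilon> to 0 is harmless.\<close>

lemma div_free_kernel_moments:
  fixes J\<^sub>1 J\<^sub>2 J :: field and \<kappa> :: real
  assumes J1: "J\<^sub>1 \<in> H2" "AE x in lborel. weak_div J\<^sub>1 x = 0" and J2: "J\<^sub>2 \<in> H2" "AE x in lborel. weak_div J\<^sub>2 x = 0"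
    and J: "integrable lborel J" "\<And>y. y \<notin> K \<Longrightarrow> J y = 0" and K: "compact K"
    and AEJ: "AE y in lborel. J y = J\<^sub>1 y - J\<^sub>2 y"
    and d: "d > 0" "\<And>y. y \<in> K \<Longrightarrow> d \<le> norm (y - c)" and \<kappa>: "\<kappa> > 0"
  shows "(\<integral>y. J y \<bullet> (yuk \<kappa> ((norm (c - y))\<^sup>2) *\<^sub>R (c - y)) \<partial>lborel) = 0"
    and "(\<integral>y. J y \<bullet> (yuk' \<kappa> ((norm (c - y))\<^sup>2) *\<^sub>R (c - y)) \<partial>lborel) = 0"
proof -
  obtain b where b: "\<And>y. y \<in> K \<Longrightarrow> norm y \<le> b" using compact_imp_bounded[OF K] by (auto simp: bounded_iff)
  \<comment> \<open>For \<epsilon> at most 1 the regularized radius on \<open>K\<close> is at most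
    \<open>b + norm c + 1\<close>, so the profile is exactly exponential on
    \<open>K\<close>.\<close>
  define T1 where "T1 = max b 0 + norm c + 2"
  have T1: "radius c e y < T1" if "y \<in> K" "0 < e" "e \<le> 1" for e y
  proof -
    have "radius c e y \<le> norm (y - c) + e"
      unfolding radius_def using sqrt_sum_squares_le_sum[of "norm (y - c)" e] that by simp
    also have "norm (y - c) \<le> norm y + norm c" by (rule norm_triangle_ineq4)
    finally show ?thesis using b[OF that(1)] that by (simp add: T1_def)
  qed
  have T1pos: "T1 > 0" using norm_ge_zero[of c] unfolding T1_def by linarith
  have T1n: "norm (y - c) < T1" if "y \<in> K" for y
    using norm_triangle_ineq4[of y c] b[OF that] by (simp add: T1_def)
  obtain P where P: "derivative_tower P" "\<And>n t. T1 + 1 < t \<Longrightarrow> P n t = 0"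
    "\<And>t. t \<le> T1 \<Longrightarrow> P 0 t = exp (- \<kappa> * t)" "\<And>t. t < T1 \<Longrightarrow> P 1 t = - \<kappa> * exp (- \<kappa> * t)"
    using cutoff_tower[of T1 "T1 + 1" \<kappa>] by auto
  define \<epsilon> where "\<epsilon> n = 1 / (real n + 1)" for n
  have \<epsilon>: "\<epsilon> n > 0" "\<epsilon> n \<le> 1" for n by (auto simp: \<epsilon>_def)
  have \<epsilon>lim: "\<epsilon> \<longlonglongrightarrow> 0" unfolding \<epsilon>_def by real_asymp
  have wk: "wave_kernel P (\<epsilon> n) (T1 + 1)" for n by unfold_locales (use P \<epsilon> T1pos in auto)
  have rp: "radial_profile P (\<epsilon> n)" for n by unfold_locales (use P \<epsilon> in auto)
  have mom: "(\<integral>y. (J y \<bullet> (y - c)) * H (norm (y - c)) \<partial>lborel) = 0"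
    if \<Phi>: "\<And>n. test_function (\<Phi> n)" and pd: "\<And>n k y. pd k (\<Phi> n) y = H (radius c (\<epsilon> n) y) * (y - c) $ k"
      and H: "continuous_on {0<..} H" and Hm: "H \<in> borel_measurable borel" for \<Phi> and H :: "real \<Rightarrow> real"
  proof -
    define f where "f y = J y \<bullet> (y - c)" for y
    have "integrable lborel f"
    proof (rule Bochner_Integration.integrable_bound)
      show "integrable lborel (\<lambda>y. T1 * norm (J y))" using J(1) by simp
      show "f \<in> borel_measurable lborel" unfolding f_def[abs_def] using J(1) by measurable
      have "\<bar>f y\<bar> \<le> T1 * norm (J y)" for y
      proof (cases "y \<in> K")
        case True
        have "\<bar>f y\<bar> \<le> norm (J y) * norm (y - c)" unfolding f_def by (rule Cauchy_Schwarz_ineq2)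
        also have "\<dots> \<le> norm (J y) * T1" using T1n[OF True] by (intro mult_left_mono) auto
        finally show ?thesis by (simp add: mult.commute)
      qed (simp add: f_def J)
      then show "AE y in lborel. norm (f y) \<le> norm (T1 * norm (J y))" using T1pos by (intro AE_I2) simp
    qed
    moreover have "y \<notin> K \<Longrightarrow> f y = 0" for y by (simp add: f_def J)
    moreover obtain B where B: "\<forall>z\<in>H ` {d..T1}. norm z \<le> B"
      using compact_imp_bounded[OF compact_continuous_image[OF continuous_on_subset[OF H] compact_Icc[of d T1]]] d(1)
      unfolding bounded_iff by fastforce
    moreover have "\<bar>H (radius c (\<epsilon> n) y)\<bar> \<le> B" if y: "y \<in> K" for n y
    proof -
      have "d \<le> radius c (\<epsilon> n) y" using d(2)[OF y] radius_bounds(2)[OF \<epsilon>(1)] by (rule order_trans)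
      moreover have "radius c (\<epsilon> n) y \<le> T1" using T1[OF y \<epsilon>(1)[of n] \<epsilon>(2)[of n]] by simp
      ultimately show ?thesis using B by auto
    qed
    moreover have "(\<lambda>n. H (radius c (\<epsilon> n) y)) \<longlonglongrightarrow> H (norm (y - c))" if y: "y \<in> K" for y
    proof (rule isCont_tendsto_compose[OF _ radius_tendsto[OF \<epsilon>lim]])
      have "0 < norm (y - c)" using d(1) d(2)[OF y] by linarith
      then show "isCont H (norm (y - c))" using H continuous_on_eq_continuous_at[of "{0<..}" H] by auto
    qed
    ultimately have "(\<lambda>n. \<integral>y. f y * H (radius c (\<epsilon> n) y) \<partial>lborel) \<longlonglongrightarrow> (\<integral>y. f y * H (norm (y - c)) \<partial>lborel)"
      using Hm by (intro integral_limit_on_support(1)[where K = K and B = B]) auto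
    moreover have "(\<integral>y. f y * H (radius c (\<epsilon> n) y) \<partial>lborel) = 0" for n
    proof -
      note m1 = div_free_radial_moment[OF J1 \<Phi>[of n] pd[of _ n]] and m2 = div_free_radial_moment[OF J2 \<Phi>[of n] pd[of _ n]]
      have "(\<integral>y. f y * H (radius c (\<epsilon> n) y) \<partial>lborel) =
        (\<integral>y. H (radius c (\<epsilon> n) y) * (J\<^sub>1 y \<bullet> (y - c)) - H (radius c (\<epsilon> n) y) * (J\<^sub>2 y \<bullet> (y - c)) \<partial>lborel)"
      proof (rule integral_cong_AE)
        show "(\<lambda>y. f y * H (radius c (\<epsilon> n) y)) \<in> borel_measurable lborel" unfolding f_def using J(1) Hm by measurable
        show "(\<lambda>y. H (radius c (\<epsilon> n) y) * (J\<^sub>1 y \<bullet> (y - c)) - H (radius c (\<epsilon> n) y) * (J\<^sub>2 y \<bullet> (y - c))) \<in> borel_measurable lborel"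
          using m1(2) m2(2) by (intro borel_measurable_integrable Bochner_Integration.integrable_diff)
        show "AE y in lborel. f y * H (radius c (\<epsilon> n) y) = H (radius c (\<epsilon> n) y) * (J\<^sub>1 y \<bullet> (y - c)) - H (radius c (\<epsilon> n) y) * (J\<^sub>2 y \<bullet> (y - c))"
          using AEJ
        proof eventually_elim
          case (elim y)
          show ?case unfolding f_def elim unfolding inner_diff_left by algebra
        qed
      qed
      also have "\<dots> = 0" using m1 m2 by simp
      finally show ?thesis .
    qed
    ultimately have "(\<lambda>n. 0) \<longlonglongrightarrow> (\<integral>y. f y * H (norm (y - c)) \<partial>lborel)" by simp
    then show ?thesis by (simp only: LIMSEQ_const_iff f_def)
  qed
  have Pc: "continuous_on S (P n)" for S n using wave_kernel.P_cont[OF wk] .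
  have Pm: "P n \<in> borel_measurable borel" for n by (rule borel_measurable_continuous_onI[OF Pc])
  have posr: "radius c (\<epsilon> n) y > 0" for n y by (rule radius_bounds(3)[OF \<epsilon>(1)])
  have m1: "(\<integral>y. (J y \<bullet> (y - c)) * (P 1 (norm (y - c)) / norm (y - c)) \<partial>lborel) = 0"
  proof (rule mom)
    fix n
    interpret rp: radial_profile P c "\<epsilon> n" 0 by (rule rp)
    let ?\<Phi> = "\<lambda>y. P 0 (0 + radius c (\<epsilon> n) y)"
    show "test_function ?\<Phi>"
    proof (rule fun_algebra_test_function[OF rp.atoms_smooth rp.atom_profile])
      show "T1 + 1 < norm (y - c) \<Longrightarrow> P 0 (0 + radius c (\<epsilon> n) y) = 0" for y
        using radius_bounds(2)[OF \<epsilon>(1), of y c n] P(2)[of "radius c (\<epsilon> n) y" 0] by simp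
    qed
    show "pd k ?\<Phi> y = P 1 (radius c (\<epsilon> n) y) / radius c (\<epsilon> n) y * (y - c) $ k" for k y
      using rp.pd_profile[of k 0] by (simp add: divide_inverse)
  next
    show "continuous_on {0<..} (\<lambda>\<rho>. P 1 \<rho> / \<rho>)" by (intro continuous_intros Pc) auto
    show "(\<lambda>\<rho>. P 1 \<rho> / \<rho>) \<in> borel_measurable borel" using Pm[of 1] by measurable
  qed
  have m2: "(\<integral>y. (J y \<bullet> (y - c)) * (P 1 (norm (y - c)) / (norm (y - c))\<^sup>2 - P 0 (norm (y - c)) / norm (y - c) ^ 3) \<partial>lborel) = 0"
  proof (rule mom)
    fix n
    interpret rp: radial_profile P c "\<epsilon> n" 0 by (rule rp)
    let ?\<Phi> = "\<lambda>y. P 0 (0 + radius c (\<epsilon> n) y) * inverse (radius c (\<epsilon> n) y)"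
    show "test_function ?\<Phi>"
    proof (rule fun_algebra_test_function[OF rp.atoms_smooth fun_algebra.mult[OF rp.atom_profile rp.atom_inverse]])
      show "T1 + 1 < norm (y - c) \<Longrightarrow> P 0 (0 + radius c (\<epsilon> n) y) * inverse (radius c (\<epsilon> n) y) = 0" for y
        using radius_bounds(2)[OF \<epsilon>(1), of y c n] P(2)[of "radius c (\<epsilon> n) y" 0] by simp
    qed
    show "pd k ?\<Phi> y = (P 1 (radius c (\<epsilon> n) y) / (radius c (\<epsilon> n) y)\<^sup>2 - P 0 (radius c (\<epsilon> n) y) / radius c (\<epsilon> n) y ^ 3) * (y - c) $ k" for k y
      unfolding rp.pd_prod[OF rp.atom_profile rp.atom_inverse] rp.pd_profile rp.pd_inverse
      by (simp add: divide_inverse power_inverse power2_eq_square algebra_simps)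
  next
    show "continuous_on {0<..} (\<lambda>\<rho>. P 1 \<rho> / \<rho>\<^sup>2 - P 0 \<rho> / \<rho> ^ 3)" by (intro continuous_intros Pc) auto
    show "(\<lambda>\<rho>. P 1 \<rho> / \<rho>\<^sup>2 - P 0 \<rho> / \<rho> ^ 3) \<in> borel_measurable borel" using Pm[of 1] Pm[of 0] by measurable
  qed
  have k1: "J y \<bullet> (yuk \<kappa> ((norm (c - y))\<^sup>2) *\<^sub>R (c - y)) = (1 / \<kappa>) * ((J y \<bullet> (y - c)) * (P 1 (norm (y - c)) / norm (y - c)))" for y
  proof (cases "y \<in> K")
    case True
    have r: "norm (c - y) = norm (y - c)" by (rule norm_minus_commute)
    have "J y \<bullet> (c - y) = - (J y \<bullet> (y - c))" by (simp add: inner_diff_right)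
    then show ?thesis using \<kappa> P(4)[OF T1n[OF True]] unfolding inner_scaleR_right r by (simp add: yuk_def)
  qed (simp add: J)
  have k2: "J y \<bullet> (yuk' \<kappa> ((norm (c - y))\<^sup>2) *\<^sub>R (c - y)) =
     (-1/2) * ((J y \<bullet> (y - c)) * (P 1 (norm (y - c)) / (norm (y - c))\<^sup>2 - P 0 (norm (y - c)) / norm (y - c) ^ 3))" for y
  proof (cases "y \<in> K")
    case True
    have r: "norm (c - y) = norm (y - c)" by (rule norm_minus_commute)
    have pos: "norm (y - c) > 0" using d(1) d(2)[OF True] by linarith
    have "J y \<bullet> (c - y) = - (J y \<bullet> (y - c))" by (simp add: inner_diff_right)
    moreover have "yuk' \<kappa> ((norm (y - c))\<^sup>2) = (1/2) * (P 1 (norm (y - c)) / (norm (y - c))\<^sup>2 - P 0 (norm (y - c)) / norm (y - c) ^ 3)"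
      using P(4)[OF T1n[OF True]] P(3)[of "norm (y - c)"] T1n[OF True] pos
      by (simp add: yuk'_def field_simps power2_eq_square power3_eq_cube)
    ultimately show ?thesis unfolding inner_scaleR_right r by simp
  qed (simp add: J)
  show "(\<integral>y. J y \<bullet> (yuk \<kappa> ((norm (c - y))\<^sup>2) *\<^sub>R (c - y)) \<partial>lborel) = 0" by (simp only: k1 integral_mult_right_zero m1 mult_zero_right)
  show "(\<integral>y. J y \<bullet> (yuk' \<kappa> ((norm (c - y))\<^sup>2) *\<^sub>R (c - y)) \<partial>lborel) = 0" by (simp only: k2 integral_mult_right_zero m2 mult_zero_right)
qed

lemma (in wave_kernel) err_square_integrable:
  assumes "s \<ge> 0" shows "integrable lborel (\<lambda>y. (err s y)\<^sup>2)"
proof -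
  obtain C where C: "C > 0" "\<And>n t. n \<le> 2 \<Longrightarrow> t \<ge> 0 \<Longrightarrow> \<bar>P n t\<bar> \<le> C" using P_bounded by blast
  have "\<bar>err s y\<bar> \<le> C * (T\<^sup>2 + 3 * T + 3) * (\<epsilon>\<^sup>2 * inverse \<epsilon> ^ 5) * indicator (cball x0 T) y" for y
  proof -
    have "inverse (rad y) ^ 5 \<le> inverse \<epsilon> ^ 5" using r[of y] eps by (intro power_mono le_imp_inverse_le) auto
    then have "C * (T\<^sup>2 + 3 * T + 3) * (\<epsilon>\<^sup>2 * inverse (rad y) ^ 5) * indicator (cball x0 T) y
      \<le> C * (T\<^sup>2 + 3 * T + 3) * (\<epsilon>\<^sup>2 * inverse \<epsilon> ^ 5) * indicator (cball x0 T) y"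
      using C(1) T by (intro mult_right_mono mult_left_mono) auto
    then show ?thesis using err_bound[OF C assms, of y] by linarith
  qed
  then show ?thesis by (rule integrable_sq_indicator_cball(1)[OF err_measurable])
qed

lemma (in wave_kernel) continuous_on_wave:
  assumes "continuous_on S t" "continuous_on S w"
  shows "continuous_on S (\<lambda>x. wave n (t x) (w x))"
  unfolding wave_def
  by (intro continuous_intros continuous_on_compose2[OF P_cont[of UNIV]] continuous_on_compose2[OF continuous_radius[of UNIV]] assms)
    (use r(3) in \<open>auto simp: less_imp_neq[symmetric]\<close>)

text \<open>The data on \<open>\<Gamma>\<close> enter here: by Huygens' principle the cutoff of the advanced potential
  is invisible at the source, so the time-domain duality yields a static Yukawa potential.\<close>

lemma trace_limit:
  fixes J\<^sub>1 J\<^sub>2 J :: field and p q :: "real^3" and \<kappa> :: real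
  assumes F1: "maxwell_field J\<^sub>1 a g E\<^sub>1 E\<^sub>1' E\<^sub>1''" and F2: "maxwell_field J\<^sub>2 a g E\<^sub>2 E\<^sub>2' E\<^sub>2''"
    and J: "integrable lborel J" "\<And>y. y \<notin> K \<Longrightarrow> J y = 0" and K: "compact K"
    and AEJ: "AE y in lborel. J y = J\<^sub>1 y - J\<^sub>2 y"
    and a: "continuous_on {0..T} a" and g: "continuous_on {0..T} g" "\<And>t. T\<^sub>0 \<le> t \<Longrightarrow> g t = 0"
    and D: "\<And>s y. s \<in> {0..T\<^sub>0} \<Longrightarrow> y \<in> K \<Longrightarrow> norm (a s + y) \<le> D" "D < norm p"
    and T: "0 < T\<^sub>0" "T\<^sub>0 + D + norm p < T" "0 \<le> D"
    and trace: "\<And>s. 0 < s \<Longrightarrow> s < T \<Longrightarrow> \<exists>w. continuous_on UNIV w \<and> w p = 0 \<and> (AE y in lborel. w y = (E\<^sub>1 s y - E\<^sub>2 s y) \<bullet> q)"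
  shows "(\<integral>s. indicator {0..T\<^sub>0} s * (g s * exp (- \<kappa> * s) *
      (\<integral>y. J y \<bullet> (yuk \<kappa> ((norm (p - (a s + y)))\<^sup>2) *\<^sub>R q) \<partial>lborel)) \<partial>lborel) = 0"
proof -
  interpret f1: maxwell_field J\<^sub>1 a g E\<^sub>1 E\<^sub>1' E\<^sub>1'' by fact
  interpret f2: maxwell_field J\<^sub>2 a g E\<^sub>2 E\<^sub>2' E\<^sub>2'' by fact
  have T0T: "0 < T" "T\<^sub>0 \<le> T" using T norm_ge_zero[of p] by linarith+
  \<comment> \<open>The value \<open>T\<^sub>0 + D + norm p\<close> bounds
    \<open>s + norm (y + a s - p)\<close> over the source while it is active, so the kernel is
    exactly exponential there.\<close>
  obtain P where P: "derivative_tower P" "\<And>n t. T < t \<Longrightarrow> P n t = 0"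
    "\<And>t. t \<le> T\<^sub>0 + D + norm p \<Longrightarrow> P 0 t = exp (- \<kappa> * t)"
    using cutoff_tower[OF T(2), of \<kappa>] by metis
  have wk: "wave_kernel P \<epsilon> T" if "\<epsilon> > 0" for \<epsilon> by unfold_locales (use P that T0T in auto)
  define \<epsilon> where "\<epsilon> n = 1 / (real n + 1)" for n
  have \<epsilon>: "\<epsilon> n > 0" for n by (auto simp: \<epsilon>_def)
  have \<epsilon>lim: "\<epsilon> \<longlonglongrightarrow> 0" unfolding \<epsilon>_def by real_asymp
  define wave where "wave n = wave_kernel.wave P p (\<epsilon> n)" for n
  define err where "err n = wave_kernel.err P p (\<epsilon> n)" for n
  have w1: "wave_kernel P 1 T" by (rule wk) simp
  obtain C where C: "C > 0" "\<And>n t. n \<le> 2 \<Longrightarrow> t \<ge> 0 \<Longrightarrow> \<bar>P n t\<bar> \<le> C"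
    using wave_kernel.P_bounded[OF w1] by blast
  obtain G where "\<forall>z\<in>g ` {0..T}. norm z \<le> G"
    using compact_imp_bounded[OF compact_continuous_image[OF g(1) compact_Icc]] unfolding bounded_iff by blast
  then have G: "\<bar>g s\<bar> \<le> G" if "s \<in> {0..T}" for s using that by auto
  define f where "f y = J y \<bullet> q" for y
  have f: "integrable lborel f" "\<And>y. y \<notin> K \<Longrightarrow> f y = 0" using J by (auto simp: f_def[abs_def])
  have wm: "wave n 0 s \<in> borel_measurable borel" and em: "err n s \<in> borel_measurable borel" for n s
    unfolding wave_def err_def by (rule wave_kernel.wave_measurable[OF wk[OF \<epsilon>]], rule wave_kernel.err_measurable[OF wk[OF \<epsilon>]])
  \<comment> \<open>\<open>S\<close> is the source side of the duality, translated to the fixed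
    profile; \<open>N\<close> is the data side, where the kernels concentrate at
    \<open>p\<close>.\<close>
  define S where "S n s = g s * (\<integral>y. f y * wave n 0 s (y + a s) \<partial>lborel)" for n s
  define N where "N n s = (\<integral>y. err n s y * (E\<^sub>1 s y \<bullet> q) \<partial>lborel) - (\<integral>y. err n s y * (E\<^sub>2 s y \<bullet> q) \<partial>lborel)" for n s
  have JL: "J\<^sub>1 \<in> L2" "J\<^sub>2 \<in> L2" by (rule f1.JL, rule f2.JL)
  have source: "(\<integral>y. wave n 0 s y * (J\<^sub>1 (y - a s) \<bullet> q) \<partial>lborel) - (\<integral>y. wave n 0 s y * (J\<^sub>2 (y - a s) \<bullet> q) \<partial>lborel)
      = (\<integral>y. f y * wave n 0 s (y + a s) \<partial>lborel)" if s: "s \<ge> 0" for n s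
  proof -
    have sq: "integrable lborel (\<lambda>y. (wave n 0 s y)\<^sup>2)"
      unfolding wave_def by (rule wave_kernel.wave_norm(1)[OF wk[OF \<epsilon>] C _ s]) simp_all
    have i: "integrable lborel (\<lambda>y. wave n 0 s y * (u (y - a s) \<bullet> q))" if "u \<in> L2" for u
      by (rule L2_pairing(1)[OF L2_translate(1)[OF that] wm sq])
    have m: "J\<^sub>1 \<in> borel_measurable borel" "J\<^sub>2 \<in> borel_measurable borel" using JL L2_measurable by auto
    have "(\<integral>y. wave n 0 s y * (J\<^sub>1 (y - a s) \<bullet> q) \<partial>lborel) - (\<integral>y. wave n 0 s y * (J\<^sub>2 (y - a s) \<bullet> q) \<partial>lborel)
       = (\<integral>y. wave n 0 s y * (J\<^sub>1 (y - a s) \<bullet> q) - wave n 0 s y * (J\<^sub>2 (y - a s) \<bullet> q) \<partial>lborel)"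
      by (rule Bochner_Integration.integral_diff[OF i[OF JL(1)] i[OF JL(2)], symmetric])
    also have "\<dots> = (\<integral>y. wave n 0 s (y + a s) * (J\<^sub>1 y \<bullet> q) - wave n 0 s (y + a s) * (J\<^sub>2 y \<bullet> q) \<partial>lborel)"
    proof -
      have "(\<lambda>y. wave n 0 s y * (J\<^sub>1 (y - a s) \<bullet> q) - wave n 0 s y * (J\<^sub>2 (y - a s) \<bullet> q)) \<in> borel_measurable borel"
        using m wm[of n s] by measurable
      from integral_translate[OF this, of "a s"] show ?thesis by simp
    qed
    also have "\<dots> = (\<integral>y. f y * wave n 0 s (y + a s) \<partial>lborel)"
    proof (rule integral_cong_AE)
      show "(\<lambda>y. wave n 0 s (y + a s) * (J\<^sub>1 y \<bullet> q) - wave n 0 s (y + a s) * (J\<^sub>2 y \<bullet> q)) \<in> borel_measurable lborel"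
        using m wm[of n s] by measurable
      show "(\<lambda>y. f y * wave n 0 s (y + a s)) \<in> borel_measurable lborel" using f(1) wm[of n s] by measurable
      show "AE y in lborel. wave n 0 s (y + a s) * (J\<^sub>1 y \<bullet> q) - wave n 0 s (y + a s) * (J\<^sub>2 y \<bullet> q) = f y * wave n 0 s (y + a s)"
        using AEJ
      proof eventually_elim
        case (elim y)
        show ?case unfolding f_def elim unfolding inner_diff_left by algebra
      qed
    qed
    finally show ?thesis .
  qed
  have SN: "((\<lambda>s. S n s - N n s) has_integral 0) {0..T}" for n
  proof -
    note h1 = f1.duality[OF wk[OF \<epsilon>[of n]], where v = q and p = p] and h2 = f2.duality[OF wk[OF \<epsilon>[of n]], where v = q and p = p]
    have "((\<lambda>s. (g s * (\<integral>y. wave n 0 s y * (J\<^sub>1 (y - a s) \<bullet> q) \<partial>lborel) - (\<integral>y. err n s y * (E\<^sub>1 s y \<bullet> q) \<partial>lborel))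
       - (g s * (\<integral>y. wave n 0 s y * (J\<^sub>2 (y - a s) \<bullet> q) \<partial>lborel) - (\<integral>y. err n s y * (E\<^sub>2 s y \<bullet> q) \<partial>lborel))) has_integral (0 - 0)) {0..T}"
      unfolding wave_def err_def by (rule has_integral_diff[OF h1 h2])
    then have "((\<lambda>s. S n s - N n s) has_integral (0 - 0)) {0..T}"
    proof (rule has_integral_eq[rotated])
      fix s assume "s \<in> {0..T}"
      then have "s \<ge> 0" by simp
      from source[OF this, of n, symmetric]
      show "(g s * (\<integral>y. wave n 0 s y * (J\<^sub>1 (y - a s) \<bullet> q) \<partial>lborel) - (\<integral>y. err n s y * (E\<^sub>1 s y \<bullet> q) \<partial>lborel))
       - (g s * (\<integral>y. wave n 0 s y * (J\<^sub>2 (y - a s) \<bullet> q) \<partial>lborel) - (\<integral>y. err n s y * (E\<^sub>2 s y \<bullet> q) \<partial>lborel)) = S n s - N n s"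
        unfolding S_def N_def by (simp add: right_diff_distrib)
    qed
    then show ?thesis by simp
  qed
  have Sint: "S n integrable_on {0..T}" for n
  proof -
    have "continuous_on ({0..T} \<times> K) (\<lambda>(s, y). wave n 0 s (y + a s))"
      unfolding case_prod_beta wave_def
      by (intro wave_kernel.continuous_on_wave[OF wk[OF \<epsilon>]] continuous_intros continuous_on_compose2[OF a]) auto
    from continuous_on_source[OF f(1) f(2) K this]
    have "continuous_on {0..T} (\<lambda>s. \<integral>y. f y * wave n 0 s (y + a s) \<partial>lborel)" by simp
    then have "continuous_on {0..T} (S n)" unfolding S_def[abs_def] by (intro continuous_intros g(1))
    then show ?thesis by (rule integrable_continuous_real)
  qed
  have Nint: "N n integrable_on {0..T}" and SNeq: "integral {0..T} (S n) = integral {0..T} (N n)" for n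
  proof -
    have i: "(\<lambda>s. S n s - N n s) integrable_on {0..T}" using SN[of n] by blast
    have "(\<lambda>s. S n s - (S n s - N n s)) integrable_on {0..T}" by (rule integrable_diff[OF Sint i])
    then show ni: "N n integrable_on {0..T}" by simp
    have "integral {0..T} (\<lambda>s. S n s - N n s) = 0" using SN[of n] by (rule integral_unique)
    then show "integral {0..T} (S n) = integral {0..T} (N n)" using integral_diff[OF Sint ni] by simp
  qed
  have ej: "integrable lborel (\<lambda>y. err n s y * (u y \<bullet> q))" if "u \<in> L2" "s \<ge> 0" for n s and u :: field
    using wave_kernel.err_square_integrable[OF wk[OF \<epsilon>] that(2)]
    unfolding err_def by (intro L2_pairing(1)[OF that(1)] wave_kernel.err_measurable[OF wk[OF \<epsilon>]])
  have Nlim: "(\<lambda>n. N n s) \<longlonglongrightarrow> 0" if s: "s \<in> {0..T}" for s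
  proof -
    \<comment> \<open>At time 0 the fields vanish by the initial data and at time \<open>T\<close>
      the kernel has been cut off; in between, the trace condition supplies a continuous
      representative that vanishes at \<open>p\<close>.\<close>
    consider "s = 0" | "s = T" | "0 < s" "s < T" using s by fastforce
    then show ?thesis
    proof cases
      case 1
      have "(\<integral>y. h y * (w y \<bullet> q) \<partial>lborel) = 0" if "AE y in lborel. w y = 0" for h and w :: field
        by (rule integral_eq_zero_AE) (use that in eventually_elim, simp)
      then show ?thesis using f1.init(1) f2.init(1) by (simp add: N_def 1)
    next
      case 2
      have "err n T y = 0" for n y
        unfolding err_def wave_kernel.err_def[OF wk[OF \<epsilon>]]
        using P(2)[of "T + radius p (\<epsilon> n) y"] radius_bounds(3)[OF \<epsilon>, of p n y] by simp
      then show ?thesis by (simp add: N_def 2)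
    next
      case 3
      obtain w where w: "continuous_on UNIV w" "w p = 0" "AE y in lborel. w y = (E\<^sub>1 s y - E\<^sub>2 s y) \<bullet> q"
        using trace[OF 3] by blast
      have Neq: "N n s = (\<integral>y. err n s y * w y \<partial>lborel)" for n
      proof -
        have EL: "E\<^sub>1 s \<in> L2" "E\<^sub>2 s \<in> L2" using f1.fields_L2(1)[of s] f2.fields_L2(1)[of s] 3 by auto
        have i: "integrable lborel (\<lambda>y. err n s y * (E\<^sub>1 s y \<bullet> q))" "integrable lborel (\<lambda>y. err n s y * (E\<^sub>2 s y \<bullet> q))"
          using ej[OF EL(1)] ej[OF EL(2)] 3 by auto
        have "N n s = (\<integral>y. err n s y * (E\<^sub>1 s y \<bullet> q) - err n s y * (E\<^sub>2 s y \<bullet> q) \<partial>lborel)"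
          unfolding N_def by (rule Bochner_Integration.integral_diff[OF i, symmetric])
        also have "\<dots> = (\<integral>y. err n s y * w y \<partial>lborel)"
        proof (rule integral_cong_AE)
          show "(\<lambda>y. err n s y * (E\<^sub>1 s y \<bullet> q) - err n s y * (E\<^sub>2 s y \<bullet> q)) \<in> borel_measurable lborel"
            using i by (intro borel_measurable_integrable Bochner_Integration.integrable_diff)
          show "(\<lambda>y. err n s y * w y) \<in> borel_measurable lborel"
            using em[of n s] borel_measurable_continuous_onI[OF w(1)] by measurable
          show "AE y in lborel. err n s y * (E\<^sub>1 s y \<bullet> q) - err n s y * (E\<^sub>2 s y \<bullet> q) = err n s y * w y"
            using w(3) by eventually_elim (simp add: inner_diff_left right_diff_distrib)
        qed
        finally show ?thesis .
      qed
      show ?thesis unfolding Neq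
      proof (rule approximate_identity_limit[OF \<epsilon> \<epsilon>lim w(1,2) em])
        show "\<bar>err n s y\<bar> \<le> C * (T\<^sup>2 + 3 * T + 3) * ((\<epsilon> n)\<^sup>2 * inverse (radius p (\<epsilon> n) y) ^ 5) * indicator (cball p T) y" for n y
          unfolding err_def by (rule wave_kernel.err_bound[OF wk[OF \<epsilon>] C]) (use 3 in auto)
        show "0 < C * (T\<^sup>2 + 3 * T + 3)" using C(1) T0T by (intro mult_pos_pos) (auto intro: add_nonneg_pos)
      qed
    qed
  qed
  \<comment> \<open>Bounds uniform in \<epsilon> and in time, so that the pointwise limit of
    \<open>N\<close> can be integrated over time.\<close>
  obtain B1 where B1: "\<And>e s. e > 0 \<Longrightarrow> s \<in> {0..T} \<Longrightarrow> \<bar>\<integral>y. wave_kernel.err P p e s y * (E\<^sub>1 s y \<bullet> q) \<partial>lborel\<bar> \<le> B1"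
    using f1.err_pairing_bounded[OF wk g(1), of p q] by blast
  obtain B2 where B2: "\<And>e s. e > 0 \<Longrightarrow> s \<in> {0..T} \<Longrightarrow> \<bar>\<integral>y. wave_kernel.err P p e s y * (E\<^sub>2 s y \<bullet> q) \<partial>lborel\<bar> \<le> B2"
    using f2.err_pairing_bounded[OF wk g(1), of p q] by blast
  have "(\<lambda>n. integral {0..T} (N n)) \<longlonglongrightarrow> integral {0..T} (\<lambda>s. 0)"
  proof (rule dominated_convergence(2)[where h = "\<lambda>_. B1 + B2"])
    show "norm (N n s) \<le> B1 + B2" if "s \<in> {0..T}" for n s
      using B1[OF \<epsilon> that, of n] B2[OF \<epsilon> that, of n] unfolding N_def err_def by simp
  qed (use Nint Nlim in auto)
  then have S0: "(\<lambda>n. integral {0..T} (S n)) \<longlonglongrightarrow> 0" by (simp add: SNeq)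
  define Y where "Y s = (\<integral>y. f y * yuk \<kappa> ((norm (p - (a s + y)))\<^sup>2) \<partial>lborel)" for s
  define L where "L s = g s * (exp (- \<kappa> * s) * Y s)" for s
  define d where "d = norm p - D"
  have d: "d > 0" using D(2) by (simp add: d_def)
  have flip: "norm (p - (a s + y)) = norm (y + a s - p)" for s y
    using norm_minus_commute[of p "a s + y"] by (simp add: add.commute)
  have far: "d \<le> norm (y + a s - p)" "norm (y + a s - p) \<le> D + norm p" if "y \<in> K" "s \<in> {0..T\<^sub>0}" for y s
  proof -
    have "norm p - norm (a s + y) \<le> norm (p - (a s + y))" by (rule norm_triangle_ineq2)
    then show "d \<le> norm (y + a s - p)" unfolding flip using D(1)[OF that(2,1)] by (simp add: d_def)
    have "norm (y + a s - p) \<le> norm (y + a s) + norm p" by (rule norm_triangle_ineq4)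
    then show "norm (y + a s - p) \<le> D + norm p" using D(1)[OF that(2,1)] by (simp add: add.commute)
  qed
  \<comment> \<open>While the source is active its support keeps distance at least \<open>d\<close>
    from \<open>p\<close>, so the regularized kernels are bounded by C / d and converge; after
    \<open>T\<^sub>0\<close> the factor \<open>g\<close> vanishes.\<close>
  have Slim: "(\<lambda>n. S n s) \<longlonglongrightarrow> L s \<and> (\<forall>n. \<bar>S n s\<bar> \<le> G * ((\<integral>y. \<bar>f y\<bar> \<partial>lborel) * (C / d)))" if s: "s \<in> {0..T}" for s
  proof (cases "s \<le> T\<^sub>0")
    case False
    have "G \<ge> 0" using order_trans[OF abs_ge_zero G[OF s]] .
    then show ?thesis using g(2)[of s] False C d by (simp add: S_def L_def)
  next
    case True
    then have s0: "s \<in> {0..T\<^sub>0}" "s \<ge> 0" using s by auto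
    have b: "\<bar>wave n 0 s (y + a s)\<bar> \<le> C / d" if y: "y \<in> K" for n y
    proof -
      let ?r = "radius p (\<epsilon> n) (y + a s)"
      have r: "d \<le> ?r" using far(1)[OF y s0(1)] radius_bounds(2)[OF \<epsilon>] by (rule order_trans)
      have "\<bar>wave n 0 s (y + a s)\<bar> = \<bar>P 0 (s + ?r)\<bar> / ?r"
        using r d by (simp add: wave_def wave_kernel.wave_def[OF wk[OF \<epsilon>]] abs_mult divide_inverse)
      also have "\<dots> \<le> C / d" using C(2)[of 0 "s + ?r"] r d s0 by (intro frac_le) auto
      finally show ?thesis .
    qed
    have l: "(\<lambda>n. wave n 0 s (y + a s)) \<longlonglongrightarrow> exp (- \<kappa> * s) * yuk \<kappa> ((norm (p - (a s + y)))\<^sup>2)" if y: "y \<in> K" for y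
    proof -
      let ?n = "norm (y + a s - p)"
      have "(\<lambda>n. P 0 (s + radius p (\<epsilon> n) (y + a s))) \<longlonglongrightarrow> P 0 (s + ?n)"
        using wave_kernel.P_cont[OF w1, of UNIV 0] continuous_on_eq_continuous_at[of UNIV "P 0"]
        by (intro isCont_tendsto_compose[where g = "P 0"] tendsto_intros radius_tendsto[OF \<epsilon>lim]) auto
      moreover have "P 0 (s + ?n) = exp (- \<kappa> * (s + ?n))" using far(2)[OF y s0(1)] s0 by (intro P(3)) auto
      moreover have "?n \<noteq> 0" using far(1)[OF y s0(1)] d by linarith
      ultimately have "(\<lambda>n. P 0 (s + radius p (\<epsilon> n) (y + a s)) * inverse (radius p (\<epsilon> n) (y + a s))) \<longlonglongrightarrow> exp (- \<kappa> * (s + ?n)) * inverse ?n"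
        by (intro tendsto_intros radius_tendsto[OF \<epsilon>lim]) auto
      moreover have "exp (- \<kappa> * (s + ?n)) * inverse ?n = exp (- \<kappa> * s) * yuk \<kappa> ((norm (p - (a s + y)))\<^sup>2)"
        unfolding flip by (simp add: yuk_def divide_inverse distrib_left flip: exp_add)
      ultimately show ?thesis by (simp add: wave_def wave_kernel.wave_def[OF wk[OF \<epsilon>]])
    qed
    have m1: "(\<lambda>y. wave n 0 s (y + a s)) \<in> borel_measurable borel" for n using wm[of n s] by measurable
    have m2: "(\<lambda>y. exp (- \<kappa> * s) * yuk \<kappa> ((norm (p - (a s + y)))\<^sup>2)) \<in> borel_measurable borel" unfolding yuk_def by measurable
    have lim1: "(\<lambda>n. \<integral>y. f y * wave n 0 s (y + a s) \<partial>lborel) \<longlonglongrightarrow> (\<integral>y. f y * (exp (- \<kappa> * s) * yuk \<kappa> ((norm (p - (a s + y)))\<^sup>2)) \<partial>lborel)"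
      by (rule integral_limit_on_support(1)[where K = K, OF f(1) _ m1 m2 l b]) (rule f(2))
    have lim2: "\<bar>\<integral>y. f y * wave n 0 s (y + a s) \<partial>lborel\<bar> \<le> (\<integral>y. \<bar>f y\<bar> \<partial>lborel) * (C / d)" for n
      by (rule integral_limit_on_support(2)[where K = K, OF f(1) _ m1 m2 l b]) (rule f(2))
    have "(\<lambda>n. \<integral>y. f y * wave n 0 s (y + a s) \<partial>lborel) \<longlonglongrightarrow> (\<integral>y. exp (- \<kappa> * s) * (f y * yuk \<kappa> ((norm (p - (a s + y)))\<^sup>2)) \<partial>lborel)"
      using lim1 by (simp add: mult_ac)
    then have "(\<lambda>n. \<integral>y. f y * wave n 0 s (y + a s) \<partial>lborel) \<longlonglongrightarrow> exp (- \<kappa> * s) * Y s" by (simp add: Y_def)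
    then have "(\<lambda>n. S n s) \<longlonglongrightarrow> L s" unfolding S_def L_def by (intro tendsto_intros)
    moreover have "\<bar>S n s\<bar> \<le> G * ((\<integral>y. \<bar>f y\<bar> \<partial>lborel) * (C / d))" for n
      unfolding S_def abs_mult using G[OF s] lim2[of n] order_trans[OF abs_ge_zero G[OF s]] by (intro mult_mono) auto
    ultimately show ?thesis by blast
  qed
  have conv: "L integrable_on {0..T}" "(\<lambda>n. integral {0..T} (S n)) \<longlonglongrightarrow> integral {0..T} L"
    by (rule dominated_convergence[where f = S and h = "\<lambda>_. G * ((\<integral>y. \<bar>f y\<bar> \<partial>lborel) * (C / d))"]; use Sint Slim in auto)+
  then have "integral {0..T} L = 0" using S0 LIMSEQ_unique by blast
  moreover have "integral {0..T\<^sub>0} L + integral {T\<^sub>0..T} L = integral {0..T} L"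
    using T T0T conv(1) by (intro Henstock_Kurzweil_Integration.integral_combine) auto
  moreover have "integral {T\<^sub>0..T} L = integral {T\<^sub>0..T} (\<lambda>_. 0)"
    by (rule integral_cong) (simp add: L_def g(2))
  ultimately have L0: "integral {0..T\<^sub>0} L = 0" by simp
  have cL: "continuous_on {0..T\<^sub>0} L"
  proof -
    have pos: "0 < (norm (p - (a s + y)))\<^sup>2" if "s \<in> {0..T\<^sub>0}" "y \<in> K" for s y
      unfolding flip using far(1)[OF that(2,1)] d by (intro zero_less_power) linarith
    have a0: "continuous_on {0..T\<^sub>0} a" using a by (rule continuous_on_subset) (use T0T in auto)
    have "continuous_on ({0..T\<^sub>0} \<times> K) (\<lambda>(s, y). yuk \<kappa> ((norm (p - (a s + y)))\<^sup>2))"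
      unfolding case_prod_beta
    proof (rule continuous_on_yuk(1))
      show "continuous_on ({0..T\<^sub>0} \<times> K) (\<lambda>x. (norm (p - (a (fst x) + snd x)))\<^sup>2)"
        by (intro continuous_intros continuous_on_compose2[OF a0]) auto
      show "0 < (norm (p - (a (fst x) + snd x)))\<^sup>2" if "x \<in> {0..T\<^sub>0} \<times> K" for x
        by (rule pos) (use that in auto)
    qed
    from continuous_on_source[OF f(1) f(2) K this] have "continuous_on {0..T\<^sub>0} Y" unfolding Y_def by simp
    moreover have "continuous_on {0..T\<^sub>0} g" using g(1) by (rule continuous_on_subset) (use T0T in auto)
    ultimately show ?thesis unfolding L_def[abs_def] by (intro continuous_intros)
  qed
  have "(LINT s:{0..T\<^sub>0}|lborel. L s) = integral {0..T\<^sub>0} L"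
    by (rule set_borel_integral_eq_integral(2)[OF borel_integrable_atLeastAtMost'[OF cL]])
  then have "(\<integral>s. indicator {0..T\<^sub>0} s * L s \<partial>lborel) = 0" using L0 by (simp add: set_lebesgue_integral_def)
  moreover have "(\<integral>y. J y \<bullet> (yuk \<kappa> ((norm (p - (a s + y)))\<^sup>2) *\<^sub>R q) \<partial>lborel) = Y s" for s
    unfolding Y_def f_def by (simp add: mult.commute)
  ultimately show ?thesis unfolding L_def by (simp add: mult.assoc)
qed

section \<open>Uniqueness of the source profile\<close>

lemma C1_halfline_continuous:
  assumes "C1_halfline f" shows "continuous_on {0..} f"
proof -
  obtain f' where "\<And>t. t \<ge> 0 \<Longrightarrow> (f has_vector_derivative f' t) (at t within {0..})"
    using assms by (auto simp: C1_halfline_def)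
  then show ?thesis
    unfolding continuous_on_eq_continuous_within by (meson atLeast_iff has_vector_derivative_continuous)
qed

theorem theorem3p1:
  fixes Rhat R\<^sub>1 T\<^sub>0 R T :: real
    and \<Gamma> :: "(real^3) set"
    and a :: "real \<Rightarrow> real^3"
    and g :: "real \<Rightarrow> real"
    and J\<^sub>1 J\<^sub>2 :: "real^3 \<Rightarrow> real^3"
    and E\<^sub>1 E\<^sub>2 :: "real \<Rightarrow> real^3 \<Rightarrow> real^3"
  assumes "Rhat > 0" and "R\<^sub>1 > 0" and "T\<^sub>0 > 0"
    and "R > Rhat + R\<^sub>1"
    and "T = T\<^sub>0 + Rhat + R\<^sub>1 + R"
    and "openin (top_of_set (sphere 0 R)) \<Gamma>" and "sphere_area R \<Gamma> > 0"
    and "C1_halfline a" and "\<forall>t\<ge>0. norm (a t) < R\<^sub>1"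
    and "C1_halfline g" and "\<forall>t. t \<ge> T\<^sub>0 \<or> t \<le> 0 \<longrightarrow> g t = 0"
    and "integral {0..T\<^sub>0} g \<noteq> 0"
    and "J\<^sub>1 \<in> H2" and "compactly_supported_in (ball 0 Rhat) J\<^sub>1"
    and "AE x in lborel. weak_div J\<^sub>1 x = 0"
    and "J\<^sub>2 \<in> H2" and "compactly_supported_in (ball 0 Rhat) J\<^sub>2"
    and "AE x in lborel. weak_div J\<^sub>2 x = 0"
    and "maxwell_solution J\<^sub>1 a g E\<^sub>1"
    and "maxwell_solution J\<^sub>2 a g E\<^sub>2"
    and "\<forall>t\<in>{0<..<T}. same_tangential_trace \<Gamma> (\<lambda>x. (1 / R) *\<^sub>R x) (E\<^sub>1 t) (E\<^sub>2 t)"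
  shows "AE x in lborel. J\<^sub>1 x = J\<^sub>2 x"
proof -
  have R: "R > 0" and T0T: "T\<^sub>0 < T" using assms by auto
  note J1 = assms(13,15) and J2 = assms(16,18)
  obtain K\<^sub>1 where K1: "compact K\<^sub>1" "K\<^sub>1 \<subseteq> ball 0 Rhat" "AE x in lborel. x \<notin> K\<^sub>1 \<longrightarrow> J\<^sub>1 x = 0"
    using assms(14) by (auto simp: compactly_supported_in_def)
  obtain K\<^sub>2 where K2: "compact K\<^sub>2" "K\<^sub>2 \<subseteq> ball 0 Rhat" "AE x in lborel. x \<notin> K\<^sub>2 \<longrightarrow> J\<^sub>2 x = 0"
    using assms(17) by (auto simp: compactly_supported_in_def)
  \<comment> \<open>The origin is inserted to make \<open>K\<close> nonempty, so that a point
    \<open>y0\<close> of maximal norm exists.\<close>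
  define K where "K = insert 0 (K\<^sub>1 \<union> K\<^sub>2)"
  have K: "compact K" "K \<subseteq> ball 0 Rhat" "K \<noteq> {}" using K1 K2 assms(1) by (auto simp: K_def intro!: compact_insert compact_Un)
  define J where "J y = indicator K y *\<^sub>R (J\<^sub>1 y - J\<^sub>2 y)" for y
  have loc: "locally_integrable u" if "u \<in> H2" for u
    using weak_deriv_works[OF that, of "[1]"] by (simp add: has_weak_deriv_def)
  have Ji: "integrable lborel J"
  proof -
    have "integrable lborel (\<lambda>y. indicator K y *\<^sub>R J\<^sub>1 y)" "integrable lborel (\<lambda>y. indicator K y *\<^sub>R J\<^sub>2 y)"
      using loc[OF J1(1)] loc[OF J2(1)] K(1) by (auto simp: locally_integrable_def set_integrable_def)
    then show ?thesis unfolding J_def[abs_def] scaleR_diff_right by (rule Bochner_Integration.integrable_diff)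
  qed
  have J0: "J y = 0" if "y \<notin> K" for y using that by (simp add: J_def)
  have AEJ: "AE y in lborel. J y = J\<^sub>1 y - J\<^sub>2 y"
    using K1(3) K2(3) by eventually_elim (auto simp: J_def K_def indicator_def)
  have aC: "continuous_on {0..} a" and gC: "continuous_on {0..} g"
    using assms(8,10) by (auto intro: C1_halfline_continuous)
  have a: "continuous_on {0..t} a" and g: "continuous_on {0..t} g" for t
    using aC gC by (auto elim!: continuous_on_subset)
  obtain y0 where y0: "y0 \<in> K" "\<And>y. y \<in> K \<Longrightarrow> norm y \<le> norm y0"
    using continuous_attains_sup[OF K(1,3), of norm] by (auto intro: continuous_intros)
  obtain s0 where s0: "s0 \<in> {0..T\<^sub>0}" "\<And>s. s \<in> {0..T\<^sub>0} \<Longrightarrow> norm (a s) \<le> norm (a s0)"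
    using continuous_attains_sup[OF compact_Icc _ continuous_on_norm[OF a], of T\<^sub>0] assms(3) by fastforce
  \<comment> \<open>Both maxima are attained, at \<open>s0\<close> and \<open>y0\<close>, so
    \<open>D\<close> is strictly below \<open>Rhat + R\<^sub>1\<close>. This strictness is the gap
    between \<open>T\<^sub>0 + D + R\<close> and \<open>T\<close> in which the profile is cut
    off.\<close>
  define D where "D = norm (a s0) + norm y0"
  have D: "norm (a s + y) \<le> D" if "s \<in> {0..T\<^sub>0}" "y \<in> K" for s y
    using norm_triangle_ineq[of "a s" y] y0(2)[OF that(2)] s0(2)[OF that(1)] by (simp add: D_def)
  have "norm y0 < Rhat" using y0(1) K(2) by auto
  moreover have "norm (a s0) < R\<^sub>1" using assms(9) s0(1) by auto
  ultimately have DR: "0 \<le> D" "D < R" "T\<^sub>0 + D + R < T" using assms(4,5) by (auto simp: D_def)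
  have "\<Gamma> \<noteq> {}"
  proof
    assume "\<Gamma> = {}"
    then have "sphere_area R \<Gamma> = 0" by (simp add: sphere_area_def)
    then show False using assms(7) by simp
  qed
  obtain E\<^sub>1' E\<^sub>1'' where F1: "maxwell_field J\<^sub>1 a g E\<^sub>1 E\<^sub>1' E\<^sub>1''"
    using assms(19) J1 unfolding maxwell_solution_def maxwell_field_def by blast
  obtain E\<^sub>2' E\<^sub>2'' where F2: "maxwell_field J\<^sub>2 a g E\<^sub>2 E\<^sub>2' E\<^sub>2''"
    using assms(20) J2 unfolding maxwell_solution_def maxwell_field_def by blast
  have "AE y in lborel. J y = 0"
  proof (rule static_uniqueness[OF assms(3) K(1) Ji J0 a g D DR(1,2) s0(2) assms(6) \<open>\<Gamma> \<noteq> {}\<close>])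
    show "(\<integral>s. indicator {0..T\<^sub>0} s * g s \<partial>lborel) \<noteq> 0"
      using set_borel_integral_eq_integral(2)[OF borel_integrable_atLeastAtMost'[OF g[of T\<^sub>0]]] assms(12)
      by (simp add: set_lebesgue_integral_def)
  next
    fix \<kappa> :: real and x u v :: "real^3" assume \<kappa>: "\<kappa> > 0" and x: "x \<in> \<Gamma>"
    have nx: "norm x = R" using x assms(6) by (auto simp: openin_open)
    \<comment> \<open>This is the double cross product of \<open>x\<close> with
      \<open>cross3 u v\<close>, hence tangent to the sphere; pairing a field with it is pairing the
      cross product of the field and \<open>x\<close> with \<open>cross3 u v\<close>, which the data
      determine.\<close>
    let ?q = "(x \<bullet> v) *\<^sub>R u - (x \<bullet> u) *\<^sub>R v"
    show "(\<integral>s. indicator {0..T\<^sub>0} s * (g s * exp (- \<kappa> * s) *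
         (\<integral>y. J y \<bullet> (yuk \<kappa> ((norm (x - (a s + y)))\<^sup>2) *\<^sub>R ?q) \<partial>lborel)) \<partial>lborel) = 0"
    proof (rule trace_limit[OF F1 F2 Ji J0 K(1) AEJ a g _ D])
      show "T\<^sub>0 \<le> t \<Longrightarrow> g t = 0" for t using assms(11) by blast
      show "D < norm x" "0 < T\<^sub>0" "T\<^sub>0 + D + norm x < T" "0 \<le> D" using DR assms(3) nx by auto
      fix s assume s: "0 < s" "s < T"
      then have "same_tangential_trace \<Gamma> (\<lambda>x. (1 / R) *\<^sub>R x) (E\<^sub>1 s) (E\<^sub>2 s)" using assms(21) by simp
      then obtain w\<^sub>1 w\<^sub>2 where w: "continuous_rep (E\<^sub>1 s) w\<^sub>1" "continuous_rep (E\<^sub>2 s) w\<^sub>2"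
        "cross3 (w\<^sub>1 x) ((1 / R) *\<^sub>R x) = cross3 (w\<^sub>2 x) ((1 / R) *\<^sub>R x)"
        using x unfolding same_tangential_trace_def by blast
      let ?w = "\<lambda>y. (w\<^sub>1 y - w\<^sub>2 y) \<bullet> ?q"
      have "cross3 (w\<^sub>1 x - w\<^sub>2 x) x = 0"
        using w(3) R by (simp add: cross_mult_right Cross3.left_diff_distrib)
      moreover have "?w x = cross3 (w\<^sub>1 x - w\<^sub>2 x) x \<bullet> cross3 u v"
        unfolding dot_cross by (simp add: inner_diff_right algebra_simps)
      ultimately have "?w x = 0" by simp
      moreover have "continuous_on UNIV ?w" using w by (auto simp: continuous_rep_def intro!: continuous_intros)
      moreover have "AE y in lborel. w\<^sub>1 y = E\<^sub>1 s y" "AE y in lborel. w\<^sub>2 y = E\<^sub>2 s y"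
        using w by (auto simp: continuous_rep_def)
      then have "AE y in lborel. ?w y = (E\<^sub>1 s y - E\<^sub>2 s y) \<bullet> ?q" by eventually_elim simp
      ultimately show "\<exists>w. continuous_on UNIV w \<and> w x = 0 \<and> (AE y in lborel. w y = (E\<^sub>1 s y - E\<^sub>2 s y) \<bullet> ?q)" by blast
    qed
  next
    fix \<kappa> s :: real and x :: "real^3" assume \<kappa>: "\<kappa> > 0" and s: "s \<in> {0..T\<^sub>0}" and x: "D < norm x"
    have d: "norm x - D \<le> norm (y - (x - a s))" if "y \<in> K" for y
      using norm_triangle_ineq2[of x "a s + y"] D[OF s that] norm_minus_commute[of x "a s + y"]
      by (simp add: algebra_simps)
    have d0: "0 < norm x - D" using x by simp
    have m: "(\<integral>y. J y \<bullet> (yuk \<kappa> ((norm ((x - a s) - y))\<^sup>2) *\<^sub>R ((x - a s) - y)) \<partial>lborel) = 0"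
      "(\<integral>y. J y \<bullet> (yuk' \<kappa> ((norm ((x - a s) - y))\<^sup>2) *\<^sub>R ((x - a s) - y)) \<partial>lborel) = 0"
      by (rule div_free_kernel_moments[OF J1 J2 Ji _ K(1) AEJ d0 _ \<kappa>], erule J0, erule d)+
    show "(\<integral>y. J y \<bullet> (yuk \<kappa> ((norm (x - (a s + y)))\<^sup>2) *\<^sub>R (x - (a s + y))) \<partial>lborel) = 0"
      "(\<integral>y. J y \<bullet> (yuk' \<kappa> ((norm (x - (a s + y)))\<^sup>2) *\<^sub>R (x - (a s + y))) \<partial>lborel) = 0"
      using m unfolding diff_diff_eq by simp_all
  qed
  with AEJ show ?thesis by eventually_elim simp
qed

end
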